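(* Let $S\in\mathbb{S}^d_m$, $Y\in\mathcal{L}_2(\mathbb{R}^d)$, $\nu:=\mathrm{Law}(Y)$. Assume that the interior of the convex hull of $\operatorname{supp}\nu$ is non-empty and (A4) $h(SY)\ne0$ a.s. for every $h\in\mathcal{H}^j_C$ with index $j\in\{1,\dots,d\}$ and compact set $C\subset\{x\in\mathbb{R}^d:x^j=1,\ S(x,x)\ge0\}$. Then $\nu(\Sigma(P_G))=0$ for every $G\in\mathcal{M}(S)$ with $\mathbb{E}[\psi_G(Y)]<\infty$, and for every optimal set $G$ of the dual problem, $X:=P_G(Y)\mathbf{1}_{\{Y\notin\Sigma(P_G)\}}$ is the unique optimal map and $\mathrm{Law}(X,Y)$ is the unique optimal plan.
   Context: $\mathbb{S}^d_m$: symmetric invertible $d\times d$ real matrices with exactly $m$ positive eigenvalues; $S(x,y):=\langle x,Sy\rangle$. $G\subset\mathbb{R}^d$ is $S$-monotone if $S(x-y,x-y)\ge0$ for $x,y\in G$; maximal if not a strict subset of another $S$-monotone set; $\mathcal{M}(S)$ is the family of maximal $S$-monotone sets. $\psi_G(y):=\sup_{x\in G}(S(x,y)-\frac12S(x,x))$, $P_G(y):=\operatorname{argmax}_{x\in G}(S(x,y)-\frac12S(x,x))$. $\Sigma(P_G):=\{y:P_G(y)\ne\emptyset\text{ and not a single point}\}$. For $x\in\mathbb{R}^d$, $x^{-j}$ is $x$ without its $j$-th coordinate. For $j$ and compact $C$ with $y^j=1$ on $C$, $\mathcal{H}^j_C$ is the family of functions $h(x)=x^j+g_1(x^{-j})-g_2(x^{-j})$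 with $g_1,g_2$ convex on $\mathbb{R}^{d-1}$ of linear growth and $\nabla h(x)\in C$ whenever $g_1,g_2$ are differentiable at $x^{-j}$. $\mathcal{X}(Y):=\{X\in\mathcal{L}_2(\mathbb{R}^d):X\ Y\text{-measurable},\ \mathbb{E}[Y|X]=X\}$; optimal map: maximizer of $\frac12\mathbb{E}[S(X,Y)]$ over $\mathcal{X}(Y)$. $\Gamma(\nu)$: Borel probability measures on $\mathbb{R}^d\times\mathbb{R}^d$ (coordinates $(x,y)$) with finite second moments, second marginal $\nu$, conditional expectation of $y$ given $x$ equal to $x$; optimal plan: maximizer of $\frac12\int S(x,y)d\gamma$ over $\Gamma(\nu)$. Optimal set of the dual problem: minimizer of $\int\psi_H d\nu$ over $H\in\mathcal{M}(S)$. *)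

theory Defs
  imports "HOL-Analysis.Analysis" "HOL-Probability.Probability"
begin

text \<open>S^d_m: symmetric invertible matrices with exactly m positive eigenvalues
  (counted with multiplicity, via the spectral decomposition).\<close>
definition Sdm :: "nat \<Rightarrow> (real^'n::finite^'n) set" where
  "Sdm m = {S. transpose S = S \<and> invertible S \<and>
     (\<exists>U (lam :: 'n \<Rightarrow> real). orthogonal_matrix U \<and>
        S = U ** (\<chi> i j. if i = j then lam i else 0) ** transpose U \<and>
        card {i. lam i > 0} = m)}"

definition Sform :: "real^'n::finite^'n \<Rightarrow> real^'n \<Rightarrow> real^'n \<Rightarrow> real" where
  "Sform S x y = x \<bullet> (S *v y)"

definition S_monotone :: "real^'n::finite^'n \<Rightarrow> (real^'n) set \<Rightarrow> bool" where
  "S_monotone S G \<longleftrightarrow> (\<forall>x\<in>G. \<forall>y\<in>G. Sform S (x - y) (x - y) \<ge> 0)"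

definition maxmon :: "real^'n::finite^'n \<Rightarrow> (real^'n) set set" where
  "maxmon S = {G. S_monotone S G \<and> (\<forall>G'. S_monotone S G' \<and> G \<subseteq> G' \<longrightarrow> G' = G)}"

definition psi :: "real^'n::finite^'n \<Rightarrow> (real^'n) set \<Rightarrow> real^'n \<Rightarrow> ereal" where
  "psi S G y = (SUP x\<in>G. ereal (Sform S x y - Sform S x x / 2))"

definition PG :: "real^'n::finite^'n \<Rightarrow> (real^'n) set \<Rightarrow> real^'n \<Rightarrow> (real^'n) set" where
  "PG S G y = {x\<in>G. \<forall>x'\<in>G. Sform S x' y - Sform S x' x' / 2 \<le> Sform S x y - Sform S x x / 2}"

definition SigmaP :: "real^'n::finite^'n \<Rightarrow> (real^'n) set \<Rightarrow> (real^'n) set" where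
  "SigmaP S G = {y. PG S G y \<noteq> {} \<and> \<not> (\<exists>z. PG S G y = {z})}"

text \<open>A function on R^d that depends only on x^{-j} (i.e. a function on R^{d-1}).\<close>
definition indep_coord :: "'n::finite \<Rightarrow> (real^'n \<Rightarrow> real) \<Rightarrow> bool" where
  "indep_coord j g \<longleftrightarrow> (\<forall>x t. g (\<chi> i. if i = j then t else x $ i) = g x)"

definition lin_growth :: "(real^'n::finite \<Rightarrow> real) \<Rightarrow> bool" where
  "lin_growth g \<longleftrightarrow> (\<exists>c. \<forall>x. \<bar>g x\<bar> \<le> c * (1 + norm x))"

definition Hfam :: "'n::finite \<Rightarrow> (real^'n) set \<Rightarrow> (real^'n \<Rightarrow> real) set" where
  "Hfam j C = {h. \<exists>g1 g2. indep_coord j g1 \<and> indep_coord j g2 \<and>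
      convex_on UNIV g1 \<and> convex_on UNIV g2 \<and> lin_growth g1 \<and> lin_growth g2 \<and>
      h = (\<lambda>x. x $ j + g1 x - g2 x) \<and>
      (\<forall>x. g1 differentiable (at x) \<and> g2 differentiable (at x) \<longrightarrow>
          (\<exists>v\<in>C. (h has_derivative (\<lambda>z. v \<bullet> z)) (at x)))}"

definition msupp :: "('b::metric_space) measure \<Rightarrow> 'b set" where
  "msupp \<mu> = {x. \<forall>e>0. emeasure \<mu> (ball x e) > 0}"

definition L2vec :: "'a measure \<Rightarrow> ('a \<Rightarrow> real^'n::finite) \<Rightarrow> bool" where
  "L2vec M X \<longleftrightarrow> X \<in> borel_measurable M \<and> integrable M (\<lambda>\<omega>. (norm (X \<omega>))^2)"

definition cond_exp_self :: "'a measure \<Rightarrow> ('a \<Rightarrow> real^'n::finite) \<Rightarrow> ('a \<Rightarrow> real^'n) \<Rightarrow> bool" where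
  "cond_exp_self M Y X \<longleftrightarrow> (\<forall>i. AE \<omega> in M.
      real_cond_exp M (vimage_algebra (space M) X borel) (\<lambda>\<omega>. Y \<omega> $ i) \<omega> = X \<omega> $ i)"

definition Xset :: "'a measure \<Rightarrow> ('a \<Rightarrow> real^'n::finite) \<Rightarrow> ('a \<Rightarrow> real^'n) set" where
  "Xset M Y = {X. L2vec M X \<and> X \<in> borel_measurable (vimage_algebra (space M) Y borel)
                  \<and> cond_exp_self M Y X}"

definition optimal_map :: "'a measure \<Rightarrow> real^'n::finite^'n \<Rightarrow> ('a \<Rightarrow> real^'n) \<Rightarrow> ('a \<Rightarrow> real^'n) \<Rightarrow> bool" where
  "optimal_map M S Y X \<longleftrightarrow> X \<in> Xset M Y \<and>
     (\<forall>X'\<in>Xset M Y. (\<integral>\<omega>. Sform S (X' \<omega>) (Y \<omega>) \<partial>M) / 2 \<le> (\<integral>\<omega>. Sform S (X \<omega>) (Y \<omega>) \<partial>M) / 2)"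

definition Gamma :: "(real^'n::finite) measure \<Rightarrow> ((real^'n) \<times> (real^'n)) measure set" where
  "Gamma \<nu> = {\<gamma>. prob_space \<gamma> \<and> sets \<gamma> = sets borel \<and>
      (\<integral>\<^sup>+p. ennreal ((norm (fst p))^2 + (norm (snd p))^2) \<partial>\<gamma>) < \<infinity> \<and>
      distr \<gamma> borel snd = \<nu> \<and>
      (\<forall>i. AE p in \<gamma>. real_cond_exp \<gamma> (vimage_algebra (space \<gamma>) fst borel) (\<lambda>p. snd p $ i) p = fst p $ i)}"

definition optimal_plan :: "(real^'n::finite) measure \<Rightarrow> real^'n^'n \<Rightarrow> ((real^'n) \<times> (real^'n)) measure \<Rightarrow> bool" where
  "optimal_plan \<nu> S \<gamma> \<longleftrightarrow> \<gamma> \<in> Gamma \<nu> \<and>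
     (\<forall>\<gamma>'\<in>Gamma \<nu>. (\<integral>p. Sform S (fst p) (snd p) \<partial>\<gamma>') / 2 \<le> (\<integral>p. Sform S (fst p) (snd p) \<partial>\<gamma>) / 2)"

definition ext_int :: "'b measure \<Rightarrow> ('b \<Rightarrow> ereal) \<Rightarrow> ereal" where
  "ext_int \<mu> f = enn2ereal (\<integral>\<^sup>+x. e2ennreal (f x) \<partial>\<mu>) - enn2ereal (\<integral>\<^sup>+x. e2ennreal (- f x) \<partial>\<mu>)"

definition dual_optimal :: "real^'n::finite^'n \<Rightarrow> (real^'n) measure \<Rightarrow> (real^'n) set \<Rightarrow> bool" where
  "dual_optimal S \<nu> G \<longleftrightarrow> G \<in> maxmon S \<and> (\<forall>H\<in>maxmon S. ext_int \<nu> (psi S G) \<le> ext_int \<nu> (psi S H))"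

definition mapX :: "real^'n::finite^'n \<Rightarrow> (real^'n) set \<Rightarrow> ('a \<Rightarrow> real^'n) \<Rightarrow> 'a \<Rightarrow> real^'n" where
  "mapX S G Y \<omega> = (if Y \<omega> \<notin> SigmaP S G \<and> (\<exists>z. PG S G (Y \<omega>) = {z}) then the_elem (PG S G (Y \<omega>)) else 0)"

end

theory Submission
  imports Defs
begin

text \<open>
  Write \<open>q(x) = S(x,x)/2\<close>. A convex function above \<open>q\<close> dominates \<open>psi\<close> of some maximal \<open>S\<close>-monotone set
  (Zorn's lemma on convex subsets of the epigraph, plus a separation argument giving Minty's
  parametrisation of maximal monotone sets by the positive subspace). Hence a dual optimal \<open>G\<close> can be
  compared with every perturbation \<open>x \<mapsto> x + e \<kappa>(x) v\<close> of its points, because \<open>psi\<close> of the perturbed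
  set stays above \<open>q\<close>. Differentiating at \<open>e = 0\<close>, where the maximiser \<open>X = P_G(Y)\<close> is almost
  surely unique, yields \<open>E[\<kappa>(X)(Y - X)] = 0\<close>, the martingale property of \<open>X\<close>. Optimality and uniqueness
  follow by testing \<open>psi\<close> at the point of \<open>G\<close> having the same positive part as a given competitor.

  Uniqueness of the maximiser comes from (A4): two maximisers separated in the coordinate \<open>j\<close> put
  \<open>SY\<close> on a hypersurface where two maxima of affine functions with separated slopes agree, and such a
  hypersurface is the zero set of a difference of convex functions in \<open>Hfam\<close>. Points where the supremum is
  approached along an unbounded sequence lie on the boundary of the domain of \<open>psi\<close>, with an outer
  normal \<open>Su\<close>, \<open>S(u,u) \<ge> 0\<close>, and are covered by hypersurfaces of the same kind.
\<close>

section \<open>Maximal monotone sets in pseudo-Euclidean space\<close>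

text \<open>Completing the square gives \<open>ell S x y = qform S y - qform S (y - x)\<close>. So a
  set is monotone exactly when its \<open>psi\<close> does not exceed \<open>qform S\<close> on it,
  and for a maximal one \<open>psi\<close> is above \<open>qform S\<close> everywhere, with equality
  on the set. This is why the dual problem can be handled through convex functions above
  \<open>qform S\<close>: displaced points of \<open>G\<close> need not form a monotone set, and
  lying above \<open>qform S\<close> is a far weaker demand.

  Indefiniteness of the form has two further costs. A finite supremum in \<open>psi\<close> need not
  be attained, since \<open>G\<close> may contain unbounded sequences along which
  \<open>ell S x y\<close> stays high. And nothing is known at first about the integrability of the
  maximiser, so only fields \<open>\<kappa>\<close> of bounded support can be tested; its square
  integrability is then extracted from the resulting equations by testing with truncations of the
  maximiser itself.\<close>

definition qform :: "real^'n::finite^'n \<Rightarrow> real^'n \<Rightarrow> real" where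
  "qform S x = Sform S x x / 2"

definition ell :: "real^'n::finite^'n \<Rightarrow> real^'n \<Rightarrow> real^'n \<Rightarrow> real" where
  "ell S x y = Sform S x y - Sform S x x / 2"

lemma bounded_bilinear_Sform: "bounded_bilinear (Sform S)"
  unfolding Sform_def
  by (rule bounded_bilinear.comp[OF bounded_bilinear_inner bounded_linear_ident
        matrix_vector_mul_bounded_linear])

lemma continuous_on_Sform [continuous_intros]:
  assumes "continuous_on A f" "continuous_on A g"
  shows "continuous_on A (\<lambda>x. Sform S (f x) (g x))"
  using bounded_bilinear.continuous_on[OF bounded_bilinear_Sform assms] .

lemma continuous_on_qform [continuous_intros]:
  "continuous_on A f \<Longrightarrow> continuous_on A (\<lambda>x. qform S (f x))"
  unfolding qform_def by (intro continuous_intros) auto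

lemma continuous_on_ell [continuous_intros]:
  "continuous_on A f \<Longrightarrow> continuous_on A g \<Longrightarrow> continuous_on A (\<lambda>x. ell S (f x) (g x))"
  unfolding ell_def by (intro continuous_intros) auto

lemma Sform_bound: "\<exists>C>0. \<forall>x y. \<bar>Sform S x y\<bar> \<le> C * norm x * norm y"
proof -
  obtain K where "K > 0" "\<And>x y. norm (Sform S x y) \<le> norm x * norm y * K"
    using bounded_bilinear.pos_bounded[OF bounded_bilinear_Sform] by blast
  then show ?thesis by (auto simp: mult_ac intro!: exI[of _ K])
qed

lemma psi_ell: "psi S G y = (SUP x\<in>G. ereal (ell S x y))"
  unfolding psi_def ell_def ..

lemma psi_le_iff: "psi S G y \<le> ereal s \<longleftrightarrow> (\<forall>x\<in>G. ell S x y \<le> s)"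
  unfolding psi_ell by (simp add: SUP_le_iff)

lemma ell_le_psi: "x \<in> G \<Longrightarrow> ereal (ell S x y) \<le> psi S G y"
  unfolding psi_ell by (rule SUP_upper)

lemma PG_ell: "PG S G y = {x\<in>G. \<forall>x'\<in>G. ell S x' y \<le> ell S x y}"
  unfolding PG_def ell_def ..

lemma PG_psi: "x \<in> PG S G y \<Longrightarrow> psi S G y = ereal (ell S x y)"
  by (intro antisym ell_le_psi) (auto simp: PG_ell psi_le_iff)

text \<open>\<open>P\<close> is the \<open>S\<close>-orthogonal projection onto a maximal positive
  subspace. Together with symmetry and invertibility these properties replace the eigenvalue
  description; \<open>c\<close> makes negativity on the kernel quantitative, for the Lipschitz
  bounds.\<close>

locale pseudo_euclidean =
  fixes S :: "real^'n::finite^'n" and P :: "real^'n \<Rightarrow> real^'n" and c :: real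
  assumes symS: "transpose S = S" and linP: "linear P" and idemP: "P (P x) = P x"
    and orthP: "Sform S (P x) (y - P y) = 0"
    and posP: "P x \<noteq> 0 \<Longrightarrow> Sform S (P x) (P x) > 0"
    and c_pos: "c > 0" and negP: "Sform S (x - P x) (x - P x) \<le> - c * (norm (x - P x))\<^sup>2"
    and invS: "invertible S"
begin

sublocale form: bounded_bilinear "Sform S"
  by (rule bounded_bilinear_Sform)

lemma Sform_commute: "Sform S x y = Sform S y x"
  unfolding Sform_def by (metis dot_lmul_matrix inner_commute symS transpose_matrix_vector)

lemma qform_diff: "qform S (x - y) = qform S x + qform S y - Sform S x y"
  using Sform_commute[of x y] by (simp add: qform_def form.diff_left form.diff_right)

lemma qform_add: "qform S (x + y) = qform S x + qform S y + Sform S x y"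
  using Sform_commute[of x y] by (simp add: qform_def form.add_left form.add_right)

lemma qform_minus: "qform S (- x) = qform S x"
  by (simp add: qform_def form.minus_left form.minus_right)

lemma qform_scaleR: "qform S (t *\<^sub>R x) = t\<^sup>2 * qform S x"
  by (simp add: qform_def form.scaleR_left form.scaleR_right power2_eq_square)

lemma ell_qform: "ell S x y = qform S y - qform S (y - x)"
  unfolding qform_diff using Sform_commute[of x y] by (simp add: ell_def qform_def)

text \<open>The defect of \<open>qform S\<close> from being affine on a segment. Its sign gives
  convexity on the range of \<open>P\<close>, concavity on its kernel, and the room for adjoining a
  point in the Zorn argument.\<close>

lemma qform_convex_comb:
  assumes "u + v = 1"
  shows "qform S (u *\<^sub>R x + v *\<^sub>R y) = u * qform S x + v * qform S y - u * v * qform S (x - y)"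
proof -
  have v: "v = 1 - u" using assms by simp
  show ?thesis
    unfolding qform_add qform_diff qform_scaleR form.scaleR_left form.scaleR_right v
    by (simp add: algebra_simps power2_eq_square)
qed

lemma orthP': "P x = x \<Longrightarrow> P y = 0 \<Longrightarrow> Sform S x y = 0"
  using orthP[of x y] by simp

lemma P_diff: "P (x - y) = P x - P y" and P_add: "P (x + y) = P x + P y"
  and P_scaleR: "P (t *\<^sub>R x) = t *\<^sub>R P x"
  using linP by (simp_all add: linear_diff linear_add linear_cmul)

lemma qform_split: "qform S x = qform S (P x) + qform S (x - P x)"
  using qform_add[of "P x" "x - P x"] orthP[of x x] by simp

lemma qform_P_nonneg: "qform S (P x) \<ge> 0"
  using posP[of x] form.zero_left[of 0] unfolding qform_def by (cases "P x = 0") auto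

lemma qform_ker_nonpos: "P x = 0 \<Longrightarrow> qform S x \<le> 0"
  using negP[of x] c_pos unfolding qform_def
  by simp (metis less_eq_real_def mult_nonneg_nonneg neg_le_0_iff_le order_trans zero_le_power2)

lemma qform_ker_eq0: "P x = 0 \<Longrightarrow> qform S x \<ge> 0 \<Longrightarrow> x = 0"
  using negP[of x] c_pos unfolding qform_def
  by simp (smt (verit, best) mult_pos_pos norm_le_zero_iff zero_less_power2 norm_eq_zero)

lemma surj_S: "\<exists>b. n = S *v b"
proof -
  obtain B where "S ** B = mat 1"
    using invS unfolding invertible_def by blast
  then have "S *v (B *v n) = n" by (metis matrix_vector_mul_assoc matrix_vector_mul_lid)
  then show ?thesis by metis
qed

text \<open>Sandwich argument: an affine function separates the convex set, sheared by \<^term>\<open>a\<close>, from the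
  hypograph of the concave function \<^term>\<open>\<lambda>w. qform S (w - P w)\<close>; its slope is the negative part of
  the point sought.\<close>

lemma exists_minorant_with_positive_part:
  fixes E :: "((real^'n) \<times> real) set"
  assumes E: "convex E" "\<And>w s. (w, s) \<in> E \<Longrightarrow> qform S w \<le> s" and a: "P a = a"
  shows "\<exists>x. P x = a \<and> (\<forall>(w, s)\<in>E. ell S x w \<le> s)"
proof (cases "E = {}")
  case True
  then show ?thesis using a by auto
next
  case False
  \<comment> \<open>The point sought is \<open>a + b\<close> with \<open>P b = 0\<close>. By
    orthogonality its affine function is \<open>Sform S a w - qform S a\<close> plus
    \<open>ell S b w\<close>; the shear removes the first part, so that only \<open>b\<close>
    remains to be found.\<close>
  define f where "f = (\<lambda>p. (fst p, snd p - Sform S a (fst p) + qform S a) :: (real^'n) \<times> real)"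
  define T1 where "T1 = f ` E"
  define T2 where "T2 = {p. snd p < qform S (fst p - P (fst p))}"
  have "convex T1"
    unfolding convex_def T1_def
  proof (intro ballI allI impI, elim imageE)
    fix x y p q and u v :: real assume *: "0 \<le> u" "0 \<le> v" "u + v = 1" "x = f p" "p \<in> E" "y = f q" "q \<in> E"
    have "u *\<^sub>R p + v *\<^sub>R q \<in> E" using * E(1) by (simp add: convex_def)
    moreover have "u * qform S a + v * qform S a = qform S a"
      using * by (metis distrib_right mult_1)
    then have "u *\<^sub>R x + v *\<^sub>R y = f (u *\<^sub>R p + v *\<^sub>R q)"
      using * by (auto simp: f_def form.add_right form.scaleR_right algebra_simps)
    ultimately show "u *\<^sub>R x + v *\<^sub>R y \<in> f ` E" by auto
  qed
  moreover have "convex T2"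
    unfolding convex_def
  proof (intro ballI allI impI)
    fix x y u v assume *: "x \<in> T2" "y \<in> T2" "0 \<le> u" "0 \<le> v" "u + v = (1::real)"
    let ?N = "\<lambda>w. w - P w"
    have N: "?N (u *\<^sub>R fst x + v *\<^sub>R fst y) = u *\<^sub>R ?N (fst x) + v *\<^sub>R ?N (fst y)"
      by (simp add: P_add P_scaleR algebra_simps)
    have "qform S (?N (fst x) - ?N (fst y)) \<le> 0"
      by (rule qform_ker_nonpos) (simp add: P_diff idemP)
    then have "u * v * qform S (?N (fst x) - ?N (fst y)) \<le> 0"
      using * by (simp add: mult_nonneg_nonpos)
    then have "qform S (?N (u *\<^sub>R fst x + v *\<^sub>R fst y))
        \<ge> u * qform S (?N (fst x)) + v * qform S (?N (fst y))"
      unfolding N qform_convex_comb[OF *(5)] by simp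
    moreover have "u * snd x + v * snd y < u * qform S (?N (fst x)) + v * qform S (?N (fst y))"
    proof (cases "u = 0")
      case True then show ?thesis using * by (simp add: T2_def)
    next
      case False
      then have "u * snd x < u * qform S (?N (fst x))" "v * snd y \<le> v * qform S (?N (fst y))"
        using * by (auto simp: T2_def intro!: mult_left_mono)
      then show ?thesis by simp
    qed
    ultimately show "u *\<^sub>R x + v *\<^sub>R y \<in> T2" by (simp add: T2_def)
  qed
  moreover have "T1 \<noteq> {}" using False by (simp add: T1_def)
  moreover have "(0, -1) \<in> T2" by (simp add: T2_def linear_0[OF linP] qform_def form.zero_left)
  \<comment> \<open>A sheared point of \<open>E\<close> lies above \<open>qform S (w - a)\<close>.
    As \<open>P a = a\<close>, the kernel part of \<open>w - a\<close> is that of \<open>w\<close>,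
    and the positive part only adds.\<close>
  moreover have "T2 \<inter> T1 = {}"
  proof -
    have "snd p - Sform S a (fst p) + qform S a \<ge> qform S (fst p - P (fst p))" if "p \<in> E" for p
    proof -
      let ?w = "fst p"
      have "qform S (?w - a) = qform S (P (?w - a)) + qform S (?w - P ?w)"
        using qform_split[of "?w - a"] by (simp add: P_diff a)
      then have "qform S (?w - P ?w) \<le> qform S (?w - a)" using qform_P_nonneg[of "?w - a"] by simp
      also have "\<dots> = qform S ?w - Sform S a ?w + qform S a"
        by (simp add: qform_diff Sform_commute)
      finally show ?thesis using E(2)[of ?w "snd p"] that by simp
    qed
    then show ?thesis by (force simp: T1_def T2_def f_def)
  qed
  ultimately obtain d \<beta> where d: "d \<noteq> 0" and d2: "\<And>x. x \<in> T2 \<Longrightarrow> d \<bullet> x \<le> \<beta>"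
    and d1: "\<And>x. x \<in> T1 \<Longrightarrow> d \<bullet> x \<ge> \<beta>"
    using separating_hyperplane_sets[of T2 T1] by blast
  obtain n \<tau> where dn: "d = (n, \<tau>)" by (cases d)
  have d2': "n \<bullet> w + \<tau> * r \<le> \<beta>" if "r < qform S (w - P w)" for w r
    using d2[of "(w, r)"] that by (simp add: T2_def dn)
  \<comment> \<open>The hypograph is unbounded downwards, which excludes \<open>\<tau> < 0\<close>,
    and projects onto the whole space, which excludes \<open>\<tau> = 0\<close>.\<close>
  have "\<tau> \<ge> 0"
  proof (rule ccontr)
    assume "\<not> \<tau> \<ge> 0"
    then have t: "\<tau> < 0" by simp
    define r where "r = - (\<bar>\<beta>\<bar> + 1) / (- \<tau>)"
    have "r < 0" using t unfolding r_def by (intro divide_neg_pos) auto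
    moreover have "\<tau> * r = \<bar>\<beta>\<bar> + 1" using t by (simp add: r_def)
    ultimately show False
      using d2'[of r 0] by (simp add: linear_0[OF linP] qform_def form.zero_left)
  qed
  moreover have "\<tau> \<noteq> 0"
  proof
    assume t: "\<tau> = 0"
    then have n: "n \<noteq> 0" using d dn by (simp add: zero_prod_def)
    define w where "w = ((\<bar>\<beta>\<bar> + 1) / (n \<bullet> n)) *\<^sub>R n"
    have "n \<bullet> w = \<bar>\<beta>\<bar> + 1" using n by (simp add: w_def)
    then show False using d2'[of "qform S (w - P w) - 1" w] t by simp
  qed
  ultimately have t: "\<tau> > 0" by simp
  obtain b where b: "(-1 / \<tau>) *\<^sub>R n = S *v b" using surj_S by blast
  have "Sform S b w = - (n \<bullet> w) / \<tau>" for w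
    unfolding Sform_commute[of b w] unfolding Sform_def b[symmetric] by (simp add: inner_commute)
  then have nb: "n \<bullet> w = - \<tau> * Sform S b w" for w using t by simp
  have up: "qform S (w - P w) \<le> \<beta> / \<tau> + Sform S b w" for w
  proof (rule dense_le)
    fix r assume "r < qform S (w - P w)"
    from d2'[OF this] show "r \<le> \<beta> / \<tau> + Sform S b w"
      using t by (simp add: nb field_simps)
  qed
  have lo: "\<beta> / \<tau> + Sform S b w \<le> s - Sform S a w + qform S a" if "(w, s) \<in> E" for w s
  proof -
    have "(w, s - Sform S a w + qform S a) \<in> T1" using that by (force simp: T1_def f_def)
    from d1[OF this] show ?thesis using t by (simp add: dn nb field_simps)
  qed
  \<comment> \<open>On the line through \<open>P b\<close> the concave function is 0, so its affine
    majorant has slope 0 there; that slope is \<open>Sform S (P b) (P b)\<close>.\<close>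
  have "P b = 0"
  proof (rule ccontr)
    assume "P b \<noteq> 0"
    then have p: "Sform S (P b) (P b) > 0" by (rule posP)
    have e: "Sform S b (P b) = Sform S (P b) (P b)"
      using orthP[of b b] by (simp add: form.diff_right Sform_commute)
    define k where "k = - (\<bar>\<beta> / \<tau>\<bar> + 1) / Sform S (P b) (P b)"
    have "Sform S b (k *\<^sub>R P b) = - (\<bar>\<beta> / \<tau>\<bar> + 1)"
      using p by (simp add: form.scaleR_right e k_def)
    moreover have "0 \<le> \<beta> / \<tau> + Sform S b (k *\<^sub>R P b)"
      using up[of "k *\<^sub>R P b"] by (simp add: P_scaleR idemP qform_def form.zero_left)
    ultimately show False by linarith
  qed
  then have pb: "P (a + b) = a" by (simp add: P_add a)
  \<comment> \<open>Testing the majorant at \<open>b\<close> itself yields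
    \<open>- qform S b \<le> \<beta> / \<tau>\<close>, which fixes the constant term of
    \<open>ell S (a + b)\<close>.\<close>
  have "qform S b \<le> \<beta> / \<tau> + 2 * qform S b"
    using up[of b] \<open>P b = 0\<close> by (simp add: qform_def)
  moreover have "ell S (a + b) w = Sform S a w + Sform S b w - qform S a - qform S b" for w
    using orthP'[OF a \<open>P b = 0\<close>] qform_add[of a b] by (simp add: ell_def form.add_left qform_def field_simps)
  ultimately have "ell S (a + b) w \<le> s" if "(w, s) \<in> E" for w s using lo[OF that] by simp
  then show ?thesis using pb by (intro exI[of _ "a + b"]) auto
qed

section \<open>Monotone sets and their parametrisation by positive parts\<close>

lemma monotone_qform: "S_monotone S G \<longleftrightarrow> (\<forall>x\<in>G. \<forall>y\<in>G. qform S (x - y) \<ge> 0)"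
  by (simp add: S_monotone_def qform_def)

lemma monotoneD: "S_monotone S G \<Longrightarrow> x \<in> G \<Longrightarrow> y \<in> G \<Longrightarrow> qform S (x - y) \<ge> 0"
  by (simp add: monotone_qform)

lemma maxmon_monotone: "G \<in> maxmon S \<Longrightarrow> S_monotone S G"
  by (simp add: maxmon_def)

lemma maxmon_memI:
  assumes G: "G \<in> maxmon S" and x: "\<And>y. y \<in> G \<Longrightarrow> qform S (x - y) \<ge> 0"
  shows "x \<in> G"
proof -
  have "S_monotone S (insert x G)"
    using x maxmon_monotone[OF G] qform_minus[of "x - _"]
    by (auto simp: monotone_qform form.zero_left qform_def[of S 0])
  then show ?thesis using G unfolding maxmon_def by blast
qed

text \<open>A point of a monotone extension and the point of \<open>H\<close> with the same positive
  part differ by a vector in the kernel of \<open>P\<close> on which \<open>qform S\<close> is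
  nonnegative, hence by 0.\<close>

lemma maxmonI:
  assumes "S_monotone S H" and sec: "\<And>a. \<exists>x\<in>H. P x = P a"
  shows "H \<in> maxmon S"
proof -
  have "z \<in> H" if "S_monotone S H'" "H \<subseteq> H'" "z \<in> H'" for H' z
  proof -
    obtain x where x: "x \<in> H" "P x = P z" using sec by blast
    have "qform S (z - x) \<ge> 0" using x that(2) by (intro monotoneD[OF that(1,3)]) auto
    moreover have "P (z - x) = 0" using x by (simp add: P_diff)
    ultimately have "z - x = 0" by (rule qform_ker_eq0[rotated])
    then show ?thesis using x by simp
  qed
  then have "\<forall>H'. S_monotone S H' \<and> H \<subseteq> H' \<longrightarrow> H' = H" by blast
  then show ?thesis using assms(1) unfolding maxmon_def by blast
qed

text \<open>Enlarging a convex set leaves fewer affine minorants \<open>ell S x\<close>. For a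
  maximal \<open>E\<close> the contact point \<open>(x, qform S x)\<close> of every minorant already
  belongs to \<open>E\<close>, so any two minorants can be tested against each other, and that is
  monotonicity. Separation supplies a minorant over each positive part.\<close>

lemma exists_maxmon_below:
  fixes E0 :: "((real^'n) \<times> real) set"
  assumes E0: "convex E0" "\<And>w s. (w, s) \<in> E0 \<Longrightarrow> qform S w \<le> s"
  shows "\<exists>H\<in>maxmon S. \<forall>(w, s)\<in>E0. psi S H w \<le> ereal s"
proof -
  define \<A> where "\<A> = {E. convex E \<and> E0 \<subseteq> E \<and> (\<forall>(w, s)\<in>E. qform S w \<le> s)}"
  have "\<exists>E\<in>\<A>. \<forall>X\<in>\<A>. E \<subseteq> X \<longrightarrow> X = E"
  proof (rule subset_Zorn_nonempty)
    show "\<A> \<noteq> {}" using E0 by (auto simp: \<A>_def)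
    fix \<C> assume C: "\<C> \<noteq> {}" "subset.chain \<A> \<C>"
    then have CA: "\<And>E. E \<in> \<C> \<Longrightarrow> E \<in> \<A>" by (auto simp: subset.chain_def)
    have "convex (\<Union>\<C>)"
    proof (unfold convex_def, intro ballI allI impI)
      fix x y u v assume *: "x \<in> \<Union>\<C>" "y \<in> \<Union>\<C>" "0 \<le> u" "0 \<le> v" "u + v = (1::real)"
      then obtain X Y where XY: "X \<in> \<C>" "x \<in> X" "Y \<in> \<C>" "y \<in> Y" by blast
      then have "X \<subseteq> Y \<or> Y \<subseteq> X" using C(2) by (auto simp: subset.chain_def)
      then obtain Z where "Z \<in> \<C>" "x \<in> Z" "y \<in> Z" using XY by blast
      moreover have "convex Z" using CA[of Z] \<open>Z \<in> \<C>\<close> by (simp add: \<A>_def)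
      ultimately show "u *\<^sub>R x + v *\<^sub>R y \<in> \<Union>\<C>"
        using *(3-5) unfolding convex_def by blast
    qed
    moreover have "E0 \<subseteq> \<Union>\<C>" "\<forall>(w, s)\<in>\<Union>\<C>. qform S w \<le> s"
      using C(1) CA unfolding \<A>_def by fast+
    ultimately show "\<Union>\<C> \<in> \<A>" unfolding \<A>_def by blast
  qed
  then obtain E where EA: "E \<in> \<A>" and Emax: "\<And>X. X \<in> \<A> \<Longrightarrow> E \<subseteq> X \<Longrightarrow> X = E" by blast
  then have E: "convex E" "E0 \<subseteq> E" "\<And>w s. (w, s) \<in> E \<Longrightarrow> qform S w \<le> s"
    by (auto simp: \<A>_def)
  define H where "H = {x. \<forall>(w, s)\<in>E. ell S x w \<le> s}"
  have HE: "(x, qform S x) \<in> E" if "x \<in> H" for x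
  proof -
    define E' where "E' = convex hull (insert (x, qform S x) E)"
    have "qform S w \<le> s" if ws: "(w, s) \<in> E'" for w s
    proof (cases "E = {}")
      case True
      then show ?thesis using ws by (simp add: E'_def)
    next
      case False
      then obtain u v w' s' where *: "0 \<le> u" "0 \<le> v" "u + v = 1" "(w', s') \<in> E"
        "w = u *\<^sub>R x + v *\<^sub>R w'" "s = u * qform S x + v * s'"
        using ws by (auto simp: E'_def convex_hull_insert[OF False] convex_hull_eq[THEN iffD2, OF E(1)])
      have l: "qform S w' - qform S (x - w') \<le> s'"
        using \<open>x \<in> H\<close> *(4) qform_minus[of "x - w'"] by (auto simp: H_def ell_qform)
      \<comment> \<open>Averaging the minorant inequality (weight \<open>u\<close>) with
        \<open>qform S w' \<le> s'\<close> (weight \<open>v\<close>) leaves exactly the share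
        \<open>u * qform S (x - w')\<close> that \<open>qform_convex_comb\<close> subtracts.\<close>
      have "v * (qform S w' - u * qform S (x - w')) \<le> v * s'"
      proof (rule mult_left_mono[OF _ *(2)])
        have "s' = u * s' + v * s'" using *(3) by (metis distrib_right mult_1)
        moreover have "u * (qform S w' - qform S (x - w')) + v * qform S w' \<le> u * s' + v * s'"
          using l E(3)[OF *(4)] * by (intro add_mono mult_left_mono) auto
        moreover have "u * (qform S w' - qform S (x - w')) + v * qform S w' =
           (u + v) * qform S w' - u * qform S (x - w')" by (simp add: algebra_simps)
        ultimately show "qform S w' - u * qform S (x - w') \<le> s'" using *(3) by simp
      qed
      then show ?thesis unfolding *(5,6) qform_convex_comb[OF *(3)] by (simp add: algebra_simps)
    qed
    then have "E' \<in> \<A>" using E(2) hull_subset[of "insert (x, qform S x) E" convex]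
      by (auto simp: \<A>_def E'_def)
    moreover have "E \<subseteq> E'" unfolding E'_def using hull_subset[of "insert (x, qform S x) E" convex] by blast
    ultimately have "E' = E" by (rule Emax)
    then show ?thesis unfolding E'_def by (metis hull_inc insertI1)
  qed
  have "H \<in> maxmon S"
  proof (rule maxmonI)
    show "S_monotone S H"
      unfolding monotone_qform
    proof (intro ballI)
      fix x y assume "x \<in> H" "y \<in> H"
      then have "ell S y x \<le> qform S x" using HE[of x] by (auto simp: H_def)
      then show "qform S (x - y) \<ge> 0" by (simp add: ell_qform)
    qed
    fix a
    show "\<exists>x\<in>H. P x = P a"
      using exists_minorant_with_positive_part[OF E(1,3) idemP[of a]] by (auto simp: H_def)
  qed
  moreover have "psi S H w \<le> ereal s" if "(w, s) \<in> E0" for w s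
    using that E(2) by (auto simp: psi_le_iff H_def)
  ultimately show ?thesis by auto
qed

text \<open>If \<open>psi\<close> were smaller at \<open>w\<close>, then \<open>w\<close> would be
  monotone against all of \<open>G\<close>, hence a point of \<open>G\<close>, where
  \<open>ell S w w = qform S w\<close>.\<close>

lemma qform_le_psi:
  assumes G: "G \<in> maxmon S"
  shows "ereal (qform S w) \<le> psi S G w"
proof (rule ccontr)
  assume "\<not> ?thesis"
  then have l: "ell S x w < qform S w" if "x \<in> G" for x
    using ell_le_psi[OF that, of S w] by (metis ereal_less_eq(3) not_le order_trans)
  have "w \<in> G" using l by (intro maxmon_memI[OF G]) (auto simp: ell_qform less_imp_le)
  from l[OF this] show False by (simp add: ell_def qform_def)
qed

lemma convex_above_ell: "convex {(w, s). \<forall>x\<in>H. ell S x w \<le> s}"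
proof -
  have "{(w, s). \<forall>x\<in>H. ell S x w \<le> s} = (\<Inter>x\<in>H. {p. ell S x (fst p) \<le> snd p})" by auto
  moreover have "convex {p. ell S x (fst p) \<le> snd p}" for x
  proof (unfold convex_def, clarsimp)
    fix a b a' b' and u v :: real
    assume *: "ell S x a \<le> b" "ell S x a' \<le> b'" "0 \<le> u" "0 \<le> v" "u + v = 1"
    have "ell S x (u *\<^sub>R a + v *\<^sub>R a') = u * ell S x a + v * ell S x a'"
      using *(5) by (simp add: ell_def form.add_right form.scaleR_right algebra_simps)
       (metis add_divide_distrib distrib_right mult_1)
    also have "\<dots> \<le> u * b + v * b'" using * by (intro add_mono mult_left_mono) auto
    finally show "ell S x (u *\<^sub>R a + v *\<^sub>R a') \<le> u * b + v * b'" .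
  qed
  ultimately show ?thesis by (auto intro: convex_INT)
qed

text \<open>Minty's theorem. The epigraph of \<open>psi\<close> has a minorant with the prescribed
  positive part; since the epigraph contains all points \<open>(y, qform S y)\<close> with
  \<open>y \<in> G\<close>, this minorant comes from a point monotone against
  \<open>G\<close>.\<close>

lemma maxmon_section:
  assumes G: "G \<in> maxmon S"
  shows "\<exists>x\<in>G. P x = P a"
proof -
  define E where "E = {(w, s). \<forall>x\<in>G. ell S x w \<le> s}"
  have "convex E" unfolding E_def by (rule convex_above_ell)
  moreover have "qform S w \<le> s" if "(w, s) \<in> E" for w s
    using that qform_le_psi[OF G, of w] by (auto simp: E_def psi_le_iff[symmetric] dest: order_trans)
  ultimately obtain x where x: "P x = P a" "\<forall>(w, s)\<in>E. ell S x w \<le> s"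
    using exists_minorant_with_positive_part[OF _ _ idemP[of a], of E] by blast
  have "x \<in> G"
  proof (rule maxmon_memI[OF G])
    fix y assume y: "y \<in> G"
    have "(y, qform S y) \<in> E"
      using monotoneD[OF maxmon_monotone[OF G] y] by (simp add: E_def ell_qform)
    then have "ell S x y \<le> qform S y" using x by auto
    then show "qform S (x - y) \<ge> 0" using qform_minus[of "x - y"] by (simp add: ell_qform)
  qed
  then show ?thesis using x by auto
qed

lemma maxmon_ne: "G \<in> maxmon S \<Longrightarrow> G \<noteq> {}"
  using maxmon_section by blast

lemma maxmon_closed:
  assumes G: "G \<in> maxmon S"
  shows "closed G"
proof -
  have "G = (\<Inter>y\<in>G. {x. 0 \<le> qform S (x - y)})"
    using maxmon_memI[OF G] monotoneD[OF maxmon_monotone[OF G]] by blast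
  moreover have "closed {x. 0 \<le> qform S (x - y)}" for y
    by (intro closed_Collect_le continuous_intros)
  ultimately show ?thesis by (metis (no_types, lifting) closed_INT)
qed

text \<open>When \<open>qform S d \<ge> 0\<close>, the negative part of \<open>d\<close> is
  outweighed by the positive one; \<open>C\<close> bounds the form from above and \<open>c\<close>
  its negativity from below.\<close>

lemma monotone_Lipschitz:
  "\<exists>L. L > 0 \<and> (\<forall>d. qform S d \<ge> 0 \<longrightarrow> norm d \<le> L * norm (P d))"
proof -
  obtain C where C: "C > 0" "\<And>x y. \<bar>Sform S x y\<bar> \<le> C * norm x * norm y"
    using Sform_bound by blast
  have "norm d \<le> (sqrt (C / c) + 1) * norm (P d)" if "qform S d \<ge> 0" for d
  proof -
    have "c * (norm (d - P d))\<^sup>2 \<le> Sform S (P d) (P d)"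
      using that qform_split[of d] negP[of d] by (simp add: qform_def)
    also have "\<dots> \<le> C * norm (P d) * norm (P d)" using C(2)[of "P d" "P d"] by simp
    finally have "(norm (d - P d))\<^sup>2 \<le> (C / c) * (norm (P d))\<^sup>2"
      using c_pos by (simp add: field_simps power2_eq_square)
    then have "norm (d - P d) \<le> sqrt (C / c) * norm (P d)"
      using real_le_rsqrt real_sqrt_mult by (metis norm_ge_zero real_sqrt_abs abs_of_nonneg)
    moreover have "norm d \<le> norm (d - P d) + norm (P d)"
      using norm_triangle_ineq[of "d - P d" "P d"] by simp
    ultimately show ?thesis by (simp add: algebra_simps)
  qed
  moreover have "sqrt (C / c) + 1 > 0" using C c_pos by (simp add: add_nonneg_pos)
  ultimately show ?thesis by blast
qed

text \<open>The choice is forced when \<open>G\<close> is maximal monotone: two points of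
  \<open>G\<close> with equal positive parts coincide. Defined on the whole space, it depends on
  \<open>z\<close> through \<open>P z\<close> only.\<close>

definition section_of :: "(real^'n) set \<Rightarrow> real^'n \<Rightarrow> real^'n" where
  "section_of G z = (SOME x. x \<in> G \<and> P x = P z)"

lemma section_of:
  assumes "G \<in> maxmon S"
  shows "section_of G z \<in> G" "P (section_of G z) = P z"
  using someI_ex[of "\<lambda>x. x \<in> G \<and> P x = P z"] maxmon_section[OF assms, of z]
  unfolding section_of_def by blast+

lemma section_of_Lipschitz:
  assumes G: "G \<in> maxmon S"
  shows "\<exists>L>0. \<forall>z z'. norm (section_of G z - section_of G z') \<le> L * norm (z - z')"
proof -
  obtain L where L: "L > 0" "\<And>d. qform S d \<ge> 0 \<Longrightarrow> norm d \<le> L * norm (P d)"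
    using monotone_Lipschitz by blast
  obtain K where K: "K > 0" "\<And>x. norm (P x) \<le> norm x * K"
    using bounded_linear.pos_bounded[of P] linear_conv_bounded_linear[of P] linP by blast
  have "norm (section_of G z - section_of G z') \<le> (L * K) * norm (z - z')" for z z'
  proof -
    have "norm (section_of G z - section_of G z') \<le> L * norm (P (z - z'))"
      using L(2)[of "section_of G z - section_of G z'"] monotoneD[OF maxmon_monotone[OF G]]
        section_of[OF G] by (simp add: P_diff)
    also have "\<dots> \<le> L * (norm (z - z') * K)" using L(1) K(2) by (intro mult_left_mono) auto
    finally show ?thesis by (simp add: mult_ac)
  qed
  then show ?thesis using L K by (intro exI[of _ "L * K"]) auto
qed

lemma section_of_continuous:
  assumes G: "G \<in> maxmon S"
  shows "continuous_on A (section_of G)"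
proof -
  obtain L where "L > 0" "\<forall>z z'. norm (section_of G z - section_of G z') \<le> L * norm (z - z')"
    using section_of_Lipschitz[OF G] by blast
  then have "L-lipschitz_on A (section_of G)"
    by (auto simp: lipschitz_on_def dist_norm)
  then show ?thesis by (rule lipschitz_on_continuous_on)
qed

end

section \<open>The positive projection from the spectral decomposition\<close>

lemma Sdm_pseudo_euclidean:
  fixes S :: "real^'n::finite^'n"
  assumes "S \<in> Sdm m"
  shows "\<exists>P c. pseudo_euclidean S P c"
proof -
  obtain U and lam :: "'n \<Rightarrow> real" where sym: "transpose S = S" and inv: "invertible S"
    and U: "orthogonal_matrix U"
    and Seq: "S = U ** (\<chi> i j. if i = j then lam i else 0) ** transpose U"
    using assms unfolding Sdm_def by blast
  have UU: "transpose U ** U = mat 1" "U ** transpose U = mat 1"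
    using U unfolding orthogonal_matrix_def by auto
  define t where "t = (\<lambda>x. transpose U *v x)"
  have tU: "t (U *v x) = x" "U *v t x = x" for x
    unfolding t_def matrix_vector_mul_assoc UU by simp_all
  have t_lin: "t (x + y) = t x + t y" "t (x - y) = t x - t y" "t (r *\<^sub>R x) = r *\<^sub>R t x" for x y r
    unfolding t_def matrix_vector_right_distrib matrix_vector_mult_diff_distrib
      matrix_vector_mult_scaleR by (rule refl)+
  have diag: "((\<chi> i j. if i = j then lam i else 0) :: real^'n^'n) *v y = (\<chi> i. lam i * y $ i)" for y
    by (simp add: vec_eq_iff matrix_vector_mult_def if_distrib if_distribR cong: if_cong)
  have SF: "Sform S x y = (\<Sum>i\<in>UNIV. lam i * t x $ i * t y $ i)" for x y
  proof -
    have "S *v y = U *v (\<chi> i. lam i * t y $ i)"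
      unfolding Seq by (simp add: t_def matrix_vector_mul_assoc[symmetric] diag)
    then have "Sform S x y = t x \<bullet> (\<chi> i. lam i * t y $ i)"
      by (simp add: Sform_def t_def dot_lmul_matrix)
    then show ?thesis by (simp add: inner_vec_def mult_ac)
  qed
  have lam0: "lam i \<noteq> 0" for i
  proof
    assume 0: "lam i = 0"
    have "S *v (U *v axis i 1) = U *v (\<chi> k. lam k * t (U *v axis i 1) $ k)"
      unfolding Seq by (simp add: t_def matrix_vector_mul_assoc[symmetric] diag)
    also have "(\<chi> k. lam k * t (U *v axis i 1) $ k) = 0"
      using 0 by (simp add: tU vec_eq_iff axis_def)
    finally have "S *v (U *v axis i 1) = 0" by simp
    then have "U *v axis i 1 = 0" using inv
      by (metis invertible_def matrix_vector_mul_assoc matrix_vector_mul_lid matrix_vector_mult_0_right)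
    then have "axis i (1::real) = 0" using tU(1)[of "axis i 1"] by (simp add: t_def)
    then show False by (simp add: axis_eq_0_iff)
  qed
  have tnorm: "(norm (t x))\<^sup>2 = (norm x)\<^sup>2" for x
  proof -
    have "t x \<bullet> t x = x \<bullet> (U *v t x)"
      unfolding t_def by (simp add: dot_lmul_matrix)
    then show ?thesis using tU(2)[of x] by (simp add: power2_norm_eq_inner)
  qed
  define P where "P = (\<lambda>x. U *v (\<chi> i. if lam i > 0 then t x $ i else 0))"
  have tP: "t (P x) $ i = (if lam i > 0 then t x $ i else 0)" for x i
    by (simp add: P_def tU)
  have t_inj: "x = y" if "t x = t y" for x y using that tU(2) by metis
  \<comment> \<open>The least modulus of an eigenvalue, positive because invertibility excludes the
    eigenvalue 0.\<close>
  define c where "c = Min (range (\<lambda>i. \<bar>lam i\<bar>))"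
  have c: "c > 0" unfolding c_def using lam0 by (subst Min_gr_iff) auto
  have cl: "c \<le> \<bar>lam i\<bar>" for i unfolding c_def by (rule Min_le) auto
  have "pseudo_euclidean S P c"
  proof
    show "transpose S = S" "invertible S" "c > 0" by fact+
    show "P (x + y) = P x + P y" "P (r *\<^sub>R x) = r *\<^sub>R P x" for x y r
      by (rule t_inj; simp add: vec_eq_iff t_lin tP)+
    show "P (P x) = P x" for x
      by (rule t_inj) (simp add: vec_eq_iff tP)
    show "Sform S (P x) (y - P y) = 0" for x y
      unfolding SF by (rule sum.neutral) (simp add: t_lin tP)
    show "Sform S (P x) (P x) > 0" if "P x \<noteq> 0" for x
    proof -
      have "t (P x) \<noteq> 0" using that t_inj[of "P x" 0] by (auto simp: t_def)
      then obtain i where i: "t (P x) $ i \<noteq> 0" by (auto simp: vec_eq_iff)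
      have "lam k * t (P x) $ k * t (P x) $ k \<ge> 0" for k
        by (simp add: tP mult.assoc)
      moreover have "lam i * t (P x) $ i * t (P x) $ i > 0"
        using i by (auto simp: tP mult.assoc split: if_splits)
          (metis mult_pos_pos not_real_square_gt_zero)
      ultimately show ?thesis unfolding SF by (intro sum_pos2[where i = i]) auto
    qed
    show "Sform S (x - P x) (x - P x) \<le> - c * (norm (x - P x))\<^sup>2" for x
    proof -
      let ?z = "t (x - P x)"
      have "Sform S (x - P x) (x - P x) \<le> (\<Sum>i\<in>UNIV. - c * (?z $ i * ?z $ i))"
        unfolding SF
      proof (rule sum_mono)
        fix i
        have "lam i * (?z $ i * ?z $ i) \<le> - c * (?z $ i * ?z $ i)"
        proof (cases "lam i > 0")
          case True then show ?thesis by (simp add: t_lin tP)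
        next
          case False
          then have "lam i \<le> - c" using cl[of i] by linarith
          then show ?thesis by (intro mult_right_mono) auto
        qed
        then show "lam i * ?z $ i * ?z $ i \<le> - c * (?z $ i * ?z $ i)" by (simp add: mult.assoc)
      qed
      also have "\<dots> = - c * (?z \<bullet> ?z)" by (simp add: inner_vec_def sum_distrib_left)
      finally show ?thesis by (simp add: power2_norm_eq_inner[symmetric] tnorm)
    qed
  qed
  then show ?thesis by blast
qed

section \<open>Hypersurfaces where two maxima of affine functions agree\<close>

text \<open>A pair \<open>(a, b)\<close> stands for the affine function
  \<open>a \<bullet> z - b\<close>. It is used for compact \<open>A\<close>, where the supremum is
  finite and attained, unlike the one in \<open>psi\<close>.\<close>

definition fmax :: "((real^'n::finite) \<times> real) set \<Rightarrow> real^'n \<Rightarrow> real" where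
  "fmax A z = Sup ((\<lambda>p. fst p \<bullet> z - snd p) ` A)"

lemma fmax_attained:
  assumes "compact A" "A \<noteq> {}"
  shows "\<exists>p\<in>A. fmax A z = fst p \<bullet> z - snd p \<and> (\<forall>p'\<in>A. fst p' \<bullet> z - snd p' \<le> fmax A z)"
proof -
  have "continuous_on A (\<lambda>p. fst p \<bullet> z - snd p)" by (intro continuous_intros)
  then obtain p where p: "p \<in> A" "\<And>p'. p' \<in> A \<Longrightarrow> fst p' \<bullet> z - snd p' \<le> fst p \<bullet> z - snd p"
    using continuous_attains_sup[OF assms] by blast
  then have "fmax A z = fst p \<bullet> z - snd p"
    unfolding fmax_def by (intro cSup_eq_maximum) auto
  then show ?thesis using p by auto
qed

lemma convex_on_if_supported:
  fixes g :: "'a::real_inner \<Rightarrow> real"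
  assumes "\<And>x. \<exists>d. \<forall>y. g y \<ge> g x + d \<bullet> (y - x)"
  shows "convex_on UNIV g"
proof (rule convex_onI)
  fix t and x y :: 'a assume t: "0 < t" "t < (1::real)"
  let ?z = "(1 - t) *\<^sub>R x + t *\<^sub>R y"
  obtain d where d: "\<And>w. g w \<ge> g ?z + d \<bullet> (w - ?z)" using assms by blast
  have "(1 - t) * (g ?z + d \<bullet> (x - ?z)) + t * (g ?z + d \<bullet> (y - ?z)) \<le> (1 - t) * g x + t * g y"
    using d t by (intro add_mono mult_left_mono) auto
  moreover have "(1 - t) * (g ?z + d \<bullet> (x - ?z)) + t * (g ?z + d \<bullet> (y - ?z)) =
     g ?z + d \<bullet> ((1 - t) *\<^sub>R (x - ?z) + t *\<^sub>R (y - ?z))"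
    unfolding inner_add_right inner_scaleR_right by (simp add: algebra_simps)
  moreover have "(1 - t) *\<^sub>R (x - ?z) + t *\<^sub>R (y - ?z) = 0" by (simp add: algebra_simps)
  ultimately show "g ?z \<le> (1 - t) * g x + t * g y" by simp
qed simp

definition upd :: "'n::finite \<Rightarrow> real^'n \<Rightarrow> real \<Rightarrow> real^'n" where
  "upd j z t = (\<chi> i. if i = j then t else z $ i)"

lemma upd_alt: "upd j z t = z + (t - z $ j) *\<^sub>R axis j 1"
  by (simp add: upd_def vec_eq_iff axis_def)

lemma upd_upd [simp]: "upd j (upd j z s) t = upd j z t"
  by (simp add: upd_def vec_eq_iff)

lemma inner_upd: "a \<bullet> upd j z t = (a - a $ j *\<^sub>R axis j 1) \<bullet> z + a $ j * t"
  by (simp add: upd_alt inner_add_right inner_diff_left inner_axis inner_axis' algebra_simps)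

text \<open>Writing the hypersurface \<^term>\<open>fmax A z = fmax B z\<close> as a graph \<^term>\<open>z $ j = T z\<close>, and letting \<open>v\<close>
  be the common value there, both \<open>v - \<alpha> T\<close> and \<open>v - \<beta> T\<close> are convex: at each point, a convex
  combination of the supporting inequalities of the two maxima has slope exactly \<open>\<alpha>\<close>, respectively
  \<open>\<beta>\<close>, in the variable \<open>T\<close>.\<close>

lemma hypersurface_Hfam:
  fixes A B :: "((real^'n::finite) \<times> real) set"
  assumes A: "compact A" "A \<noteq> {}" and B: "compact B" "B \<noteq> {}"
    and sep: "\<And>p r. p \<in> A \<Longrightarrow> r \<in> B \<Longrightarrow> fst p $ j > fst r $ j"
  defines "C \<equiv> (\<lambda>(p, r). (1 / (fst p $ j - fst r $ j)) *\<^sub>R (fst p - fst r)) ` (A \<times> B)"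
  shows "compact C" "\<exists>h\<in>Hfam j C. \<forall>z. h z = 0 \<longleftrightarrow> fmax A z = fmax B z"
proof -
  have ne: "fst p $ j - fst r $ j \<noteq> 0" if "p \<in> A" "r \<in> B" for p r using sep[OF that] by simp
  show "compact C"
    unfolding C_def case_prod_beta
    using ne by (intro compact_continuous_image compact_Times A B continuous_intros) auto
  have "continuous_on A (\<lambda>p. fst p $ j)" "continuous_on B (\<lambda>p. fst p $ j)"
    by (intro continuous_intros)+
  then obtain pa pb where pa: "pa \<in> A" "\<And>p. p \<in> A \<Longrightarrow> fst pa $ j \<le> fst p $ j"
    and pb: "pb \<in> B" "\<And>p. p \<in> B \<Longrightarrow> fst p $ j \<le> fst pb $ j"
    using continuous_attains_inf[OF A] continuous_attains_sup[OF B] by blast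
  define \<alpha> \<beta> where "\<alpha> = fst pa $ j" and "\<beta> = fst pb $ j"
  define \<delta> where "\<delta> = \<alpha> - \<beta>"
  have \<delta>: "\<delta> > 0" using sep[OF pa(1) pb(1)] by (simp add: \<delta>_def \<alpha>_def \<beta>_def)
  have al: "\<alpha> \<le> fst p $ j" if "p \<in> A" for p using pa(2)[OF that] by (simp add: \<alpha>_def)
  have be: "fst p $ j \<le> \<beta>" if "p \<in> B" for p using pb(2)[OF that] by (simp add: \<beta>_def)
  define k where "k = (\<lambda>z. fmax A z - fmax B z)"
  obtain R where R: "R > 0" "\<And>p. p \<in> A \<union> B \<Longrightarrow> norm p \<le> R"
    using compact_imp_bounded[OF compact_Un[OF A(1) B(1)]] by (auto simp: bounded_pos)
  have Rf: "norm (fst p) \<le> R" "\<bar>snd p\<bar> \<le> R" if "p \<in> A \<union> B" for p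
    using R(2)[OF that] norm_fst_le[of "fst p" "snd p"] norm_snd_le[of "snd p" "fst p"] by auto
  have fl1: "fmax D z - fmax D z' \<le> R * norm (z - z')" if D: "compact D" "D \<noteq> {}" "D \<subseteq> A \<union> B" for D z z'
  proof -
    obtain p where p: "p \<in> D" "fmax D z = fst p \<bullet> z - snd p" using fmax_attained[OF D(1,2)] by blast
    have "fmax D z' \<ge> fst p \<bullet> z' - snd p" using fmax_attained[OF D(1,2), of z'] p by auto
    then have "fmax D z - fmax D z' \<le> fst p \<bullet> (z - z')" using p by (simp add: inner_diff_right)
    also have "\<dots> \<le> norm (fst p) * norm (z - z')" by (rule norm_cauchy_schwarz)
    also have "\<dots> \<le> R * norm (z - z')" using Rf(1)[of p] p D(3) by (intro mult_right_mono) auto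
    finally show ?thesis .
  qed
  have fl: "\<bar>fmax D z - fmax D z'\<bar> \<le> R * norm (z - z')" if "compact D" "D \<noteq> {}" "D \<subseteq> A \<union> B" for D z z'
    using fl1[OF that, of z z'] fl1[OF that, of z' z] by (simp add: abs_le_iff norm_minus_commute)
  have fg: "\<bar>fmax D z\<bar> \<le> R * norm z + R" if D: "compact D" "D \<noteq> {}" "D \<subseteq> A \<union> B" for D z
  proof -
    obtain p where p: "p \<in> D" "fmax D 0 = - snd p" using fmax_attained[OF D(1,2), of 0] by auto
    then have "\<bar>fmax D 0\<bar> \<le> R" using Rf(2)[of p] D(3) by auto
    then show ?thesis using fl[OF D, of z 0] by simp
  qed
  have fc: "continuous_on UNIV (fmax D)" if D: "compact D" "D \<noteq> {}" "D \<subseteq> A \<union> B" for D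
  proof -
    have "R-lipschitz_on UNIV (fmax D)" using fl[OF D] R(1) by (auto simp: lipschitz_on_def dist_norm)
    then show ?thesis by (rule lipschitz_on_continuous_on)
  qed
  \<comment> \<open>The \<open>j\<close>-slopes are at least \<open>\<alpha>\<close> in
    \<open>A\<close> and at most \<open>\<beta>\<close> in \<open>B\<close>, so \<open>k\<close>
    grows at rate at least \<open>\<delta>\<close> and has exactly one zero on each line parallel to
    the axis \<open>j\<close>: the hypersurface is a graph.\<close>
  have kinc: "k (upd j z t') \<ge> k (upd j z t) + \<delta> * (t' - t)" if "t \<le> t'" for z t t'
  proof -
    obtain p where p: "p \<in> A" "fmax A (upd j z t) = fst p \<bullet> upd j z t - snd p"
      using fmax_attained[OF A] by blast
    obtain r where r: "r \<in> B" "fmax B (upd j z t') = fst r \<bullet> upd j z t' - snd r"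
      using fmax_attained[OF B] by blast
    have "fmax A (upd j z t') \<ge> fst p \<bullet> upd j z t' - snd p" using fmax_attained[OF A, of "upd j z t'"] p by auto
    moreover have "fmax B (upd j z t) \<ge> fst r \<bullet> upd j z t - snd r" using fmax_attained[OF B, of "upd j z t"] r by auto
    ultimately have "k (upd j z t') - k (upd j z t) \<ge> (fst p $ j) * (t' - t) - (fst r $ j) * (t' - t)"
      unfolding k_def p r inner_upd by (simp add: algebra_simps)
    moreover have "(fst p $ j) * (t' - t) \<ge> \<alpha> * (t' - t)" "(fst r $ j) * (t' - t) \<le> \<beta> * (t' - t)"
      using al[OF p(1)] be[OF r(1)] that by (auto intro!: mult_right_mono)
    ultimately show ?thesis by (simp add: \<delta>_def algebra_simps)
  qed
  have "\<exists>t. k (upd j z t) = 0" for z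
  proof -
    define s where "s = \<bar>k (upd j z 0)\<bar> / \<delta>"
    have s: "s \<ge> 0" "\<delta> * s = \<bar>k (upd j z 0)\<bar>" using \<delta> by (auto simp: s_def)
    have "k (upd j z s) \<ge> 0" "k (upd j z (- s)) \<le> 0"
      using kinc[of 0 s z] kinc[of "- s" 0 z] s by auto
    moreover have "continuous_on {- s..s} (\<lambda>t. k (upd j z t))"
      unfolding k_def upd_alt
      by (intro continuous_intros continuous_on_compose2[OF fc[OF A]] continuous_on_compose2[OF fc[OF B]]) auto
    ultimately show ?thesis using IVT'[of "\<lambda>t. k (upd j z t)" "- s" 0 s] s(1) by auto
  qed
  then obtain T where T: "\<And>z. k (upd j z (T z)) = 0" by metis
  have Tu: "T z = t" if "k (upd j z t) = 0" for z t
  proof (rule ccontr)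
    assume "T z \<noteq> t"
    then consider "T z < t" | "t < T z" by linarith
    then show False
    proof cases
      case 1
      then have "0 < \<delta> * (t - T z)" using \<delta> by simp
      then show False using kinc[of "T z" t z] T[of z] that 1 by linarith
    next
      case 2
      then have "0 < \<delta> * (T z - t)" using \<delta> by simp
      then show False using kinc[of t "T z" z] T[of z] that 2 by linarith
    qed
  qed
  have Tupd: "T (upd j z s) = T z" for z s using Tu[of "upd j z s" "T z"] T[of z] by simp
  define v where "v = (\<lambda>z. fmax A (upd j z (T z)))"
  have vB: "v z = fmax B (upd j z (T z))" for z using T[of z] by (simp add: v_def k_def)
  define pr where "pr = (\<lambda>a::real^'n. a - a $ j *\<^sub>R axis j 1)"
  \<comment> \<open>Functions of \<open>A\<close> and \<open>B\<close> active at the point of the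
    graph over \<open>z0\<close> support \<open>v\<close> from below; their \<open>j\<close>-th
    variable has become \<open>T\<close>, and \<open>pr\<close> keeps the remaining slopes.\<close>
  have supp: "\<exists>p\<in>A. \<exists>r\<in>B. (\<forall>z. v z - v z0 - fst p $ j * (T z - T z0) \<ge> pr (fst p) \<bullet> (z - z0))
       \<and> (\<forall>z. v z - v z0 - fst r $ j * (T z - T z0) \<ge> pr (fst r) \<bullet> (z - z0))" for z0
  proof -
    obtain p where p: "p \<in> A" "v z0 = fst p \<bullet> upd j z0 (T z0) - snd p"
      using fmax_attained[OF A] unfolding v_def by blast
    obtain r where r: "r \<in> B" "v z0 = fst r \<bullet> upd j z0 (T z0) - snd r"
      using fmax_attained[OF B] unfolding vB by blast
    have "v z \<ge> fst p \<bullet> upd j z (T z) - snd p" for z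
      using fmax_attained[OF A, of "upd j z (T z)"] p(1) unfolding v_def by auto
    then have 1: "v z - v z0 - fst p $ j * (T z - T z0) \<ge> pr (fst p) \<bullet> (z - z0)" for z
      unfolding p(2) inner_upd pr_def inner_diff_right[of _ z z0]
      by (simp add: right_diff_distrib le_diff_eq add.commute) (smt (verit))
    have "v z \<ge> fst r \<bullet> upd j z (T z) - snd r" for z
      using fmax_attained[OF B, of "upd j z (T z)"] r(1) unfolding vB by auto
    then have 2: "v z - v z0 - fst r $ j * (T z - T z0) \<ge> pr (fst r) \<bullet> (z - z0)" for z
      unfolding r(2) inner_upd pr_def inner_diff_right[of _ z z0]
      by (simp add: right_diff_distrib le_diff_eq add.commute) (smt (verit))
    show ?thesis using p r 1 2 by blast
  qed
  have cvx: "convex_on UNIV (\<lambda>z. (v z - l * T z) / \<delta>)" if l: "\<beta> \<le> l" "l \<le> \<alpha>" for l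
  proof (rule convex_on_if_supported)
    fix x
    obtain p r where p: "p \<in> A" "\<And>z. v z - v x - fst p $ j * (T z - T x) \<ge> pr (fst p) \<bullet> (z - x)"
      and r: "r \<in> B" "\<And>z. v z - v x - fst r $ j * (T z - T x) \<ge> pr (fst r) \<bullet> (z - x)"
      using supp[of x] by blast
    \<comment> \<open>The weight for which the two \<open>j\<close>-slopes average to
      \<open>l\<close>. It lies in \<open>[0,1]\<close> because \<open>fst r $ j \<le> \<beta> \<le>
      l \<le> \<alpha> \<le> fst p $ j\<close>.\<close>
    define \<theta> where "\<theta> = (l - fst r $ j) / (fst p $ j - fst r $ j)"
    have "0 \<le> \<theta>" "\<theta> \<le> 1" "\<theta> * (fst p $ j - fst r $ j) = l - fst r $ j"
      using sep[OF p(1) r(1)] al[OF p(1)] be[OF r(1)] l by (auto simp: \<theta>_def)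
    then have th: "0 \<le> \<theta>" "\<theta> \<le> 1" "\<theta> * fst p $ j + (1 - \<theta>) * fst r $ j = l"
      by (auto simp: algebra_simps)
    have "(v y - l * T y) / \<delta> \<ge> (v x - l * T x) / \<delta> + ((\<theta> / \<delta>) *\<^sub>R pr (fst p) + ((1 - \<theta>) / \<delta>) *\<^sub>R pr (fst r)) \<bullet> (y - x)" for y
    proof -
      let ?d = "T y - T x"
      have "\<theta> * (pr (fst p) \<bullet> (y - x)) + (1 - \<theta>) * (pr (fst r) \<bullet> (y - x))
        \<le> \<theta> * (v y - v x - fst p $ j * ?d) + (1 - \<theta>) * (v y - v x - fst r $ j * ?d)"
        using th p r by (intro add_mono mult_left_mono) auto
      also have "\<dots> = v y - v x - (\<theta> * fst p $ j + (1 - \<theta>) * fst r $ j) * ?d" by (simp add: algebra_simps)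
      also have "\<dots> = v y - v x - l * ?d" unfolding th(3) ..
      finally have "\<theta> * (pr (fst p) \<bullet> (y - x)) + (1 - \<theta>) * (pr (fst r) \<bullet> (y - x)) \<le> (v y - l * T y) - (v x - l * T x)"
        by (simp add: algebra_simps)
      then have "(\<theta> * (pr (fst p) \<bullet> (y - x)) + (1 - \<theta>) * (pr (fst r) \<bullet> (y - x))) / \<delta> \<le> ((v y - l * T y) - (v x - l * T x)) / \<delta>"
        using \<delta> by (intro divide_right_mono) auto
      moreover have "((\<theta> / \<delta>) *\<^sub>R pr (fst p) + ((1 - \<theta>) / \<delta>) *\<^sub>R pr (fst r)) \<bullet> (y - x) =
          (\<theta> * (pr (fst p) \<bullet> (y - x)) + (1 - \<theta>) * (pr (fst r) \<bullet> (y - x))) / \<delta>"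
        by (simp only: inner_add_left inner_scaleR_left add_divide_distrib times_divide_eq_left)
      ultimately show ?thesis by (simp add: diff_divide_distrib)
    qed
    then show "\<exists>d. \<forall>y. (v x - l * T x) / \<delta> + d \<bullet> (y - x) \<le> (v y - l * T y) / \<delta>" by blast
  qed
  \<comment> \<open>Division by \<open>\<delta>\<close> makes \<open>g2 - g1\<close> equal to
    \<open>T\<close>, so that \<open>h z = z $ j - T z\<close> vanishes exactly on the
    graph.\<close>
  define g1 g2 where "g1 = (\<lambda>z. (v z - \<alpha> * T z) / \<delta>)" and "g2 = (\<lambda>z. (v z - \<beta> * T z) / \<delta>)"
  define h where "h = (\<lambda>z. z $ j + g1 z - g2 z)"
  have g12: "g2 z - g1 z = T z" for z
    using \<delta> by (simp add: g1_def g2_def \<delta>_def diff_divide_distrib[symmetric] left_diff_distrib[symmetric])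
  have vg: "v z = \<alpha> * g2 z - \<beta> * g1 z" for z
  proof -
    have "\<alpha> * g2 z - \<beta> * g1 z = (\<delta> * v z) / \<delta>"
      unfolding g1_def g2_def \<delta>_def by (simp add: algebra_simps diff_divide_distrib[symmetric])
    then show ?thesis using \<delta> by simp
  qed
  have hT: "h z = z $ j - T z" for z using g12[of z] by (simp add: h_def)
  have h0: "h z = 0 \<longleftrightarrow> fmax A z = fmax B z" for z
  proof -
    have "upd j z (z $ j) = z" by (simp add: upd_alt)
    then have "k z = 0 \<longleftrightarrow> T z = z $ j" using Tu[of z "z $ j"] T[of z] by metis
    then show ?thesis by (auto simp: hT k_def)
  qed
  have ind: "indep_coord j (\<lambda>z. (v z - l * T z) / \<delta>)" for l
    unfolding indep_coord_def upd_def[symmetric] by (simp add: v_def Tupd)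
  have Tg: "\<bar>T z\<bar> \<le> (2 * R / \<delta>) * (1 + norm z)" for z
  proof -
    have "\<delta> * \<bar>T z\<bar> \<le> \<bar>k (upd j z 0)\<bar>"
      using kinc[of 0 "T z" z] kinc[of "T z" 0 z] T[of z] by (cases "T z \<ge> 0") auto
    also have "\<dots> \<le> \<bar>fmax A (upd j z 0)\<bar> + \<bar>fmax B (upd j z 0)\<bar>" unfolding k_def by simp
    also have "\<dots> \<le> 2 * (R * norm (upd j z 0) + R)"
      using fg[OF A, of "upd j z 0"] fg[OF B, of "upd j z 0"] by simp
    also have "\<dots> \<le> 2 * (R * norm z + R)"
    proof -
      have "norm (upd j z 0) \<le> norm z"
        unfolding norm_vec_def by (rule L2_set_mono) (auto simp: upd_def)
      then show ?thesis using R(1) by simp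
    qed
    finally show ?thesis using \<delta> by (simp add: field_simps)
  qed
  have lg: "lin_growth (\<lambda>z. (v z - l * T z) / \<delta>)" for l
  proof -
    let ?c = "2 * R / \<delta>"
    let ?K = "R * (2 + ?c) + R + \<bar>l\<bar> * ?c"
    have c0: "?c \<ge> 0" using R \<delta> by simp
    have "\<bar>(v z - l * T z) / \<delta>\<bar> \<le> (?K / \<delta>) * (1 + norm z)" for z
    proof -
      have "norm (upd j z (T z)) \<le> norm z + \<bar>T z - z $ j\<bar>"
        unfolding upd_alt by (rule order_trans[OF norm_triangle_ineq]) simp
      also have "\<dots> \<le> 2 * norm z + \<bar>T z\<bar>" using component_le_norm_cart[of z j] by linarith
      also have "\<dots> \<le> (2 + ?c) * (1 + norm z)" using Tg[of z] by (simp add: algebra_simps)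
      finally have "R * norm (upd j z (T z)) \<le> R * ((2 + ?c) * (1 + norm z))"
        using R(1) by (intro mult_left_mono) auto
      then have "\<bar>v z\<bar> \<le> R * ((2 + ?c) * (1 + norm z)) + R"
        using fg[OF A, of "upd j z (T z)"] by (simp add: v_def)
      also have "\<dots> \<le> R * ((2 + ?c) * (1 + norm z)) + R * (1 + norm z)" using R(1) by simp
      finally have "\<bar>v z\<bar> \<le> (R * (2 + ?c) + R) * (1 + norm z)" by (simp add: distrib_right mult.assoc)
      moreover have "\<bar>l * T z\<bar> \<le> \<bar>l\<bar> * (?c * (1 + norm z))"
        unfolding abs_mult using Tg[of z] by (intro mult_left_mono) auto
      ultimately have "\<bar>v z - l * T z\<bar> \<le> (R * (2 + ?c) + R) * (1 + norm z) + \<bar>l\<bar> * (?c * (1 + norm z))"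
        by linarith
      also have "\<dots> = ?K * (1 + norm z)" by (simp only: distrib_right mult.assoc)
      finally have "\<bar>v z - l * T z\<bar> \<le> ?K * (1 + norm z)" .
      then have "\<bar>v z - l * T z\<bar> / \<delta> \<le> ?K * (1 + norm z) / \<delta>" using \<delta> by (intro divide_right_mono) auto
      then show ?thesis using \<delta> by simp
    qed
    then show ?thesis unfolding lin_growth_def by blast
  qed
  have diff: "\<exists>w\<in>C. (h has_derivative (\<lambda>z. w \<bullet> z)) (at x)"
    if d: "g1 differentiable (at x)" "g2 differentiable (at x)" for x
  proof -
    obtain G1 G2 where G: "(g1 has_derivative G1) (at x)" "(g2 has_derivative G2) (at x)"
      using d unfolding differentiable_def by blast
    obtain p r where p: "p \<in> A" "\<And>z. v z - v x - fst p $ j * (T z - T x) \<ge> pr (fst p) \<bullet> (z - x)"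
      and r: "r \<in> B" "\<And>z. v z - v x - fst r $ j * (T z - T x) \<ge> pr (fst r) \<bullet> (z - x)"
      using supp[of x] by blast
    \<comment> \<open>Both \<open>v\<close> and \<open>T\<close> are linear combinations of
      \<open>g1\<close> and \<open>g2\<close>, hence differentiable at \<open>x\<close>. A
      supporting inequality is an equality at \<open>x\<close>, so its two sides have the same
      derivative there. Subtracting the equations for \<open>p\<close> and \<open>r\<close>
      eliminates \<open>v\<close> and determines the derivative of \<open>T\<close>.\<close>
    have crit: "(\<lambda>w. (\<alpha> * G2 w - \<beta> * G1 w) - e $ j * (G2 w - G1 w) - pr e \<bullet> w) = (\<lambda>w. 0)"
      if e: "\<And>z. v z - v x - e $ j * (T z - T x) \<ge> pr e \<bullet> (z - x)" for e
    proof (rule differential_zero_maxmin[of x UNIV])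
      show "((\<lambda>z. (\<alpha> * g2 z - \<beta> * g1 z) - e $ j * (g2 z - g1 z) - pr e \<bullet> z) has_derivative
          (\<lambda>w. (\<alpha> * G2 w - \<beta> * G1 w) - e $ j * (G2 w - G1 w) - pr e \<bullet> w)) (at x)"
        by (intro derivative_intros G)
      have "(\<alpha> * g2 x - \<beta> * g1 x) - e $ j * (g2 x - g1 x) - pr e \<bullet> x
         \<le> (\<alpha> * g2 z - \<beta> * g1 z) - e $ j * (g2 z - g1 z) - pr e \<bullet> z" for z
        unfolding vg[symmetric] g12 using e[of z] by (simp add: inner_diff_right algebra_simps)
      then show "(\<forall>z\<in>UNIV. (\<alpha> * g2 z - \<beta> * g1 z) - e $ j * (g2 z - g1 z) - pr e \<bullet> z \<le>
        (\<alpha> * g2 x - \<beta> * g1 x) - e $ j * (g2 x - g1 x) - pr e \<bullet> x) \<or>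
        (\<forall>z\<in>UNIV. (\<alpha> * g2 x - \<beta> * g1 x) - e $ j * (g2 x - g1 x) - pr e \<bullet> x
         \<le> (\<alpha> * g2 z - \<beta> * g1 z) - e $ j * (g2 z - g1 z) - pr e \<bullet> z)" by blast
    qed auto
    define D where "D = fst p $ j - fst r $ j"
    have D: "D > 0" using sep[OF p(1) r(1)] by (simp add: D_def)
    have eq: "D * (G2 w - G1 w) = - ((pr (fst p) - pr (fst r)) \<bullet> w)" for w
      using fun_cong[OF crit[OF p(2)], of w] fun_cong[OF crit[OF r(2)], of w]
      by (simp add: D_def inner_diff_left algebra_simps)
    define w0 where "w0 = (1 / D) *\<^sub>R (fst p - fst r)"
    have "w0 \<in> C" unfolding C_def w0_def D_def using p(1) r(1) by force
    moreover have "w $ j + G1 w - G2 w = w0 \<bullet> w" for w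
    proof -
      have "D * (w $ j + G1 w - G2 w) = (pr (fst p) - pr (fst r) + D *\<^sub>R axis j 1) \<bullet> w"
        using eq[of w] by (simp add: algebra_simps inner_add_left inner_axis')
      also have "pr (fst p) - pr (fst r) + D *\<^sub>R axis j 1 = fst p - fst r"
        by (simp add: pr_def D_def algebra_simps)
      finally have "D * (w $ j + G1 w - G2 w) = (fst p - fst r) \<bullet> w" .
      moreover have "D * (w0 \<bullet> w) = (fst p - fst r) \<bullet> w" using D by (simp add: w0_def)
      ultimately have "D * (w $ j + G1 w - G2 w) = D * (w0 \<bullet> w)" by simp
      then show ?thesis using D by (simp only: mult_cancel_left) simp
    qed
    moreover have "(h has_derivative (\<lambda>w. w $ j + G1 w - G2 w)) (at x)"
      unfolding h_def
      by (intro derivative_intros G bounded_linear_imp_has_derivative bounded_linear_vec_nth)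
    ultimately show ?thesis by auto
  qed
  have "h \<in> Hfam j C"
    unfolding Hfam_def mem_Collect_eq
  proof (rule exI[of _ g1], rule exI[of _ g2], intro conjI)
    show "indep_coord j g1" "indep_coord j g2" unfolding g1_def g2_def by (rule ind)+
    show "convex_on UNIV g1" "convex_on UNIV g2"
      unfolding g1_def g2_def using \<delta> \<delta>_def by (intro cvx; linarith)+
    show "lin_growth g1" "lin_growth g2" unfolding g1_def g2_def by (rule lg)+
    show "h = (\<lambda>x. x $ j + g1 x - g2 x)" by (simp add: h_def)
    show "\<forall>x. g1 differentiable (at x) \<and> g2 differentiable (at x) \<longrightarrow>
          (\<exists>v\<in>C. (h has_derivative (\<lambda>z. v \<bullet> z)) (at x))" using diff by blast
  qed
  then show "\<exists>h\<in>Hfam j C. \<forall>z. h z = 0 \<longleftrightarrow> fmax A z = fmax B z" using h0 by blast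
qed

section \<open>Null sets under (A4)\<close>

locale transport = pseudo_euclidean S P c + prob_space M
  for S :: "real^'n::finite^'n" and P c and M :: "'a measure" +
  fixes Y :: "'a \<Rightarrow> real^'n"
  assumes L2Y: "L2vec M Y"
    and A4: "\<And>j C h. compact C \<Longrightarrow> C \<subseteq> {x. x $ j = 1 \<and> Sform S x x \<ge> 0} \<Longrightarrow>
               h \<in> Hfam j C \<Longrightarrow> AE \<omega> in M. h (S *v Y \<omega>) \<noteq> 0"
begin

lemma AE_fmax_neq:
  assumes A: "compact A" "A \<noteq> {}" and B: "compact B" "B \<noteq> {}"
    and sep: "\<And>p r. p \<in> A \<Longrightarrow> r \<in> B \<Longrightarrow> fst p $ j > fst r $ j \<and> qform S (fst p - fst r) \<ge> 0"
  shows "AE \<omega> in M. fmax A (S *v Y \<omega>) \<noteq> fmax B (S *v Y \<omega>)"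
proof -
  define C where "C = (\<lambda>(p, r). (1 / (fst p $ j - fst r $ j)) *\<^sub>R (fst p - fst r)) ` (A \<times> B)"
  have C: "compact C" "\<exists>h\<in>Hfam j C. \<forall>z. h z = 0 \<longleftrightarrow> fmax A z = fmax B z"
    unfolding C_def using sep by (intro hypersurface_Hfam A B; blast)+
  then obtain h where h: "h \<in> Hfam j C" "\<And>z. h z = 0 \<longleftrightarrow> fmax A z = fmax B z" by blast
  have "C \<subseteq> {x. x $ j = 1 \<and> Sform S x x \<ge> 0}"
  proof
    fix x assume "x \<in> C"
    then obtain p r where pr: "p \<in> A" "r \<in> B"
      and x: "x = (1 / (fst p $ j - fst r $ j)) *\<^sub>R (fst p - fst r)" by (auto simp: C_def)
    have "x $ j = 1" using sep[OF pr] by (simp add: x)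
    moreover have "qform S x \<ge> 0" unfolding x qform_scaleR using sep[OF pr] by simp
    ultimately show "x \<in> {x. x $ j = 1 \<and> Sform S x x \<ge> 0}" by (simp add: qform_def)
  qed
  from A4[OF C(1) this h(1)] show ?thesis by (simp add: h(2))
qed

end

section \<open>Compact pieces of G and outer normals of the domain of psi\<close>

context pseudo_euclidean
begin

text \<open>Lifts points to affine functions so that \<open>fmax (gr K) (S *v y)\<close> is the
  maximum of \<open>ell S x y\<close> over \<open>K\<close>; the argument is \<open>S *v y\<close>
  because (A4) speaks of \<open>S *v Y \<omega>\<close>.\<close>

definition gr :: "(real^'n) set \<Rightarrow> ((real^'n) \<times> real) set" where
  "gr K = (\<lambda>x. (x, qform S x)) ` K"

lemma gr_affine: "p \<in> gr K \<Longrightarrow> fst p \<bullet> (S *v y) - snd p = ell S (fst p) y"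
  by (auto simp: gr_def ell_def qform_def Sform_def)

lemma compact_gr: "compact K \<Longrightarrow> compact (gr K)"
  unfolding gr_def by (intro compact_continuous_image continuous_intros)

lemma fmax_gr:
  assumes "compact K" "K \<subseteq> G" "x \<in> K" "x \<in> PG S G y"
  shows "fmax (gr K) (S *v y) = ell S x y"
proof -
  have x: "(x, qform S x) \<in> gr K" using assms by (auto simp: gr_def)
  then obtain p where p: "p \<in> gr K" "fmax (gr K) (S *v y) = fst p \<bullet> (S *v y) - snd p"
    "\<And>p'. p' \<in> gr K \<Longrightarrow> fst p' \<bullet> (S *v y) - snd p' \<le> fmax (gr K) (S *v y)"
    using fmax_attained[OF compact_gr[OF assms(1)], of "S *v y"] by blast
  have "ell S (fst p) y \<le> ell S x y" using p(1) assms by (auto simp: gr_def PG_ell)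
  then show ?thesis using p(2) p(3)[OF x] gr_affine[OF p(1)] gr_affine[OF x] by simp
qed

definition slab :: "(real^'n) set \<Rightarrow> 'n \<Rightarrow> nat \<Rightarrow> real set \<Rightarrow> (real^'n) set" where
  "slab G j n I = G \<inter> cball 0 (real n) \<inter> {x. x $ j \<in> I}"

lemma compact_slab:
  assumes "closed G" "closed I"
  shows "compact (slab G j n I)"
proof -
  have "{x :: real^'n. x $ j \<in> I} = (\<lambda>x. x $ j) -` I" by auto
  moreover have "closed ((\<lambda>x :: real^'n. x $ j) -` I)"
    using assms(2) by (intro closed_vimage continuous_intros)
  ultimately have "closed (G \<inter> {x :: real^'n. x $ j \<in> I})" using assms by auto
  then have "compact (cball 0 (real n) \<inter> (G \<inter> {x :: real^'n. x $ j \<in> I}))"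
    by (intro compact_Int_closed) auto
  then show ?thesis by (simp add: slab_def Int_ac)
qed

text \<open>Two distinct maximisers differ in some coordinate and lie in a common ball. Rational
  levels strictly between the two coordinates leave countably many pairs of compact, separated
  slabs, which serves both (A4) and measurability.\<close>

lemma SigmaP_iff:
  "y \<in> SigmaP S G \<longleftrightarrow> (\<exists>j n (r1::rat) (r2::rat). r2 < r1 \<and>
     PG S G y \<inter> slab G j n {of_rat r1..} \<noteq> {} \<and> PG S G y \<inter> slab G j n {..of_rat r2} \<noteq> {})"
  (is "_ \<longleftrightarrow> ?R")
proof
  assume "y \<in> SigmaP S G"
  then obtain x0 where "x0 \<in> PG S G y" "PG S G y \<noteq> {x0}" by (auto simp: SigmaP_def)
  then obtain x1 where x: "x0 \<in> PG S G y" "x1 \<in> PG S G y" "x0 \<noteq> x1" by blast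
  then obtain j where j: "x0 $ j \<noteq> x1 $ j" by (auto simp: vec_eq_iff)
  obtain a b where ab: "a \<in> PG S G y" "b \<in> PG S G y" "a $ j < b $ j"
    using x j by (metis linorder_neqE_linordered_idom)
  obtain r1 where r1: "a $ j < of_rat r1" "of_rat r1 < b $ j" using of_rat_dense[OF ab(3)] by blast
  obtain r2 where r2: "a $ j < of_rat r2" "of_rat r2 < (of_rat r1 :: real)" using of_rat_dense[OF r1(1)] by blast
  obtain n :: nat where n: "norm a + norm b \<le> real n" using real_arch_simple by blast
  have "b \<in> slab G j n {of_rat r1..}" "a \<in> slab G j n {..of_rat r2}"
    using ab r1 r2 n norm_ge_zero[of a] norm_ge_zero[of b]
    by (auto simp: slab_def PG_def simp del: norm_ge_zero)
  moreover have "r2 < r1" using r2(2) by (simp add: of_rat_less)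
  ultimately show ?R using ab by blast
next
  assume ?R
  then obtain j n r1 r2 a b where *: "r2 < r1" "b \<in> PG S G y" "b \<in> slab G j n {of_rat r1..}"
    "a \<in> PG S G y" "a \<in> slab G j n {..of_rat r2}" by blast
  then have "a $ j < b $ j" using of_rat_less[of r2 r1, where ?'a = real] by (auto simp: slab_def)
  then have "a \<noteq> b" by auto
  then show "y \<in> SigmaP S G" using * by (auto simp: SigmaP_def)
qed

text \<open>A recession direction: \<open>u\<close> is a limit of normalised points
  \<open>X n\<close> of the level set. Dividing \<open>qform S (X n - x0) \<ge> 0\<close> by the
  square of \<open>norm (X n)\<close> gives the sign of \<open>qform S u\<close>. In
  \<open>ell S (X n) y' - ell S (X n) y\<close> the quadratic terms cancel, so the bound on it,
  divided by \<open>norm (X n)\<close>, becomes the normal inequality.\<close>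

lemma unbounded_level_normal:
  assumes G: "G \<in> maxmon S" and unb: "\<not> bounded {x\<in>G. k \<le> ell S x y}"
  shows "\<exists>u. u \<noteq> 0 \<and> qform S u \<ge> 0 \<and> (\<forall>y'. psi S G y' < \<infinity> \<longrightarrow> Sform S u y' \<le> Sform S u y)"
proof -
  have "\<exists>x. x \<in> G \<and> k \<le> ell S x y \<and> norm x > real (Suc n)" for n
    using unb unfolding bounded_iff by (auto simp: not_le)
  then obtain X where X: "\<And>n. X n \<in> G" "\<And>n. k \<le> ell S (X n) y" "\<And>n. norm (X n) > real (Suc n)"
    by metis
  define i where "i = (\<lambda>n. 1 / norm (X n))"
  have i0: "i n > 0" "i n \<le> 1 / real (Suc n)" "norm (X n) > 0" for n
  proof -
    show p: "norm (X n) > 0" using X(3)[of n] by (metis of_nat_0_le_iff order_le_less_trans)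
    then show "i n > 0" by (simp add: i_def)
    show "i n \<le> 1 / real (Suc n)" unfolding i_def using X(3)[of n] p by (intro divide_left_mono mult_pos_pos) auto
  qed
  have i_lim: "i \<longlonglongrightarrow> 0"
  proof (rule tendsto_sandwich[of "\<lambda>_. 0" _ _ "\<lambda>n. 1 / real (Suc n)"])
    show "(\<lambda>n. 1 / real (Suc n)) \<longlonglongrightarrow> 0" using LIMSEQ_inverse_real_of_nat by (simp add: inverse_eq_divide)
  qed (use i0(1,2) less_imp_le[OF i0(1)] in simp_all)
  define U where "U = (\<lambda>n. i n *\<^sub>R X n)"
  have "U n \<in> sphere 0 1" for n using i0(3)[of n] by (simp add: U_def i_def)
  then obtain u r where u: "u \<in> sphere 0 1" "strict_mono r" "(U \<circ> r) \<longlonglongrightarrow> u"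
    using compact_sphere[of "0::real^'n" 1] unfolding compact_def by metis
  have ir: "(i \<circ> r) \<longlonglongrightarrow> 0" by (rule LIMSEQ_subseq_LIMSEQ[OF i_lim u(2)])
  have "qform S u \<ge> 0"
  proof -
    obtain x0 where x0: "x0 \<in> G" using maxmon_ne[OF G] by blast
    have "continuous_on UNIV (qform S)" by (intro continuous_intros)
    moreover have "(\<lambda>n. (U \<circ> r) n - (i \<circ> r) n *\<^sub>R x0) \<longlonglongrightarrow> u - 0 *\<^sub>R x0"
      by (intro tendsto_intros u ir)
    ultimately have "(\<lambda>n. qform S ((U \<circ> r) n - (i \<circ> r) n *\<^sub>R x0)) \<longlonglongrightarrow> qform S (u - 0 *\<^sub>R x0)"
      by (rule continuous_on_tendsto_compose) auto
    moreover have "qform S ((U \<circ> r) n - (i \<circ> r) n *\<^sub>R x0) \<ge> 0" for n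
    proof -
      have "(U \<circ> r) n - (i \<circ> r) n *\<^sub>R x0 = i (r n) *\<^sub>R (X (r n) - x0)" by (simp add: U_def algebra_simps)
      then show ?thesis using monotoneD[OF maxmon_monotone[OF G] X(1) x0] by (simp add: qform_scaleR)
    qed
    ultimately show ?thesis by (simp add: LIMSEQ_le_const)
  qed
  moreover have "Sform S u y' \<le> Sform S u y" if y': "psi S G y' < \<infinity>" for y'
  proof -
    obtain x0 where x0: "x0 \<in> G" using maxmon_ne[OF G] by blast
    have "psi S G y' \<noteq> -\<infinity>" using ell_le_psi[OF x0, of S y'] by auto
    then obtain \<rho> where \<rho>: "psi S G y' = ereal \<rho>" using y' by (cases "psi S G y'") auto
    have "Sform S ((U \<circ> r) n) (y' - y) \<le> (i \<circ> r) n * (\<rho> - k)" for n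
    proof -
      have "ell S (X (r n)) y' \<le> \<rho>" using psi_le_iff[of S G y' \<rho>] X(1) \<rho> by simp
      then have "Sform S (X (r n)) (y' - y) \<le> \<rho> - k"
        using X(2)[of "r n"] by (simp add: ell_def form.diff_right)
      then show ?thesis using i0(1)[of "r n"] by (simp add: U_def form.scaleR_left)
    qed
    moreover have "(\<lambda>n. Sform S ((U \<circ> r) n) (y' - y)) \<longlonglongrightarrow> Sform S u (y' - y)"
      by (intro form.tendsto u tendsto_const)
    moreover have "(\<lambda>n. (i \<circ> r) n * (\<rho> - k)) \<longlonglongrightarrow> 0 * (\<rho> - k)" by (intro tendsto_intros ir)
    ultimately have "Sform S u (y' - y) \<le> 0 * (\<rho> - k)" by (intro LIMSEQ_le) auto
    then show ?thesis by (simp add: form.diff_right)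
  qed
  ultimately show ?thesis using u(1) by (intro exI[of _ u]) auto
qed

text \<open>A pair \<open>(u, s)\<close> is a half-space \<open>Sform S u y \<le> s\<close>
  containing the domain of \<open>psi\<close>. Fixing the \<open>j\<close>-th coordinate of
  \<open>u\<close> as \<open>e\<close> separates these slopes from that of the constant function 0,
  and \<open>n\<close> makes the family compact.\<close>

definition normals :: "(real^'n) set \<Rightarrow> real \<Rightarrow> 'n \<Rightarrow> nat \<Rightarrow> ((real^'n) \<times> real) set" where
  "normals G e j n = {p. fst p $ j = e \<and> qform S (fst p) \<ge> 0 \<and> norm (fst p) \<le> n \<and> \<bar>snd p\<bar> \<le> n \<and>
     (\<forall>y. psi S G y < \<infinity> \<longrightarrow> Sform S (fst p) y \<le> snd p)}"

lemma compact_normals: "compact (normals G e j n)"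
proof -
  have "closed (normals G e j n)"
    unfolding normals_def
    by (intro closed_Collect_conj closed_Collect_eq closed_Collect_le closed_Collect_all
        closed_Collect_imp open_Collect_const continuous_intros)
  moreover have "bounded (normals G e j n)"
  proof (rule boundedI)
    fix p assume "p \<in> normals G e j n"
    then have "norm (fst p) + norm (snd p) \<le> 2 * n" by (auto simp: normals_def)
    then show "norm p \<le> 2 * n" using norm_Pair_le[of "fst p" "snd p"] by simp
  qed
  ultimately show ?thesis by (simp add: compact_eq_bounded_closed)
qed

text \<open>At a point of the domain no member of the family is positive, and a normal active there
  attains 0. Such a point lies on the hypersurface between \<open>normals\<close> and the constant
  function 0.\<close>

lemma fmax_normals_zero:
  assumes y: "psi S G y < \<infinity>" and u: "(u, Sform S u y) \<in> normals G e j n"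
  shows "fmax (normals G e j n) (S *v y) = 0"
proof -
  obtain p where p: "p \<in> normals G e j n" "fmax (normals G e j n) (S *v y) = fst p \<bullet> (S *v y) - snd p"
    "\<And>p'. p' \<in> normals G e j n \<Longrightarrow> fst p' \<bullet> (S *v y) - snd p' \<le> fmax (normals G e j n) (S *v y)"
    using fmax_attained[OF compact_normals, of G e j n "S *v y"] u by blast
  have "fst p \<bullet> (S *v y) \<le> snd p" using p(1) y by (auto simp: normals_def Sform_def)
  then show ?thesis using p(2) p(3)[OF u] by (simp add: Sform_def)
qed

lemma unbounded_level_normals:
  assumes G: "G \<in> maxmon S" and unb: "\<not> bounded {x\<in>G. k \<le> ell S x y}"
  shows "\<exists>j n e u. (e = 1 \<or> e = -1) \<and> (u, Sform S u y) \<in> normals G e j n"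
proof -
  obtain u where u: "u \<noteq> 0" "qform S u \<ge> 0" "\<And>y'. psi S G y' < \<infinity> \<Longrightarrow> Sform S u y' \<le> Sform S u y"
    using unbounded_level_normal[OF assms] by blast
  then obtain j where j: "u $ j \<noteq> 0" by (auto simp: vec_eq_iff)
  define v where "v = (1 / \<bar>u $ j\<bar>) *\<^sub>R u"
  obtain n :: nat where n: "norm v + \<bar>Sform S v y\<bar> \<le> n" using real_arch_simple by blast
  have "v $ j = sgn (u $ j)" using j by (simp add: v_def sgn_if abs_if)
  moreover have "Sform S v y' \<le> Sform S v y" if "psi S G y' < \<infinity>" for y'
    unfolding v_def form.scaleR_left using u(3)[OF that] by (intro scaleR_left_mono) auto
  moreover have "norm v \<le> n" "\<bar>Sform S v y\<bar> \<le> n"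
    using n norm_ge_zero[of v] abs_ge_zero[of "Sform S v y"] by linarith+
  moreover have "qform S v \<ge> 0" using u(2) by (simp add: v_def qform_scaleR)
  ultimately have "(v, Sform S v y) \<in> normals G (sgn (u $ j)) j n"
    unfolding normals_def by simp
  moreover have "sgn (u $ j) = 1 \<or> sgn (u $ j) = -1" using j by (auto simp: sgn_if)
  ultimately show ?thesis by metis
qed

end

section \<open>Almost sure uniqueness of maximisers and boundedness of level sets\<close>

context transport
begin

text \<open>If both slabs contain a maximiser, the maxima over both equal \<open>psi\<close>. The
  slopes are separated in coordinate \<open>j\<close>, and their differences satisfy
  \<open>qform S \<ge> 0\<close> because \<open>G\<close> is monotone.\<close>

lemma AE_not_SigmaP:
  assumes G: "G \<in> maxmon S"
  shows "AE \<omega> in M. Y \<omega> \<notin> SigmaP S G"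
proof -
  have "AE \<omega> in M. r2 < r1 \<longrightarrow> \<not> (PG S G (Y \<omega>) \<inter> slab G j n {of_rat r1..} \<noteq> {} \<and>
      PG S G (Y \<omega>) \<inter> slab G j n {..of_rat r2} \<noteq> {})" for j n and r1 r2 :: rat
  proof (cases "r2 < r1 \<and> slab G j n {of_rat r1..} \<noteq> {} \<and> slab G j n {..of_rat r2} \<noteq> {}")
    case True
    let ?A = "slab G j n {of_rat r1..}" and ?B = "slab G j n {..of_rat r2}"
    have c: "compact ?A" "compact ?B" using maxmon_closed[OF G] by (intro compact_slab; simp)+
    have "AE \<omega> in M. fmax (gr ?A) (S *v Y \<omega>) \<noteq> fmax (gr ?B) (S *v Y \<omega>)"
    proof (rule AE_fmax_neq)
      show "compact (gr ?A)" "compact (gr ?B)" using c by (intro compact_gr; simp)+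
      show "gr ?A \<noteq> {}" "gr ?B \<noteq> {}" using True by (auto simp: gr_def)
      fix p r assume "p \<in> gr ?A" "r \<in> gr ?B"
      then show "fst r $ j < fst p $ j \<and> 0 \<le> qform S (fst p - fst r)"
        using True of_rat_less[of r2 r1, where ?'a = real]
        by (auto simp: gr_def slab_def intro!: monotoneD[OF maxmon_monotone[OF G]])
    qed
    then show ?thesis
    proof eventually_elim
      case (elim \<omega>)
      have "False" if "a \<in> PG S G (Y \<omega>)" "a \<in> ?A" "b \<in> PG S G (Y \<omega>)" "b \<in> ?B" for a b
      proof -
        have "ell S a (Y \<omega>) = ell S b (Y \<omega>)"
          using PG_psi[OF that(1)] PG_psi[OF that(3)] by simp
        moreover have "?A \<subseteq> G" "?B \<subseteq> G" by (auto simp: slab_def)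
        ultimately show False
          using fmax_gr[OF c(1) _ that(2,1)] fmax_gr[OF c(2) _ that(4,3)] elim by simp
      qed
      then show ?case by blast
    qed
  qed auto
  then show ?thesis unfolding SigmaP_iff by (simp add: AE_all_countable)
qed

text \<open>An unbounded level set has a normal active at \<open>Y \<omega>\<close>, scaled to
  \<open>j\<close>-th coordinate 1 or -1. For -1 the constant function 0 is the family with the
  larger \<open>j\<close>-slope, so the two families exchange roles.\<close>

lemma AE_bounded_level:
  assumes G: "G \<in> maxmon S"
  shows "AE \<omega> in M. psi S G (Y \<omega>) < \<infinity> \<longrightarrow> (\<forall>k. bounded {x\<in>G. k \<le> ell S x (Y \<omega>)})"
proof -
  have 0: "fmax {(0, 0)} z = 0" for z :: "real^'n" by (simp add: fmax_def)
  have nz: "AE \<omega> in M. normals G e j n \<noteq> {} \<longrightarrow> fmax (normals G e j n) (S *v Y \<omega>) \<noteq> 0"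
    if e: "e = 1 \<or> e = -1" for e j n
  proof (cases "normals G e j n = {}")
    case False
    show ?thesis
    proof (cases "e = 1")
      case True
      have "AE \<omega> in M. fmax (normals G e j n) (S *v Y \<omega>) \<noteq> fmax {(0, 0)} (S *v Y \<omega>)"
        using False True by (intro AE_fmax_neq[where j = j] compact_normals) (auto simp: normals_def)
      then show ?thesis by (simp add: 0)
    next
      case False
      then have "AE \<omega> in M. fmax {(0, 0)} (S *v Y \<omega>) \<noteq> fmax (normals G e j n) (S *v Y \<omega>)"
        using \<open>normals G e j n \<noteq> {}\<close> e
        by (intro AE_fmax_neq[where j = j] compact_normals) (auto simp: normals_def qform_minus)
      then show ?thesis unfolding 0 by (auto elim!: eventually_mono)
    qed
  qed auto
  have "AE \<omega> in M. \<forall>j n. normals G 1 j n \<noteq> {} \<longrightarrow> fmax (normals G 1 j n) (S *v Y \<omega>) \<noteq> 0"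
    unfolding AE_all_countable using nz by blast
  moreover have "AE \<omega> in M. \<forall>j n. normals G (-1) j n \<noteq> {} \<longrightarrow> fmax (normals G (-1) j n) (S *v Y \<omega>) \<noteq> 0"
    unfolding AE_all_countable using nz by blast
  ultimately show ?thesis
  proof eventually_elim
    case (elim \<omega>)
    show ?case
    proof (intro impI allI, rule ccontr)
      fix k assume y: "psi S G (Y \<omega>) < \<infinity>" and "\<not> bounded {x \<in> G. k \<le> ell S x (Y \<omega>)}"
      then obtain j n e u where "e = 1 \<or> e = -1" "(u, Sform S u (Y \<omega>)) \<in> normals G e j n"
        using unbounded_level_normals[OF G] by blast
      then show False using fmax_normals_zero[OF y] elim by blast
    qed
  qed
qed

end

section \<open>Integrals and conditional expectations\<close>

lemma ext_int_mono:
  assumes "AE x in \<mu>. f x \<le> g x"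
  shows "ext_int \<mu> f \<le> ext_int \<mu> g"
proof -
  have "(\<integral>\<^sup>+x. e2ennreal (f x) \<partial>\<mu>) \<le> (\<integral>\<^sup>+x. e2ennreal (g x) \<partial>\<mu>)"
    using assms by (intro nn_integral_mono_AE) (auto elim!: eventually_mono intro: e2ennreal_mono)
  moreover have "(\<integral>\<^sup>+x. e2ennreal (- g x) \<partial>\<mu>) \<le> (\<integral>\<^sup>+x. e2ennreal (- f x) \<partial>\<mu>)"
    using assms by (intro nn_integral_mono_AE) (auto elim!: eventually_mono intro: e2ennreal_mono)
  ultimately show ?thesis
    unfolding ext_int_def by (intro ereal_minus_mono) (simp_all add: less_eq_ennreal.rep_eq)
qed

lemma ext_int_real:
  assumes g: "integrable \<mu> g" and fg: "AE x in \<mu>. f x = ereal (g x)"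
  shows "ext_int \<mu> f = ereal (\<integral>x. g x \<partial>\<mu>)"
proof -
  have 1: "(\<integral>\<^sup>+x. e2ennreal (f x) \<partial>\<mu>) = (\<integral>\<^sup>+x. ennreal (g x) \<partial>\<mu>)"
    using fg by (intro nn_integral_cong_AE) (auto elim!: eventually_mono)
  have 2: "(\<integral>\<^sup>+x. e2ennreal (- f x) \<partial>\<mu>) = (\<integral>\<^sup>+x. ennreal (- g x) \<partial>\<mu>)"
    using fg by (intro nn_integral_cong_AE) (auto elim!: eventually_mono)
  have fin: "(\<integral>\<^sup>+x. ennreal (g x) \<partial>\<mu>) \<noteq> \<infinity>" "(\<integral>\<^sup>+x. ennreal (- g x) \<partial>\<mu>) \<noteq> \<infinity>"
    using g unfolding real_integrable_def by auto
  then obtain a b where "(\<integral>\<^sup>+x. ennreal (g x) \<partial>\<mu>) = ennreal a" "a \<ge> 0"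
    "(\<integral>\<^sup>+x. ennreal (- g x) \<partial>\<mu>) = ennreal b" "b \<ge> 0"
    by (metis ennreal_cases infinity_ennreal_def)
  then show ?thesis
    unfolding ext_int_def 1 2 real_lebesgue_integral_def[OF g] by (simp add: enn2ereal_ennreal)
qed

text \<open>The integrable minorant keeps the negative part finite; an infinite positive part would
  make \<open>ext_int\<close> infinite.\<close>

lemma ext_int_finiteD:
  assumes f: "f \<in> borel_measurable \<mu>" and q: "integrable \<mu> q" "\<And>x. ereal (q x) \<le> f x"
    and fin: "ext_int \<mu> f < \<infinity>"
  shows "integrable \<mu> (\<lambda>x. real_of_ereal (f x))" "AE x in \<mu>. f x = ereal (real_of_ereal (f x))"
proof -
  have neg: "(\<integral>\<^sup>+x. e2ennreal (- f x) \<partial>\<mu>) < \<infinity>"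
  proof -
    have "(\<integral>\<^sup>+x. e2ennreal (- f x) \<partial>\<mu>) \<le> (\<integral>\<^sup>+x. ennreal (- q x) \<partial>\<mu>)"
      using q(2) by (intro nn_integral_mono)
        (metis e2ennreal_ereal e2ennreal_mono ereal_minus_le_minus uminus_ereal.simps(1))
    also have "\<dots> < \<infinity>" using q(1) unfolding real_integrable_def by (simp add: top.not_eq_extremum)
    finally show ?thesis .
  qed
  have pos: "(\<integral>\<^sup>+x. e2ennreal (f x) \<partial>\<mu>) < \<infinity>"
  proof (rule ccontr)
    assume "\<not> ?thesis"
    then have "(\<integral>\<^sup>+x. e2ennreal (f x) \<partial>\<mu>) = \<infinity>" by (simp flip: less_top)
    then show False using fin unfolding ext_int_def by simp
  qed
  have m[measurable]: "f \<in> borel_measurable \<mu>" by fact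
  have "AE x in \<mu>. e2ennreal (f x) \<noteq> \<infinity>" using pos by (intro nn_integral_PInf_AE) auto
  then show *: "AE x in \<mu>. f x = ereal (real_of_ereal (f x))"
  proof eventually_elim
    case (elim x)
    then show ?case using q(2)[of x] by (cases "f x") auto
  qed
  show "integrable \<mu> (\<lambda>x. real_of_ereal (f x))"
    unfolding real_integrable_def
  proof (intro conjI)
    have "(\<integral>\<^sup>+x. ennreal (real_of_ereal (f x)) \<partial>\<mu>) = (\<integral>\<^sup>+x. e2ennreal (f x) \<partial>\<mu>)"
      using * by (intro nn_integral_cong_AE) (auto elim!: eventually_mono simp flip: e2ennreal_ereal)
    then show "(\<integral>\<^sup>+x. ennreal (real_of_ereal (f x)) \<partial>\<mu>) \<noteq> \<infinity>" using pos by simp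
    have "(\<integral>\<^sup>+x. ennreal (- real_of_ereal (f x)) \<partial>\<mu>) = (\<integral>\<^sup>+x. e2ennreal (- f x) \<partial>\<mu>)"
      using * by (intro nn_integral_cong_AE, elim eventually_mono)
       (metis e2ennreal_ereal uminus_ereal.simps(1))
    then show "(\<integral>\<^sup>+x. ennreal (- real_of_ereal (f x)) \<partial>\<mu>) \<noteq> \<infinity>" using neg by simp
  qed measurable
qed

lemma ext_int_distr:
  assumes "Y \<in> borel_measurable M" "f \<in> borel_measurable borel"
  shows "ext_int (distr M borel Y) f = ext_int M (\<lambda>\<omega>. f (Y \<omega>))"
  unfolding ext_int_def using assms by (simp add: nn_integral_distr)

text \<open>A Dynkin argument from the intersection-stable generator of closed sets; complements
  work because \<open>UNIV\<close> is itself closed. Closed sets are what continuous test functions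
  can approximate.\<close>

lemma integral_indicator_closed_imp_borel:
  fixes X :: "'a \<Rightarrow> 'b::metric_space" and f :: "'a \<Rightarrow> real"
  assumes X[measurable]: "X \<in> borel_measurable M" and f: "integrable M f"
    and cl: "\<And>F. closed F \<Longrightarrow> (\<integral>\<omega>. indicator F (X \<omega>) * f \<omega> \<partial>M) = 0"
    and A: "A \<in> sets borel"
  shows "(\<integral>\<omega>. indicator A (X \<omega>) * f \<omega> \<partial>M) = 0"
proof -
  have b: "sets borel = sigma_sets UNIV (Collect closed :: 'b set set)"
    unfolding borel_eq_closed by (simp add: sets_measure_of)
  have int: "integrable M (\<lambda>\<omega>. indicator B (X \<omega>) * f \<omega>)" if "B \<in> sets borel" for B
  proof -
    have [measurable]: "B \<in> sets borel" "f \<in> borel_measurable M" using that f by auto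
    show ?thesis using f by (rule Bochner_Integration.integrable_bound) (auto simp: indicator_def)
  qed
  have "Int_stable (Collect closed :: 'b set set)" by (auto simp: Int_stable_def)
  moreover have "(Collect closed :: 'b set set) \<subseteq> Pow UNIV" by simp
  moreover have "A \<in> sigma_sets UNIV (Collect closed)" using A b by simp
  ultimately show ?thesis
  proof (induction rule: sigma_sets_induct_disjoint)
    case (basic A)
    then show ?case using cl by simp
  next
    case empty
    show ?case by simp
  next
    case (compl A)
    then have "integrable M (\<lambda>\<omega>. indicator A (X \<omega>) * f \<omega>)" using int b by simp
    moreover have "(\<lambda>\<omega>. indicator (UNIV - A) (X \<omega>) * f \<omega>) = (\<lambda>\<omega>. f \<omega> - indicator A (X \<omega>) * f \<omega>)"
      by (auto simp: indicator_def)
    moreover have "(\<integral>\<omega>. f \<omega> \<partial>M) = 0" using cl[of UNIV] by simp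
    ultimately show ?case using compl f by simp
  next
    case (union A)
    have [measurable]: "A i \<in> sets borel" for i using union(2) b by auto
    define B where "B = (\<lambda>i. X -` A i \<inter> space M)"
    have [measurable]: "B i \<in> sets M" for i unfolding B_def by measurable
    have eq: "(\<integral>\<omega>. indicator D (X \<omega>) * f \<omega> \<partial>M) = (LINT \<omega>:X -` D \<inter> space M|M. f \<omega>)" for D
      unfolding set_lebesgue_integral_def
      by (intro Bochner_Integration.integral_cong) (auto simp: indicator_def)
    have "X -` (\<Union>i. A i) \<inter> space M = (\<Union>i. B i)" by (auto simp: B_def)
    moreover have "(LINT \<omega>:(\<Union>i. B i)|M. f \<omega>) = (\<Sum>i. LINT \<omega>:B i|M. f \<omega>)"
    proof (rule lebesgue_integral_countable_add)
      show "B i \<inter> B j = {}" if "i \<noteq> j" for i j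
        using union(1) that by (auto simp: B_def disjoint_family_on_def)
      show "set_integrable M (\<Union>i. B i) f"
        unfolding set_integrable_def by (intro integrable_mult_indicator f) measurable
    qed auto
    moreover have "(LINT \<omega>:B i|M. f \<omega>) = 0" for i
      using union(3)[of i] by (simp add: eq B_def)
    ultimately show ?case by (simp add: eq)
  qed
qed

section \<open>Conditional expectation given a random vector\<close>

context prob_space
begin

lemma sigma_finite_vimage_subalgebra:
  fixes X :: "'a \<Rightarrow> 'b::topological_space"
  assumes X: "X \<in> borel_measurable M"
  shows "sigma_finite_subalgebra M (vimage_algebra (space M) X borel)"
proof -
  have "sets (vimage_algebra (space M) X borel) \<subseteq> sets M"
    using measurable_sets[OF X] by (subst sets_vimage_algebra2) auto
  then have "subalgebra M (vimage_algebra (space M) X borel)" by (simp add: subalgebra_def)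
  then have "finite_measure_subalgebra M (vimage_algebra (space M) X borel)"
    using finite_measure_axioms by (simp add: finite_measure_subalgebra_def finite_measure_subalgebra_axioms_def)
  then show ?thesis by (rule finite_measure_subalgebra_is_sigma_finite)
qed

text \<open>\<open>h (X \<omega>)\<close> is measurable for the sigma-algebra of \<open>X\<close>
  and can be moved into the conditional expectation. Asking only for an integrable product admits
  the unbounded test functions of the duality argument.\<close>

lemma real_cond_exp_vimage_test:
  fixes X :: "'a \<Rightarrow> 'b::topological_space"
  assumes X[measurable]: "X \<in> borel_measurable M" and h[measurable]: "h \<in> borel_measurable borel"
    and f[measurable]: "f \<in> borel_measurable M"
    and ce: "AE \<omega> in M. real_cond_exp M (vimage_algebra (space M) X borel) f \<omega> = g \<omega>"
    and g[measurable]: "g \<in> borel_measurable M"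
    and int: "integrable M (\<lambda>\<omega>. h (X \<omega>) * f \<omega>)"
  shows "integrable M (\<lambda>\<omega>. h (X \<omega>) * g \<omega>)" "(\<integral>\<omega>. h (X \<omega>) * g \<omega> \<partial>M) = (\<integral>\<omega>. h (X \<omega>) * f \<omega> \<partial>M)"
proof -
  let ?F = "vimage_algebra (space M) X borel"
  interpret F: sigma_finite_subalgebra M ?F by (rule sigma_finite_vimage_subalgebra[OF X])
  have "X \<in> measurable ?F borel" by (rule measurable_vimage_algebra1) auto
  then have hX: "(\<lambda>\<omega>. h (X \<omega>)) \<in> borel_measurable ?F" by (rule measurable_compose[OF _ h])
  have ae: "AE \<omega> in M. h (X \<omega>) * real_cond_exp M ?F f \<omega> = h (X \<omega>) * g \<omega>"
    using ce by (auto elim!: eventually_mono)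
  note r = F.real_cond_exp_intg[OF int hX f]
  show "integrable M (\<lambda>\<omega>. h (X \<omega>) * g \<omega>)"
    using r(1) ae by (subst integrable_cong_AE[symmetric]) auto
  have "(\<integral>\<omega>. h (X \<omega>) * g \<omega> \<partial>M) = (\<integral>\<omega>. h (X \<omega>) * real_cond_exp M ?F f \<omega> \<partial>M)"
    using ae by (intro integral_cong_AE) (auto elim!: eventually_mono)
  then show "(\<integral>\<omega>. h (X \<omega>) * g \<omega> \<partial>M) = (\<integral>\<omega>. h (X \<omega>) * f \<omega> \<partial>M)" using r(2) by simp
qed

text \<open>Every set of the sigma-algebra of \<open>X\<close> is a preimage under \<open>X\<close>.
  The right-hand side depends only on the joint law of \<open>X\<close> and \<open>f\<close>, so the
  martingale property can be carried from the map to the plan.\<close>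

lemma real_cond_exp_vimage_iff:
  fixes X :: "'a \<Rightarrow> 'b::topological_space"
  assumes X[measurable]: "X \<in> borel_measurable M" and f: "integrable M f"
    and g: "integrable M (\<lambda>\<omega>. g (X \<omega>))" "g \<in> borel_measurable borel"
  shows "(AE \<omega> in M. real_cond_exp M (vimage_algebra (space M) X borel) f \<omega> = g (X \<omega>)) \<longleftrightarrow>
    (\<forall>A\<in>sets borel. (\<integral>\<omega>. indicator A (X \<omega>) * (f \<omega> - g (X \<omega>)) \<partial>M) = 0)" (is "?L \<longleftrightarrow> ?R")
proof -
  let ?F = "vimage_algebra (space M) X borel"
  interpret F: sigma_finite_subalgebra M ?F by (rule sigma_finite_vimage_subalgebra[OF X])
  note [measurable] = g(2)
  have [measurable]: "f \<in> borel_measurable M" using f by auto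
  have int: "integrable M (\<lambda>\<omega>. indicator A (X \<omega>) * h \<omega>)"
    if "A \<in> sets borel" "integrable M h" for A and h :: "'a \<Rightarrow> real"
  proof -
    have [measurable]: "A \<in> sets borel" "h \<in> borel_measurable M" using that by auto
    show ?thesis using that(2) by (rule Bochner_Integration.integrable_bound) (auto simp: indicator_def)
  qed
  have eq: "(\<integral>\<omega>. indicator A (X \<omega>) * (f \<omega> - g (X \<omega>)) \<partial>M) =
     (\<integral>\<omega>. indicator A (X \<omega>) * f \<omega> \<partial>M) - (\<integral>\<omega>. indicator A (X \<omega>) * g (X \<omega>) \<partial>M)"
    if "A \<in> sets borel" for A
    using int[OF that f] int[OF that g(1)] by (simp add: right_diff_distrib)
  show ?thesis
  proof
    assume ?L
    show ?R
    proof
      fix A :: "'b set" assume A[measurable]: "A \<in> sets borel"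
      have "(\<integral>\<omega>. indicator A (X \<omega>) * g (X \<omega>) \<partial>M) = (\<integral>\<omega>. indicator A (X \<omega>) * f \<omega> \<partial>M)"
        by (rule real_cond_exp_vimage_test(2)[OF X _ _ \<open>?L\<close>]) (auto intro: int[OF A f])
      then show "(\<integral>\<omega>. indicator A (X \<omega>) * (f \<omega> - g (X \<omega>)) \<partial>M) = 0" by (simp add: eq[OF A])
    qed
  next
    assume R: ?R
    show ?L
    proof (rule F.real_cond_exp_charact[OF _ f g(1)])
      have "X \<in> measurable ?F borel" by (rule measurable_vimage_algebra1) auto
      then show "(\<lambda>\<omega>. g (X \<omega>)) \<in> borel_measurable ?F" by (rule measurable_compose[OF _ g(2)])
      fix D assume "D \<in> sets ?F"
      then obtain A where A: "A \<in> sets borel" "D = X -` A \<inter> space M"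
        by (auto simp: sets_vimage_algebra2)
      have "(LINT \<omega>:D|M. h \<omega>) = (\<integral>\<omega>. indicator A (X \<omega>) * h \<omega> \<partial>M)" for h :: "'a \<Rightarrow> real"
        unfolding set_lebesgue_integral_def A(2)
        by (intro Bochner_Integration.integral_cong) (auto simp: indicator_def)
      then show "(LINT \<omega>:D|M. f \<omega>) = (LINT \<omega>:D|M. g (X \<omega>))" using R A(1) eq by simp
    qed
  qed
qed

end

section \<open>Measurability and perturbation of the maximiser\<close>

text \<open>Superlevel sets of a supremum of continuous functions are open, however many functions
  there are.\<close>

lemma borel_measurable_psi [measurable]: "psi S G \<in> borel_measurable borel"
proof (rule borel_measurableI_greater)
  fix a
  have "open {y. a < ereal (ell S x y)}" for x
    by (intro open_Collect_less continuous_intros continuous_on_ereal)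
  then have "open (\<Union>x\<in>G. {y. a < ereal (ell S x y)})" by auto
  moreover have "{y \<in> space borel. a < psi S G y} = (\<Union>x\<in>G. {y. a < ereal (ell S x y)})"
    by (auto simp: psi_ell less_SUP_iff)
  ultimately show "{y \<in> space borel. a < psi S G y} \<in> sets borel" by simp
qed

text \<open>The default 0 agrees with \<open>mapX\<close>. As a function of \<open>y\<close> alone
  it can also be evaluated at the second component of any competing plan.\<close>

definition proj_point :: "real^'n::finite^'n \<Rightarrow> (real^'n) set \<Rightarrow> real^'n \<Rightarrow> real^'n" where
  "proj_point S G y = (if \<exists>z. PG S G y = {z} then the_elem (PG S G y) else 0)"

lemma mapX_proj_point: "mapX S G Y \<omega> = proj_point S G (Y \<omega>)"
  by (auto simp: mapX_def proj_point_def SigmaP_def)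

text \<open>On the compact set \<open>G \<inter> K\<close> the supremum is attained. The right-hand
  side compares two measurable functions, which makes the hitting set measurable without any
  selection.\<close>

lemma PG_meets_compact_iff:
  assumes "closed G" "G \<noteq> {}" "compact K"
  shows "PG S G y \<inter> K \<noteq> {} \<longleftrightarrow> psi S G y \<le> psi S (G \<inter> K) y"
proof
  assume "PG S G y \<inter> K \<noteq> {}"
  then obtain x where x: "x \<in> PG S G y" "x \<in> K" by blast
  then have "x \<in> G \<inter> K" by (simp add: PG_def)
  then show "psi S G y \<le> psi S (G \<inter> K) y" unfolding PG_psi[OF x(1)] by (rule ell_le_psi)
next
  assume le: "psi S G y \<le> psi S (G \<inter> K) y"
  obtain x0 where "x0 \<in> G" using assms by blast
  then have "psi S G y \<noteq> -\<infinity>" using ell_le_psi[of x0 G S y] by auto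
  then have "G \<inter> K \<noteq> {}" using le by (auto simp: psi_def bot_ereal_def)
  moreover have "compact (G \<inter> K)" using assms by (simp add: closed_Int_compact)
  moreover have "continuous_on (G \<inter> K) (\<lambda>x. ell S x y)" by (intro continuous_intros)
  ultimately obtain x where x: "x \<in> G \<inter> K" "\<forall>x'\<in>G \<inter> K. ell S x' y \<le> ell S x y"
    using continuous_attains_sup by blast
  then have "psi S G y \<le> ereal (ell S x y)" using le psi_le_iff[of S "G \<inter> K" y "ell S x y"] by auto
  then show "PG S G y \<inter> K \<noteq> {}" using x(1) by (auto simp: psi_le_iff PG_ell)
qed

section \<open>Borel measurability of the maximiser and displacement of maximal sets\<close>

context pseudo_euclidean
begin

lemma borel_PG_meets_compact:
  assumes G: "G \<in> maxmon S" and K: "compact K"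
  shows "{y. PG S G y \<inter> K \<noteq> {}} \<in> sets borel"
  unfolding PG_meets_compact_iff[OF maxmon_closed[OF G] maxmon_ne[OF G] K] by measurable

lemma borel_PG_meets_closed:
  assumes G: "G \<in> maxmon S" and F: "closed F"
  shows "{y. PG S G y \<inter> F \<noteq> {}} \<in> sets borel"
proof -
  have "{y. PG S G y \<inter> F \<noteq> {}} = (\<Union>n::nat. {y. PG S G y \<inter> (F \<inter> cball 0 (real n)) \<noteq> {}})"
  proof (intro set_eqI iffI)
    fix y assume "y \<in> {y. PG S G y \<inter> F \<noteq> {}}"
    then obtain x where "x \<in> PG S G y" "x \<in> F" by blast
    moreover obtain n :: nat where "norm x \<le> real n" using real_arch_simple by blast
    ultimately have "x \<in> PG S G y \<inter> (F \<inter> cball 0 (real n))" by simp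
    then show "y \<in> (\<Union>n::nat. {y. PG S G y \<inter> (F \<inter> cball 0 (real n)) \<noteq> {}})" by blast
  qed auto
  moreover have "{y. PG S G y \<inter> (F \<inter> cball 0 (real n)) \<noteq> {}} \<in> sets borel" for n :: nat
    using F by (intro borel_PG_meets_compact[OF G]) (simp add: closed_Int_compact)
  ultimately show ?thesis by auto
qed

lemma borel_SigmaP:
  assumes G: "G \<in> maxmon S"
  shows "SigmaP S G \<in> sets borel"
proof -
  have "SigmaP S G = (\<Union>j. \<Union>n. \<Union>r1::rat. \<Union>r2\<in>{..<r1}. {y. PG S G y \<inter> slab G j n {of_rat r1..} \<noteq> {}} \<inter>
      {y. PG S G y \<inter> slab G j n {..of_rat r2} \<noteq> {}})"
    by (rule set_eqI) (simp add: SigmaP_iff, blast)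
  also have "\<dots> \<in> sets borel"
    using maxmon_closed[OF G]
    by (intro sets.countable_UN'' sets.Int borel_PG_meets_compact[OF G] compact_slab) (auto intro: countable_subset)
  finally show ?thesis .
qed

lemma PG_singleton_iff: "(\<exists>z. PG S G y = {z}) \<longleftrightarrow> PG S G y \<inter> UNIV \<noteq> {} \<and> y \<notin> SigmaP S G"
  by (auto simp: SigmaP_def)

lemma borel_PG_singleton:
  assumes G: "G \<in> maxmon S"
  shows "{y. \<exists>z. PG S G y = {z}} \<in> sets borel"
proof -
  have "{y. \<exists>z. PG S G y = {z}} = {y. PG S G y \<inter> UNIV \<noteq> {}} - SigmaP S G"
    unfolding PG_singleton_iff by blast
  then show ?thesis using borel_PG_meets_closed[OF G closed_UNIV] borel_SigmaP[OF G] by auto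
qed

lemma borel_measurable_proj_point:
  assumes G: "G \<in> maxmon S"
  shows "proj_point S G \<in> borel_measurable borel"
proof (rule borel_measurableI)
  fix U :: "(real^'n) set" assume U: "open U"
  let ?W = "{y. \<exists>z. PG S G y = {z}}"
  \<comment> \<open>Measurability is known for closed sets being hit, hence the complement of
    \<open>U\<close>. Off \<open>?W\<close> the value is the default 0, so \<open>- ?W\<close> is
    included exactly when \<open>0 \<notin> U\<close>.\<close>
  have "proj_point S G -` (- U) = (?W \<inter> {y. PG S G y \<inter> (- U) \<noteq> {}}) \<union> (if 0 \<in> U then {} else - ?W)"
  proof (intro set_eqI)
    fix y
    show "y \<in> proj_point S G -` (- U) \<longleftrightarrow>
        y \<in> (?W \<inter> {y. PG S G y \<inter> (- U) \<noteq> {}}) \<union> (if 0 \<in> U then {} else - ?W)"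
    proof (cases "\<exists>z. PG S G y = {z}")
      case True
      then obtain z where "PG S G y = {z}" by blast
      then show ?thesis by (simp add: proj_point_def)
    next
      case False
      then show ?thesis by (simp add: proj_point_def)
    qed
  qed
  also have "\<dots> \<in> sets borel"
    using borel_PG_singleton[OF G] borel_PG_meets_closed[OF G, of "- U"] U
    by (auto simp: closed_Compl intro!: sets.Int sets.Un borel_comp)
  finally have "- (proj_point S G -` (- U)) \<in> sets borel" by (rule borel_comp)
  then show "proj_point S G -` U \<inter> space borel \<in> sets borel" by (simp add: vimage_Compl)
qed

text \<open>\<open>exists_maxmon_below\<close> applied to the epigraph of \<open>psi S H\<close>. It
  turns a set that need not be monotone into a competitor for the dual problem.\<close>

lemma exists_maxmon_psi_le:
  assumes "\<And>w. ereal (qform S w) \<le> psi S H w"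
  shows "\<exists>H'\<in>maxmon S. \<forall>w. psi S H' w \<le> psi S H w"
proof -
  have "\<exists>H'\<in>maxmon S. \<forall>(w, s)\<in>{(w, s). \<forall>x\<in>H. ell S x w \<le> s}. psi S H' w \<le> ereal s"
  proof (rule exists_maxmon_below[OF convex_above_ell])
    fix w s assume "(w, s) \<in> {(w, s). \<forall>x\<in>H. ell S x w \<le> s}"
    then have "psi S H w \<le> ereal s" by (simp add: psi_le_iff)
    then have "ereal (qform S w) \<le> ereal s" by (rule order_trans[OF assms])
    then show "qform S w \<le> s" by simp
  qed
  then obtain H' where H': "H' \<in> maxmon S" "\<And>w s. psi S H w \<le> ereal s \<Longrightarrow> psi S H' w \<le> ereal s"
    by (auto simp: psi_le_iff)
  have "psi S H' w \<le> psi S H w" for w by (rule ereal_le_real) (rule H'(2))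
  then show ?thesis using H'(1) by blast
qed

text \<open>Moving every point of \<^term>\<open>G\<close> by a bounded continuous field keeps \<^term>\<open>psi\<close> above \<^term>\<open>qform S\<close>:
  by Brouwer's theorem the positive parts of the moved points still fill the whole positive subspace.\<close>

lemma qform_le_psi_perturbed:
  fixes \<kappa> :: "real^'n \<Rightarrow> real"
  assumes G: "G \<in> maxmon S" and \<kappa>: "continuous_on UNIV \<kappa>" "\<And>x. \<bar>\<kappa> x\<bar> \<le> K"
  shows "ereal (qform S w) \<le> psi S ((\<lambda>x. x + (e * \<kappa> x) *\<^sub>R v) ` G) w"
proof -
  let ?\<xi> = "section_of G"
  \<comment> \<open>A fixed point \<open>z\<close> is the positive part of a point of
    \<open>G\<close> whose displaced position has positive part \<open>P w\<close>.\<close>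
  define f where "f = (\<lambda>z. P w - (e * \<kappa> (?\<xi> z)) *\<^sub>R P v)"
  define r where "r = norm (P w) + \<bar>e\<bar> * K * norm (P v) + 1"
  have K0: "K \<ge> 0" using \<kappa>(2)[of 0] by linarith
  have r: "r > 0" using K0 by (simp add: r_def add_nonneg_pos)
  have "norm (f z) \<le> r" for z
  proof -
    have "norm (f z) \<le> norm (P w) + \<bar>e * \<kappa> (?\<xi> z)\<bar> * norm (P v)"
      unfolding f_def by (rule order_trans[OF norm_triangle_ineq4]) simp
    also have "\<dots> \<le> norm (P w) + (\<bar>e\<bar> * K) * norm (P v)"
      using \<kappa>(2) by (intro add_left_mono mult_right_mono) (auto simp: abs_mult intro!: mult_left_mono)
    finally show ?thesis by (simp add: r_def)
  qed
  then have "f \<in> cball 0 r \<rightarrow> cball 0 r" by auto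
  moreover have "continuous_on (cball 0 r) f"
    unfolding f_def
    by (intro continuous_intros continuous_on_compose2[OF \<kappa>(1) section_of_continuous[OF G]]) auto
  ultimately obtain z where z: "f z = z" using brouwer_ball[OF r, of 0 f] by blast
  have "P (f z) = f z" by (simp add: f_def P_diff P_scaleR idemP)
  then have "P z = z" by (simp only: z)
  define x where "x = ?\<xi> z"
  have x: "x \<in> G" "P x = z" using section_of[OF G, of z] \<open>P z = z\<close> by (auto simp: x_def)
  let ?x = "x + (e * \<kappa> x) *\<^sub>R v"
  have "P ?x = P w" using z by (simp add: P_add P_scaleR x(2) f_def x_def[symmetric] algebra_simps)
  \<comment> \<open>The displaced point and \<open>w\<close> differ by a vector in the kernel of
    \<open>P\<close>, so \<open>ell_qform\<close> puts its affine function above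
    \<open>qform S w\<close> at \<open>w\<close>.\<close>
  then have "qform S (w - ?x) \<le> 0" by (intro qform_ker_nonpos) (simp add: P_diff)
  then have "ereal (qform S w) \<le> ereal (ell S ?x w)" by (simp add: ell_qform)
  also have "\<dots> \<le> psi S ((\<lambda>x. x + (e * \<kappa> x) *\<^sub>R v) ` G) w" using x(1) by (intro ell_le_psi) auto
  finally show ?thesis .
qed

lemma ell_perturbed:
  "ell S (x + t *\<^sub>R v) y = ell S x y + t * Sform S v (y - x) - t\<^sup>2 * qform S v"
  using Sform_commute[of x v]
  by (simp add: ell_def qform_def form.add_left form.add_right form.scaleR_left form.scaleR_right
      form.diff_right power2_eq_square field_simps)

lemma PG_nonempty:
  assumes G: "G \<in> maxmon S" and b: "\<And>k. bounded {x\<in>G. k \<le> ell S x y}"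
  shows "PG S G y \<noteq> {}"
proof -
  obtain x0 where x0: "x0 \<in> G" using maxmon_ne[OF G] by blast
  let ?K = "{x\<in>G. ell S x0 y \<le> ell S x y}"
  have "?K = G \<inter> {x. ell S x0 y \<le> ell S x y}" by auto
  moreover have "closed {x. ell S x0 y \<le> ell S x y}" by (intro closed_Collect_le continuous_intros)
  ultimately have "closed ?K" using closed_Int[OF maxmon_closed[OF G]] by simp
  then have "compact ?K" using b by (simp add: compact_eq_bounded_closed)
  moreover have "?K \<noteq> {}" using x0 by auto
  moreover have "continuous_on ?K (\<lambda>x. ell S x y)" by (intro continuous_intros)
  ultimately have "\<exists>x\<in>?K. \<forall>x'\<in>?K. ell S x' y \<le> ell S x y" by (rule continuous_attains_sup)
  then obtain x where x: "x \<in> ?K" "\<forall>x'\<in>?K. ell S x' y \<le> ell S x y" by (rule bexE)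
  have "ell S x' y \<le> ell S x y" if "x' \<in> G" for x'
  proof (cases "ell S x0 y \<le> ell S x' y")
    case True
    then show ?thesis using x(2) that by simp
  next
    case False
    then show ?thesis using x(1) by simp
  qed
  then have "x \<in> PG S G y" using x(1) by (simp add: PG_ell)
  then show ?thesis by blast
qed

text \<open>Outside \<open>V\<close>, the points within 1 of the top value form a compact set; its
  best value stays strictly below the top by uniqueness. Points further down already leave a gap of
  1.\<close>

lemma level_gap:
  assumes G: "G \<in> maxmon S" and b: "\<And>k. bounded {x\<in>G. k \<le> ell S x y}"
    and X: "PG S G y = {X}" and V: "open V" "X \<in> V"
  shows "\<exists>d>0. \<forall>x\<in>G - V. ell S x y \<le> ell S X y - d"
proof (rule ccontr)
  assume n: "\<not> ?thesis"
  let ?K = "({x\<in>G. ell S X y - 1 \<le> ell S x y}) - V"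
  have "?K = G \<inter> {x. ell S X y - 1 \<le> ell S x y} - V" by auto
  moreover have "closed {x. ell S X y - 1 \<le> ell S x y}" by (intro closed_Collect_le continuous_intros)
  ultimately have "closed ?K" using maxmon_closed[OF G] V by auto
  moreover have "bounded ?K" by (rule bounded_subset[OF b]) auto
  ultimately have "compact ?K" by (simp add: compact_eq_bounded_closed)
  moreover have "\<not> (\<forall>x\<in>G - V. ell S x y \<le> ell S X y - 1)" using n zero_less_one by blast
  then have "?K \<noteq> {}" by (auto simp: not_le intro: less_imp_le)
  moreover have "continuous_on ?K (\<lambda>x. ell S x y)" by (intro continuous_intros)
  ultimately have "\<exists>x\<in>?K. \<forall>x'\<in>?K. ell S x' y \<le> ell S x y" by (rule continuous_attains_sup)
  then obtain x where x: "x \<in> ?K" "\<forall>x'\<in>?K. ell S x' y \<le> ell S x y" by (rule bexE)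
  have XG: "X \<in> G" "\<And>x'. x' \<in> G \<Longrightarrow> ell S x' y \<le> ell S X y" using X by (auto simp: PG_ell)
  have "ell S x y < ell S X y"
  proof (rule ccontr)
    assume "\<not> ?thesis"
    then have "x \<in> PG S G y" using x(1) XG by (fastforce simp: PG_ell)
    then show False using X x(1) V by auto
  qed
  define d where "d = min 1 (ell S X y - ell S x y)"
  have "d > 0" using \<open>ell S x y < ell S X y\<close> by (simp add: d_def)
  moreover have "ell S x' y \<le> ell S X y - d" if "x' \<in> G - V" for x'
  proof (cases "ell S X y - 1 \<le> ell S x' y")
    case True
    then have "ell S x' y \<le> ell S x y" using x(2) that by auto
    then show ?thesis by (simp add: d_def)
  qed (auto simp: d_def)
  ultimately show False using n by blast
qed

text \<open>The lower bound tests the displaced maximiser. The two-sided bound, uniform in the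
  points of \<open>G\<close>, supplies the dominating function for the difference quotients.\<close>

lemma psi_perturbed_bounds:
  fixes \<kappa> :: "real^'n \<Rightarrow> real"
  assumes X: "X \<in> PG S G y" and e: "0 < e" "e \<le> 1"
    and C: "\<And>x. \<bar>\<kappa> x * Sform S v (y - x)\<bar> \<le> C" "\<And>x. (\<kappa> x)\<^sup>2 * \<bar>qform S v\<bar> \<le> Q"
  defines "F \<equiv> psi S ((\<lambda>x. x + (e * \<kappa> x) *\<^sub>R v) ` G) y"
  shows "\<exists>f. F = ereal f \<and> ell S X y + e * (\<kappa> X * Sform S v (y - X)) - e\<^sup>2 * Q \<le> f \<and> \<bar>f - ell S X y\<bar> \<le> e * (C + Q)"
proof -
  have XG: "X \<in> G" "\<And>x'. x' \<in> G \<Longrightarrow> ell S x' y \<le> ell S X y" using X by (auto simp: PG_ell)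
  have Q: "\<bar>(e * \<kappa> x)\<^sup>2 * qform S v\<bar> \<le> e\<^sup>2 * Q" for x
  proof -
    have "\<bar>(e * \<kappa> x)\<^sup>2 * qform S v\<bar> = e\<^sup>2 * ((\<kappa> x)\<^sup>2 * \<bar>qform S v\<bar>)"
      by (simp add: abs_mult power_mult_distrib)
    then show ?thesis using C(2)[of x] by (simp add: mult_left_mono)
  qed
  have Q0: "Q \<ge> 0" using C(2)[of 0] by (metis abs_ge_zero mult_nonneg_nonneg order_trans zero_le_power2)
  have eQ: "e\<^sup>2 * Q \<le> e * Q" using e Q0 by (intro mult_right_mono) (auto simp: power2_eq_square)
  have lin: "(e * \<kappa> x) * Sform S v (y - x) = e * (\<kappa> x * Sform S v (y - x))" for x by simp
  have lb: "\<bar>e * (\<kappa> x * Sform S v (y - x))\<bar> \<le> e * C" for x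
    using C(1)[of x] e by (simp add: abs_mult mult_left_mono)
  have up: "F \<le> ereal (ell S X y + e * (C + Q))"
    unfolding F_def psi_le_iff
  proof clarify
    fix x assume "x \<in> G"
    then show "ell S (x + (e * \<kappa> x) *\<^sub>R v) y \<le> ell S X y + e * (C + Q)"
      unfolding ell_perturbed lin using XG(2)[of x] Q[of x] eQ lb[of x] by (simp add: distrib_left)
  qed
  have lo: "ereal (ell S X y + e * (\<kappa> X * Sform S v (y - X)) - e\<^sup>2 * Q) \<le> F"
  proof -
    have "ereal (ell S X y + e * (\<kappa> X * Sform S v (y - X)) - e\<^sup>2 * Q) \<le> ereal (ell S (X + (e * \<kappa> X) *\<^sub>R v) y)"
      unfolding ell_perturbed lin using Q[of X] by simp
    also have "\<dots> \<le> F" unfolding F_def using XG(1) by (intro ell_le_psi) auto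
    finally show ?thesis .
  qed
  obtain f where f: "F = ereal f" using up lo by (cases F) auto
  have "ell S X y + e * (\<kappa> X * Sform S v (y - X)) - e\<^sup>2 * Q \<le> f" using lo f by simp
  moreover have "f \<le> ell S X y + e * (C + Q)" using up f by simp
  moreover have "ell S X y - e * (C + Q) \<le> f"
    using lb[of X] eQ \<open>ell S X y + e * (\<kappa> X * Sform S v (y - X)) - e\<^sup>2 * Q \<le> f\<close>
    by (simp add: distrib_left)
  ultimately show ?thesis using f by (intro exI[of _ f]) auto
qed

text \<open>An envelope theorem: the derivative of a supremum is the derivative at its unique
  maximiser. Points near \<open>X\<close> have nearly the slope \<open>D\<close>; the others lose
  the gap of \<open>level_gap\<close>, which exceeds what a small displacement can gain.\<close>

lemma psi_perturbed_limit:
  fixes \<kappa> :: "real^'n \<Rightarrow> real" and e :: "nat \<Rightarrow> real"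
  assumes G: "G \<in> maxmon S" and b: "\<And>k. bounded {x\<in>G. k \<le> ell S x y}" and X: "PG S G y = {X}"
    and e: "\<And>n. 0 < e n" "\<And>n. e n \<le> 1" "e \<longlonglongrightarrow> 0" and \<kappa>: "continuous_on UNIV \<kappa>"
    and C: "\<And>x. \<bar>\<kappa> x * Sform S v (y - x)\<bar> \<le> C" "\<And>x. (\<kappa> x)\<^sup>2 * \<bar>qform S v\<bar> \<le> Q"
  defines "F \<equiv> \<lambda>n. real_of_ereal (psi S ((\<lambda>x. x + (e n * \<kappa> x) *\<^sub>R v) ` G) y)"
  shows "(\<lambda>n. (F n - ell S X y) / e n) \<longlonglongrightarrow> \<kappa> X * Sform S v (y - X)"
proof -
  define D where "D = \<kappa> X * Sform S v (y - X)"
  have XP: "X \<in> PG S G y" using X by simp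
  have XG: "X \<in> G" "\<And>x'. x' \<in> G \<Longrightarrow> ell S x' y \<le> ell S X y" using XP by (auto simp: PG_ell)
  have F: "psi S ((\<lambda>x. x + (e n * \<kappa> x) *\<^sub>R v) ` G) y = ereal (F n)"
    "ell S X y + e n * D - (e n)\<^sup>2 * Q \<le> F n" for n
    using psi_perturbed_bounds[OF XP e(1,2) C, of n] by (auto simp: F_def D_def)
  have Q0: "Q \<ge> 0" using C(2)[of 0] by (metis abs_ge_zero mult_nonneg_nonneg order_trans zero_le_power2)
  have C0: "C \<ge> 0" using C(1)[of 0] by linarith
  have lower: "D - e n * Q \<le> (F n - ell S X y) / e n" for n
  proof -
    have "(D - e n * Q) * e n \<le> F n - ell S X y" using F(2)[of n] by (simp add: algebra_simps power2_eq_square)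
    then show ?thesis using e(1)[of n] by (simp add: pos_le_divide_eq)
  qed
  show ?thesis unfolding D_def[symmetric]
  proof (rule tendstoI)
    fix h :: real assume h: "h > 0"
    define V where "V = {x. \<kappa> x * Sform S v (y - x) < D + h / 2}"
    have "open V" unfolding V_def
      by (intro open_Collect_less continuous_intros) (auto intro: continuous_on_subset[OF \<kappa>])
    moreover have "X \<in> V" using h by (simp add: V_def D_def)
    ultimately have "\<exists>d>0. \<forall>x\<in>G - V. ell S x y \<le> ell S X y - d" by (rule level_gap[OF G b X])
    then obtain d where d: "d > 0" "\<And>x. x \<in> G - V \<Longrightarrow> ell S x y \<le> ell S X y - d" by blast
    \<comment> \<open>The first bound keeps the quadratic error \<open>e n * Q\<close> below
      \<open>h / 2\<close>; the second keeps the gain of distant points, at most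
      \<open>e n * (C + Q)\<close>, and the term \<open>e n * \<bar>D\<bar>\<close> together below
      the gap \<open>d\<close>. The added 1 keeps both denominators positive.\<close>
    define m where "m = min (h / (2 * (Q + 1))) (d / (C + Q + \<bar>D\<bar> + 1))"
    have m: "m > 0" using h d Q0 C0 by (simp add: m_def add_nonneg_pos)
    then have "eventually (\<lambda>n. e n < m) sequentially" using order_tendstoD(2)[OF e(3)] by blast
    then show "eventually (\<lambda>n. dist ((F n - ell S X y) / e n) D < h) sequentially"
    proof eventually_elim
      case (elim n)
      let ?e = "e n"
      have e1: "?e * Q < h / 2"
      proof -
        have "?e * (Q + 1) < h / 2"
          using elim Q0 by (simp add: m_def field_simps)
        then show ?thesis using e(1)[of n] by (simp add: algebra_simps)
      qed
      have e2: "?e * (C + Q + \<bar>D\<bar>) \<le> d"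
      proof -
        have "?e * (C + Q + \<bar>D\<bar> + 1) \<le> d"
          using elim Q0 C0 by (simp add: m_def field_simps)
        then show ?thesis using e(1)[of n] by (simp add: algebra_simps)
      qed
      have eQ: "?e\<^sup>2 * Q = ?e * (?e * Q)" by (simp add: power2_eq_square)
      have "ell S (x + (?e * \<kappa> x) *\<^sub>R v) y \<le> ell S X y + ?e * (D + h / 2 + ?e * Q)" if x: "x \<in> G" for x
      proof -
        have q: "\<bar>(?e * \<kappa> x)\<^sup>2 * qform S v\<bar> \<le> ?e * (?e * Q)"
        proof -
          have "\<bar>(?e * \<kappa> x)\<^sup>2 * qform S v\<bar> = ?e\<^sup>2 * ((\<kappa> x)\<^sup>2 * \<bar>qform S v\<bar>)"
            by (simp add: abs_mult power_mult_distrib)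
          then show ?thesis using C(2)[of x] eQ by (metis mult_left_mono zero_le_power2)
        qed
        show ?thesis
        proof (cases "x \<in> V")
          case True
          then have "?e * (\<kappa> x * Sform S v (y - x)) \<le> ?e * (D + h / 2)"
            using e(1)[of n] by (intro mult_left_mono) (auto simp: V_def)
          then show ?thesis unfolding ell_perturbed using q XG(2)[OF x] by (simp add: distrib_left mult.assoc)
        next
          case False
          have "?e * (\<kappa> x * Sform S v (y - x)) \<le> ?e * C"
            using e(1)[of n] C(1)[of x] by (intro mult_left_mono) auto
          moreover have "- (?e * \<bar>D\<bar>) \<le> ?e * D"
            using e(1)[of n] by (simp add: abs_real_def)
          moreover have "?e * (?e * Q) \<le> ?e * Q"
            using e(1,2)[of n] Q0 by (simp add: mult_left_le_one_le mult_left_mono)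
          moreover have "?e * (h / 2) \<ge> 0" using e(1)[of n] h by simp
          ultimately show ?thesis unfolding ell_perturbed using q d(2)[of x] x False e2
            by (simp add: distrib_left mult.assoc)
        qed
      qed
      then have "psi S ((\<lambda>x. x + (?e * \<kappa> x) *\<^sub>R v) ` G) y \<le> ereal (ell S X y + ?e * (D + h / 2 + ?e * Q))"
        unfolding psi_le_iff by blast
      then have "F n - ell S X y \<le> (D + h / 2 + ?e * Q) * ?e" unfolding F(1) by (simp add: mult.commute)
      then have "(F n - ell S X y) / ?e \<le> D + h / 2 + ?e * Q" using e(1)[of n] by (simp add: pos_divide_le_eq)
      then show ?case using lower[of n] e1 h by (simp add: dist_real_def abs_less_iff)
    qed
  qed
qed

end

section \<open>The first-order condition\<close>

lemma borel_measurable_Sform [measurable]: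
  assumes "f \<in> borel_measurable M" "g \<in> borel_measurable M"
  shows "(\<lambda>x. Sform S (f x) (g x)) \<in> borel_measurable M"
  using assms by (rule borel_measurable_continuous_Pair) (intro continuous_intros)

lemma borel_measurable_ell [measurable]:
  assumes [measurable]: "f \<in> borel_measurable M" "g \<in> borel_measurable M"
  shows "(\<lambda>x. ell S (f x) (g x)) \<in> borel_measurable M"
  unfolding ell_def by measurable

lemma borel_measurable_qform [measurable]:
  assumes [measurable]: "f \<in> borel_measurable M"
  shows "(\<lambda>x. qform S (f x)) \<in> borel_measurable M"
  unfolding qform_def by measurable

lemma borel_measurable_component [measurable]:
  fixes f :: "'a \<Rightarrow> real^'n::finite"
  assumes "f \<in> borel_measurable M"
  shows "(\<lambda>x. f x $ i) \<in> borel_measurable M"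
  by (rule measurable_compose[OF assms borel_measurable_continuous_onI]) (intro continuous_intros)

lemma L2vecD:
  assumes "L2vec M X"
  shows "X \<in> borel_measurable M" "integrable M (\<lambda>\<omega>. (norm (X \<omega>))\<^sup>2)"
  using assms by (auto simp: L2vec_def)

lemma L2vec_dominated:
  fixes X Z :: "'a \<Rightarrow> real^'n::finite"
  assumes "finite_measure M" "L2vec M X" "Z \<in> borel_measurable M" "\<And>\<omega>. norm (Z \<omega>) \<le> a + b * norm (X \<omega>)"
  shows "L2vec M Z"
proof -
  interpret finite_measure M by fact
  have "integrable M (\<lambda>\<omega>. 2 * a\<^sup>2 + 2 * b\<^sup>2 * (norm (X \<omega>))\<^sup>2)"
    using L2vecD(2)[OF assms(2)] by simp
  moreover have "(\<lambda>\<omega>. (norm (Z \<omega>))\<^sup>2) \<in> borel_measurable M" using assms(3) by measurable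
  moreover have "(norm (Z \<omega>))\<^sup>2 \<le> 2 * a\<^sup>2 + 2 * b\<^sup>2 * (norm (X \<omega>))\<^sup>2" for \<omega>
  proof -
    have "(norm (Z \<omega>))\<^sup>2 \<le> (a + b * norm (X \<omega>))\<^sup>2" using assms(4) by (intro power_mono) auto
    also have "\<dots> \<le> 2 * a\<^sup>2 + 2 * (b * norm (X \<omega>))\<^sup>2"
      using sum_squares_bound[of a "b * norm (X \<omega>)"] by (simp add: power2_sum)
    finally show ?thesis by (simp add: power_mult_distrib)
  qed
  ultimately have "integrable M (\<lambda>\<omega>. (norm (Z \<omega>))\<^sup>2)"
    by (elim Bochner_Integration.integrable_bound) auto
  then show ?thesis using assms(3) by (simp add: L2vec_def)
qed

lemma L2vec_integrable_mult:
  fixes X Z :: "'a \<Rightarrow> real^'n::finite"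
  assumes "L2vec M X" "L2vec M Z" "f \<in> borel_measurable M"
    "\<And>\<omega>. \<bar>f \<omega>\<bar> \<le> C * norm (X \<omega>) * norm (Z \<omega>)" "C \<ge> 0"
  shows "integrable M f"
proof (rule Bochner_Integration.integrable_bound)
  show "integrable M (\<lambda>\<omega>. C * ((norm (X \<omega>))\<^sup>2 + (norm (Z \<omega>))\<^sup>2))"
    using L2vecD(2)[OF assms(1)] L2vecD(2)[OF assms(2)] by simp
  show "AE \<omega> in M. norm (f \<omega>) \<le> norm (C * ((norm (X \<omega>))\<^sup>2 + (norm (Z \<omega>))\<^sup>2))"
  proof (rule AE_I2)
    fix \<omega>
    have "\<bar>f \<omega>\<bar> \<le> C * (norm (X \<omega>) * norm (Z \<omega>))" using assms(4)[of \<omega>] by (simp add: mult.assoc)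
    also have "\<dots> \<le> C * ((norm (X \<omega>))\<^sup>2 + (norm (Z \<omega>))\<^sup>2)"
    proof (rule mult_left_mono[OF _ assms(5)])
      have "0 \<le> norm (X \<omega>) * norm (Z \<omega>)" by simp
      then show "norm (X \<omega>) * norm (Z \<omega>) \<le> (norm (X \<omega>))\<^sup>2 + (norm (Z \<omega>))\<^sup>2"
        using sum_squares_bound[of "norm (X \<omega>)" "norm (Z \<omega>)"] by linarith
    qed
    finally show "norm (f \<omega>) \<le> norm (C * ((norm (X \<omega>))\<^sup>2 + (norm (Z \<omega>))\<^sup>2))"
      using assms(5) by simp
  qed
qed fact

lemma L2vec_integrable_Sform:
  assumes "L2vec M X" "L2vec M Z"
  shows "integrable M (\<lambda>\<omega>. Sform S (X \<omega>) (Z \<omega>))"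
proof -
  obtain C where "C > 0" "\<And>x y. \<bar>Sform S x y\<bar> \<le> C * norm x * norm y" using Sform_bound by blast
  then show ?thesis using L2vecD(1)[OF assms(1)] L2vecD(1)[OF assms(2)]
    by (intro L2vec_integrable_mult[OF assms, where C = C]) auto
qed

lemma L2vec_integrable_qform: "L2vec M X \<Longrightarrow> integrable M (\<lambda>\<omega>. qform S (X \<omega>))"
  unfolding qform_def by (intro integrable_divide L2vec_integrable_Sform)

lemma L2vec_integrable_ell:
  "L2vec M X \<Longrightarrow> L2vec M Z \<Longrightarrow> integrable M (\<lambda>\<omega>. ell S (X \<omega>) (Z \<omega>))"
  unfolding ell_def by (intro Bochner_Integration.integrable_diff integrable_divide L2vec_integrable_Sform)

lemma L2vec_integrable_norm:
  assumes "finite_measure M" "L2vec M X"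
  shows "integrable M (\<lambda>\<omega>. norm (X \<omega>))"
proof -
  interpret finite_measure M by fact
  have "integrable M (\<lambda>\<omega>. 1 + (norm (X \<omega>))\<^sup>2)" using L2vecD(2)[OF assms(2)] by simp
  then show ?thesis
  proof (rule Bochner_Integration.integrable_bound)
    have *: "x \<le> 1 + x\<^sup>2" for x :: real
      using sum_squares_bound[of x 1] zero_le_power2[of x] unfolding mult_1_right one_power2 by linarith
    show "AE \<omega> in M. norm (norm (X \<omega>)) \<le> norm (1 + (norm (X \<omega>))\<^sup>2)"
      using *[of "norm (X _)"] by (intro AE_I2) simp
    show "(\<lambda>\<omega>. norm (X \<omega>)) \<in> borel_measurable M"
      using L2vecD(1)[OF assms(2)] by measurable
  qed
qed

lemma L2vec_integrable_component:
  assumes "finite_measure M" "L2vec M X"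
  shows "integrable M (\<lambda>\<omega>. X \<omega> $ i)"
  using L2vec_integrable_norm[OF assms]
  by (rule Bochner_Integration.integrable_bound)
    (auto simp: component_le_norm_cart intro: borel_measurable_component L2vecD(1)[OF assms(2)])

text \<open>Equal to 1 on the ball of radius \<open>n\<close> and 0 beyond \<open>n + 1\<close>:
  continuous with bounded support, as test fields must be, and increasing to 1.\<close>

definition cutoff :: "nat \<Rightarrow> real^'n::finite \<Rightarrow> real" where
  "cutoff n x = max 0 (min 1 (real n + 1 - norm x))"

lemma cutoff: "0 \<le> cutoff n x" "cutoff n x \<le> 1" "norm x > real n + 1 \<Longrightarrow> cutoff n x = 0"
  "continuous_on A (cutoff n)" "m \<le> n \<Longrightarrow> cutoff m x \<le> cutoff n x"
  unfolding cutoff_def by (auto intro!: continuous_intros)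

lemma cutoff_tendsto: "(\<lambda>n. cutoff n x) \<longlonglongrightarrow> 1"
proof (rule tendsto_eventually)
  obtain N :: nat where "norm x \<le> real N" using real_arch_simple by blast
  then have "cutoff n x = 1" if "n \<ge> N" for n using that by (auto simp: cutoff_def min_def max_def)
  then show "\<forall>\<^sub>F n in sequentially. cutoff n x = 1" unfolding eventually_sequentially by blast
qed

lemma borel_measurable_cutoff [measurable]: "cutoff n \<in> borel_measurable borel"
  by (rule borel_measurable_continuous_onI) (rule cutoff(4))

context pseudo_euclidean
begin

text \<open>The composition of \<open>qform S\<close> with \<open>P\<close> is convex and above
  \<open>qform S\<close>. Its quadratic growth makes it integrable at \<open>Y\<close>, so it
  provides a dual competitor of finite value.\<close>

lemma exists_maxmon_psi_le_positive_part:
  "\<exists>H\<in>maxmon S. \<forall>w. psi S H w \<le> ereal (qform S (P w))"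
proof -
  let ?E = "{(w, s). qform S (P w) \<le> s}"
  have "\<exists>H\<in>maxmon S. \<forall>(w, s)\<in>?E. psi S H w \<le> ereal s"
  proof (rule exists_maxmon_below)
    show "convex ?E"
    proof (unfold convex_def, clarsimp)
      fix a b a' b' and u v :: real
      assume *: "qform S (P a) \<le> b" "qform S (P a') \<le> b'" "0 \<le> u" "0 \<le> v" "u + v = 1"
      have "qform S (P (u *\<^sub>R a + v *\<^sub>R a')) \<le> u * qform S (P a) + v * qform S (P a')"
        unfolding P_add P_scaleR qform_convex_comb[OF *(5)] P_diff[symmetric]
        using *(3,4) qform_P_nonneg[of "a - a'"] by simp
      also have "\<dots> \<le> u * b + v * b'" using * by (intro add_mono mult_left_mono) auto
      finally show "qform S (P (u *\<^sub>R a + v *\<^sub>R a')) \<le> u * b + v * b'" .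
    qed
    fix w s assume "(w, s) \<in> ?E"
    moreover have "qform S (w - P w) \<le> 0" by (rule qform_ker_nonpos) (simp add: P_diff idemP)
    ultimately show "qform S w \<le> s" using qform_split[of w] by simp
  qed
  then show ?thesis by auto
qed

end

section \<open>Almost sure structure of a dual optimal set and its martingale property\<close>

context transport
begin

lemma Y_measurable [measurable]: "Y \<in> borel_measurable M"
  using L2vecD(1)[OF L2Y] .

lemma integrable_norm_Y: "integrable M (\<lambda>\<omega>. norm (Y \<omega>))"
  by (rule L2vec_integrable_norm[OF finite_measure_axioms L2Y])

abbreviation "Z G \<equiv> (\<lambda>\<omega>. proj_point S G (Y \<omega>))"

lemma Z_measurable: "G \<in> maxmon S \<Longrightarrow> Z G \<in> borel_measurable M"
  by (rule measurable_compose[OF Y_measurable borel_measurable_proj_point])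

lemma ext_int_Y: "ext_int (distr M borel Y) (psi S G) = ext_int M (\<lambda>\<omega>. psi S G (Y \<omega>))"
  by (rule ext_int_distr) measurable

lemma dual_optimalD:
  assumes "dual_optimal S (distr M borel Y) G"
  shows "G \<in> maxmon S" "\<And>H. H \<in> maxmon S \<Longrightarrow> ext_int M (\<lambda>\<omega>. psi S G (Y \<omega>)) \<le> ext_int M (\<lambda>\<omega>. psi S H (Y \<omega>))"
  using assms by (auto simp: dual_optimal_def ext_int_Y)

lemma dual_optimal_finite:
  assumes "dual_optimal S (distr M borel Y) G"
  shows "ext_int M (\<lambda>\<omega>. psi S G (Y \<omega>)) < \<infinity>"
proof -
  obtain H where H: "H \<in> maxmon S" "\<And>w. psi S H w \<le> ereal (qform S (P w))"
    using exists_maxmon_psi_le_positive_part by blast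
  obtain K where K: "\<And>x. norm (P x) \<le> norm x * K"
    using bounded_linear.bounded[of P] linear_conv_bounded_linear[of P] linP by blast
  have "L2vec M (\<lambda>\<omega>. P (Y \<omega>))"
  proof (rule L2vec_dominated[OF finite_measure_axioms L2Y])
    show "(\<lambda>\<omega>. P (Y \<omega>)) \<in> borel_measurable M"
      using linP by (intro measurable_compose[OF Y_measurable] borel_measurable_continuous_onI linear_continuous_on)
        (simp add: linear_conv_bounded_linear)
    show "norm (P (Y \<omega>)) \<le> 0 + K * norm (Y \<omega>)" for \<omega> using K[of "Y \<omega>"] by (simp add: mult.commute)
  qed
  then have "integrable M (\<lambda>\<omega>. qform S (P (Y \<omega>)))" by (rule L2vec_integrable_qform)
  then have "ext_int M (\<lambda>\<omega>. ereal (qform S (P (Y \<omega>)))) < \<infinity>" by (subst ext_int_real) auto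
  moreover have "ext_int M (\<lambda>\<omega>. psi S H (Y \<omega>)) \<le> ext_int M (\<lambda>\<omega>. ereal (qform S (P (Y \<omega>))))"
    using H(2) by (intro ext_int_mono) auto
  ultimately show ?thesis using dual_optimalD(2)[OF assms H(1)] by (meson order_trans order_le_less_trans)
qed

text \<open>A finite dual value makes \<open>psi\<close> almost surely finite; this activates the
  boundedness of level sets, which gives existence of a maximiser, and (A4) gives
  uniqueness.\<close>

lemma AE_dual_optimal:
  assumes dG: "dual_optimal S (distr M borel Y) G"
  shows "AE \<omega> in M. (\<forall>k. bounded {x\<in>G. k \<le> ell S x (Y \<omega>)}) \<and> PG S G (Y \<omega>) = {Z G \<omega>}"
    and "integrable M (\<lambda>\<omega>. ell S (Z G \<omega>) (Y \<omega>))"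
    and "ext_int M (\<lambda>\<omega>. psi S G (Y \<omega>)) = ereal (\<integral>\<omega>. ell S (Z G \<omega>) (Y \<omega>) \<partial>M)"
proof -
  note G = dual_optimalD(1)[OF dG]
  have [measurable]: "(\<lambda>\<omega>. psi S G (Y \<omega>)) \<in> borel_measurable M" "Z G \<in> borel_measurable M"
    using Z_measurable[OF G] by auto
  note f = ext_int_finiteD[OF this(1) L2vec_integrable_qform[OF L2Y] qform_le_psi[OF G] dual_optimal_finite[OF dG]]
  show good: "AE \<omega> in M. (\<forall>k. bounded {x\<in>G. k \<le> ell S x (Y \<omega>)}) \<and> PG S G (Y \<omega>) = {Z G \<omega>}"
    using f(2) AE_bounded_level[OF G] AE_not_SigmaP[OF G]
  proof eventually_elim
    case (elim \<omega>)
    then have "psi S G (Y \<omega>) < \<infinity>" by (metis ereal_less_PInfty ereal_infty_less(1) less_ereal.simps(4))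
    then have b: "\<And>k. bounded {x\<in>G. k \<le> ell S x (Y \<omega>)}" using elim by blast
    then have "PG S G (Y \<omega>) \<noteq> {}" by (rule PG_nonempty[OF G])
    then obtain z where "PG S G (Y \<omega>) = {z}" using elim by (auto simp: SigmaP_def)
    then show ?case using b by (auto simp: proj_point_def)
  qed
  then have eq: "AE \<omega> in M. psi S G (Y \<omega>) = ereal (ell S (Z G \<omega>) (Y \<omega>))"
    by (rule eventually_mono) (simp add: PG_psi)
  then have "AE \<omega> in M. real_of_ereal (psi S G (Y \<omega>)) = ell S (Z G \<omega>) (Y \<omega>)"
    by (rule eventually_mono) simp
  then show i: "integrable M (\<lambda>\<omega>. ell S (Z G \<omega>) (Y \<omega>))"
    using f(1) by (subst integrable_cong_AE[symmetric]) auto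
  show "ext_int M (\<lambda>\<omega>. psi S G (Y \<omega>)) = ereal (\<integral>\<omega>. ell S (Z G \<omega>) (Y \<omega>) \<partial>M)"
    by (rule ext_int_real[OF i eq])
qed

text \<open>The optimum is compared with displaced sets, and the difference quotients of the
  integrals converge by domination. Step sizes are positive, hence an inequality for each direction
  \<open>v\<close>.\<close>

lemma first_order_condition:
  fixes \<kappa> :: "real^'n \<Rightarrow> real"
  assumes dG: "dual_optimal S (distr M borel Y) G" and \<kappa>: "continuous_on UNIV \<kappa>"
    and K: "\<And>x. \<bar>\<kappa> x\<bar> \<le> K" and R: "\<And>x. norm x > R \<Longrightarrow> \<kappa> x = 0"
  shows "(\<integral>\<omega>. \<kappa> (Z G \<omega>) * Sform S v (Y \<omega> - Z G \<omega>) \<partial>M) \<ge> 0"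
proof -
  note G = dual_optimalD(1)[OF dG]
  have [measurable]: "Z G \<in> borel_measurable M" by (rule Z_measurable[OF G])
  have [measurable]: "\<kappa> \<in> borel_measurable borel" using \<kappa> by (rule borel_measurable_continuous_onI)
  define e where "e = (\<lambda>n. inverse (real (Suc n)))"
  have e: "0 < e n" "e n \<le> 1" for n by (auto simp: e_def inverse_eq_divide)
  have e_lim: "e \<longlonglongrightarrow> 0" unfolding e_def by (rule LIMSEQ_inverse_real_of_nat)
  obtain L where L: "L > 0" "\<And>x y. \<bar>Sform S x y\<bar> \<le> L * norm x * norm y" using Sform_bound by blast
  have K0: "K \<ge> 0" using K[of 0] by linarith
  \<comment> \<open>Where \<open>\<kappa>\<close> does not vanish, \<open>norm x \<le> R\<close>, so
    the linear term is bounded affinely in \<open>norm y\<close>. The absolute value keeps the bound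
    nonnegative when \<open>R < 0\<close>.\<close>
  define C where "C = (\<lambda>y::real^'n. K * (L * norm v * (norm y + \<bar>R\<bar>)))"
  define Q where "Q = K\<^sup>2 * \<bar>qform S v\<bar>"
  have C: "\<bar>\<kappa> x * Sform S v (y - x)\<bar> \<le> C y" for x y
  proof (cases "norm x > R")
    case True
    then show ?thesis using R K0 L(1) by (simp add: C_def)
  next
    case False
    have "\<bar>\<kappa> x * Sform S v (y - x)\<bar> \<le> K * (L * norm v * norm (y - x))"
      unfolding abs_mult using K[of x] K0 L(2)[of v "y - x"] by (intro mult_mono) auto
    also have "\<dots> \<le> C y"
      unfolding C_def using K0 L(1) False norm_triangle_ineq4[of y x] by (intro mult_left_mono) auto
    finally show ?thesis .
  qed
  have Q: "(\<kappa> x)\<^sup>2 * \<bar>qform S v\<bar> \<le> Q" for x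
    unfolding Q_def using K[of x] by (intro mult_right_mono) (auto simp: abs_le_square_iff[symmetric] K0)
  define Gn where "Gn = (\<lambda>n. (\<lambda>x. x + (e n * \<kappa> x) *\<^sub>R v) ` G)"
  define F where "F = (\<lambda>n \<omega>. real_of_ereal (psi S (Gn n) (Y \<omega>)))"
  define l where "l = (\<lambda>\<omega>. ell S (Z G \<omega>) (Y \<omega>))"
  have [measurable]: "F n \<in> borel_measurable M" "l \<in> borel_measurable M" for n
    unfolding F_def l_def by measurable
  note good = AE_dual_optimal[OF dG, folded l_def]
  have bnd: "AE \<omega> in M. psi S (Gn n) (Y \<omega>) = ereal (F n \<omega>) \<and> \<bar>F n \<omega> - l \<omega>\<bar> \<le> e n * (C (Y \<omega>) + Q)" for n
    using good(1)
  proof eventually_elim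
    case (elim \<omega>)
    then have "Z G \<omega> \<in> PG S G (Y \<omega>)" by simp
    from psi_perturbed_bounds[OF this e C Q, of n] show ?case by (auto simp: F_def l_def Gn_def)
  qed
  have int_w: "integrable M (\<lambda>\<omega>. C (Y \<omega>) + Q)"
    unfolding C_def using integrable_norm_Y by simp
  have CQ: "C y + Q \<ge> 0" for y unfolding C_def Q_def using K0 L(1) by simp
  have int_d: "integrable M (\<lambda>\<omega>. F n \<omega> - l \<omega>)" for n
  proof (rule Bochner_Integration.integrable_bound[OF int_w])
    show "AE \<omega> in M. norm (F n \<omega> - l \<omega>) \<le> norm (C (Y \<omega>) + Q)"
      using bnd[of n]
    proof eventually_elim
      case (elim \<omega>)
      have "e n * (C (Y \<omega>) + Q) \<le> C (Y \<omega>) + Q" using e[of n] CQ by (simp add: mult_left_le_one_le)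
      then show ?case using elim CQ[of "Y \<omega>"] by simp
    qed
  qed measurable
  have int_F: "integrable M (F n)" for n
    using Bochner_Integration.integrable_add[OF int_d[of n] good(2)] by simp
  \<comment> \<open>\<open>Gn n\<close> need not be monotone; optimality applies to a maximal
    monotone \<open>H\<close> whose \<open>psi\<close> lies below.\<close>
  have ge: "(\<integral>\<omega>. l \<omega> \<partial>M) \<le> (\<integral>\<omega>. F n \<omega> \<partial>M)" for n
  proof -
    obtain H where H: "H \<in> maxmon S" "\<And>w. psi S H w \<le> psi S (Gn n) w"
      using exists_maxmon_psi_le[OF qform_le_psi_perturbed[OF G \<kappa> K]] unfolding Gn_def by blast
    have "ereal (\<integral>\<omega>. l \<omega> \<partial>M) \<le> ext_int M (\<lambda>\<omega>. psi S H (Y \<omega>))"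
      using dual_optimalD(2)[OF dG H(1)] good(3) by simp
    also have "\<dots> \<le> ext_int M (\<lambda>\<omega>. psi S (Gn n) (Y \<omega>))" using H(2) by (intro ext_int_mono) auto
    also have "\<dots> = ereal (\<integral>\<omega>. F n \<omega> \<partial>M)"
      using bnd[of n] by (intro ext_int_real[OF int_F]) (auto elim!: eventually_mono)
    finally show ?thesis by simp
  qed
  have "(\<lambda>n. \<integral>\<omega>. (F n \<omega> - l \<omega>) / e n \<partial>M) \<longlonglongrightarrow> (\<integral>\<omega>. \<kappa> (Z G \<omega>) * Sform S v (Y \<omega> - Z G \<omega>) \<partial>M)"
  proof (rule integral_dominated_convergence[OF _ _ int_w])
    show "AE \<omega> in M. (\<lambda>n. (F n \<omega> - l \<omega>) / e n) \<longlonglongrightarrow> \<kappa> (Z G \<omega>) * Sform S v (Y \<omega> - Z G \<omega>)"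
      using good(1)
    proof eventually_elim
      case (elim \<omega>)
      have "bounded {x\<in>G. k \<le> ell S x (Y \<omega>)}" for k using elim by blast
      from psi_perturbed_limit[OF G this conjunct2[OF elim] e e_lim \<kappa> C Q]
      show ?case unfolding F_def l_def Gn_def .
    qed
    show "AE \<omega> in M. norm ((F n \<omega> - l \<omega>) / e n) \<le> C (Y \<omega>) + Q" for n
      using bnd[of n] by (rule eventually_mono) (use e[of n] in \<open>simp add: abs_divide pos_divide_le_eq mult.commute\<close>)
  qed measurable
  moreover have "(\<integral>\<omega>. (F n \<omega> - l \<omega>) / e n \<partial>M) \<ge> 0" for n
    using ge[of n] e(1)[of n] int_F[of n] good(2) by simp
  ultimately show ?thesis by (intro LIMSEQ_le_const) auto
qed

text \<open>Invertibility provides \<open>v\<close> for which \<open>Sform S v\<close> is the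
  \<open>i\<close>-th coordinate; the directions \<open>v\<close> and \<open>- v\<close> give both
  inequalities.\<close>

lemma first_order_equation:
  fixes \<kappa> :: "real^'n \<Rightarrow> real"
  assumes dG: "dual_optimal S (distr M borel Y) G" and \<kappa>: "continuous_on UNIV \<kappa>"
    and K: "\<And>x. \<bar>\<kappa> x\<bar> \<le> K" and R: "\<And>x. norm x > R \<Longrightarrow> \<kappa> x = 0"
  shows "(\<integral>\<omega>. \<kappa> (Z G \<omega>) * (Y \<omega> $ i - Z G \<omega> $ i) \<partial>M) = 0"
proof -
  obtain v where v: "axis i 1 = S *v v" using surj_S by blast
  have c: "Sform S v d = d $ i" for d
    unfolding Sform_commute[of v d] unfolding Sform_def v[symmetric] by (simp add: inner_axis)
  have "(\<integral>\<omega>. \<kappa> (Z G \<omega>) * Sform S v (Y \<omega> - Z G \<omega>) \<partial>M) \<ge> 0"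
    by (rule first_order_condition[OF assms])
  moreover have "(\<integral>\<omega>. \<kappa> (Z G \<omega>) * Sform S (- v) (Y \<omega> - Z G \<omega>) \<partial>M) \<ge> 0"
    by (rule first_order_condition[OF assms])
  ultimately show ?thesis unfolding form.minus_left c mult_minus_right by simp
qed

text \<open>Testing with \<open>cutoff n x * x $ i\<close> and summing over \<open>i\<close>
  identifies the truncated second moment of the maximiser with a truncated inner product with
  \<open>Y\<close>. By the inequality of the means half of that moment is absorbed, which leaves a
  bound by the second moment of \<open>Y\<close> uniform in \<open>n\<close>.\<close>

lemma Z_L2:
  assumes dG: "dual_optimal S (distr M borel Y) G"
  shows "L2vec M (Z G)"
proof -
  note G = dual_optimalD(1)[OF dG]
  have Zm[measurable]: "Z G \<in> borel_measurable M" by (rule Z_measurable[OF G])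
  let ?Z = "Z G"
  let ?f = "\<lambda>n \<omega>. cutoff n (?Z \<omega>) * (norm (?Z \<omega>))\<^sup>2"
  have cn: "cutoff n x * norm x \<le> real n + 1" for n and x :: "real^'n"
  proof (cases "norm x > real n + 1")
    case True
    then show ?thesis by (simp add: cutoff)
  next
    case False
    then show ?thesis using cutoff(1,2)[of n x] by (smt (verit, best) mult_left_le_one_le norm_ge_zero)
  qed
  have int_f: "integrable M (?f n)" for n
  proof (rule integrable_const_bound[where B = "(real n + 1)\<^sup>2"])
    have "cutoff n x * (norm x)\<^sup>2 \<le> (real n + 1)\<^sup>2" for x :: "real^'n"
    proof (cases "norm x > real n + 1")
      case True
      then show ?thesis by (simp add: cutoff)
    next
      case False
      then have "1 * (norm x)\<^sup>2 \<le> (real n + 1)\<^sup>2" by (auto intro: power_mono)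
      moreover have "cutoff n x * (norm x)\<^sup>2 \<le> 1 * (norm x)\<^sup>2" using cutoff(2)[of n x] by (intro mult_right_mono) auto
      ultimately show ?thesis by linarith
    qed
    then show "AE \<omega> in M. norm (?f n \<omega>) \<le> (real n + 1)\<^sup>2" by (simp add: cutoff(1))
  qed measurable
  have int_c: "integrable M (\<lambda>\<omega>. cutoff n (?Z \<omega>) * ?Z \<omega> $ i * (Y \<omega> $ i))" for n i
  proof (rule Bochner_Integration.integrable_bound)
    show "integrable M (\<lambda>\<omega>. (real n + 1) * norm (Y \<omega>))" using integrable_norm_Y by simp
    show "AE \<omega> in M. norm (cutoff n (?Z \<omega>) * ?Z \<omega> $ i * (Y \<omega> $ i)) \<le> norm ((real n + 1) * norm (Y \<omega>))"
    proof (rule AE_I2)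
      fix \<omega>
      have "\<bar>cutoff n (?Z \<omega>) * ?Z \<omega> $ i\<bar> \<le> cutoff n (?Z \<omega>) * norm (?Z \<omega>)"
        unfolding abs_mult by (simp add: cutoff(1) component_le_norm_cart mult_left_mono)
      then have "\<bar>cutoff n (?Z \<omega>) * ?Z \<omega> $ i\<bar> * \<bar>Y \<omega> $ i\<bar> \<le> (real n + 1) * norm (Y \<omega>)"
        using cn[of n "?Z \<omega>"] by (intro mult_mono component_le_norm_cart) auto
      then show "norm (cutoff n (?Z \<omega>) * ?Z \<omega> $ i * (Y \<omega> $ i)) \<le> norm ((real n + 1) * norm (Y \<omega>))"
        by (simp add: abs_mult)
    qed
  qed measurable
  have int_z: "integrable M (\<lambda>\<omega>. cutoff n (?Z \<omega>) * ?Z \<omega> $ i * (?Z \<omega> $ i))" for n i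
  proof (rule Bochner_Integration.integrable_bound[OF int_f[of n]])
    show "AE \<omega> in M. norm (cutoff n (?Z \<omega>) * ?Z \<omega> $ i * (?Z \<omega> $ i)) \<le> norm (?f n \<omega>)"
    proof (rule AE_I2)
      fix \<omega>
      have "\<bar>?Z \<omega> $ i\<bar> * \<bar>?Z \<omega> $ i\<bar> \<le> norm (?Z \<omega>) * norm (?Z \<omega>)"
        by (intro mult_mono component_le_norm_cart) auto
      then show "norm (cutoff n (?Z \<omega>) * ?Z \<omega> $ i * (?Z \<omega> $ i)) \<le> norm (?f n \<omega>)"
        using cutoff(1)[of n "?Z \<omega>"] by (simp add: abs_mult power2_eq_square mult.assoc mult_left_mono)
    qed
  qed measurable
  have le: "(\<integral>\<omega>. ?f n \<omega> \<partial>M) \<le> (\<integral>\<omega>. (norm (Y \<omega>))\<^sup>2 \<partial>M)" for n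
  proof -
    have "(\<integral>\<omega>. cutoff n (?Z \<omega>) * ?Z \<omega> $ i * (Y \<omega> $ i - ?Z \<omega> $ i) \<partial>M) = 0" for i
    proof (rule first_order_equation[OF dG, where K = "real n + 1" and R = "real n + 1"])
      show "continuous_on UNIV (\<lambda>x::real^'n. cutoff n x * x $ i)" by (intro continuous_intros cutoff)
      show "\<bar>cutoff n x * x $ i\<bar> \<le> real n + 1" for x :: "real^'n"
      proof -
        have "\<bar>cutoff n x * x $ i\<bar> \<le> cutoff n x * norm x"
          unfolding abs_mult by (simp add: cutoff(1) component_le_norm_cart mult_left_mono)
        then show ?thesis using cn[of n x] by linarith
      qed
    qed (simp add: cutoff(3))
    then have "(\<integral>\<omega>. cutoff n (?Z \<omega>) * ?Z \<omega> $ i * (Y \<omega> $ i) \<partial>M) = (\<integral>\<omega>. cutoff n (?Z \<omega>) * ?Z \<omega> $ i * (?Z \<omega> $ i) \<partial>M)" for i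
      using Bochner_Integration.integral_diff[OF int_c[of n i] int_z[of n i]] by (simp add: right_diff_distrib)
    then have "(\<integral>\<omega>. (\<Sum>i\<in>UNIV. cutoff n (?Z \<omega>) * ?Z \<omega> $ i * (Y \<omega> $ i)) \<partial>M) = (\<integral>\<omega>. (\<Sum>i\<in>UNIV. cutoff n (?Z \<omega>) * ?Z \<omega> $ i * (?Z \<omega> $ i)) \<partial>M)"
      using int_c[of n] int_z[of n] by (simp add: Bochner_Integration.integral_sum)
    moreover have "(\<Sum>i\<in>UNIV. cutoff n (?Z \<omega>) * ?Z \<omega> $ i * (w $ i)) = cutoff n (?Z \<omega>) * (?Z \<omega> \<bullet> w)" for \<omega> w
      by (simp add: inner_vec_def sum_distrib_left mult.assoc)
    ultimately have eq: "(\<integral>\<omega>. cutoff n (?Z \<omega>) * (?Z \<omega> \<bullet> Y \<omega>) \<partial>M) = (\<integral>\<omega>. ?f n \<omega> \<partial>M)"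
      by (simp add: power2_norm_eq_inner)
    have int_i: "integrable M (\<lambda>\<omega>. cutoff n (?Z \<omega>) * (?Z \<omega> \<bullet> Y \<omega>))"
      using Bochner_Integration.integrable_sum[of UNIV M "\<lambda>i \<omega>. cutoff n (?Z \<omega>) * ?Z \<omega> $ i * (Y \<omega> $ i)"] int_c[of n]
      by (simp add: inner_vec_def sum_distrib_left mult.assoc)
    have "(\<integral>\<omega>. cutoff n (?Z \<omega>) * (?Z \<omega> \<bullet> Y \<omega>) \<partial>M) \<le> (\<integral>\<omega>. ?f n \<omega> / 2 + (norm (Y \<omega>))\<^sup>2 / 2 \<partial>M)"
    proof (rule integral_mono[OF int_i])
      show "integrable M (\<lambda>\<omega>. ?f n \<omega> / 2 + (norm (Y \<omega>))\<^sup>2 / 2)"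
        using int_f[of n] L2vecD(2)[OF L2Y] by simp
      fix \<omega>
      let ?a = "norm (?Z \<omega>)" and ?b = "norm (Y \<omega>)"
      have "?Z \<omega> \<bullet> Y \<omega> \<le> ?a * ?b" by (rule norm_cauchy_schwarz)
      also have "\<dots> \<le> (?a\<^sup>2 + ?b\<^sup>2) / 2" using sum_squares_bound[of ?a ?b] by simp
      finally have "cutoff n (?Z \<omega>) * (?Z \<omega> \<bullet> Y \<omega>) \<le> cutoff n (?Z \<omega>) * ((?a\<^sup>2 + ?b\<^sup>2) / 2)"
        using cutoff(1) by (intro mult_left_mono) auto
      also have "\<dots> = ?f n \<omega> / 2 + cutoff n (?Z \<omega>) * ?b\<^sup>2 / 2" by (simp add: field_simps)
      also have "\<dots> \<le> ?f n \<omega> / 2 + 1 * ?b\<^sup>2 / 2"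
        using cutoff(2)[of n "?Z \<omega>"] by (intro add_left_mono divide_right_mono mult_right_mono) auto
      finally show "cutoff n (?Z \<omega>) * (?Z \<omega> \<bullet> Y \<omega>) \<le> ?f n \<omega> / 2 + (norm (Y \<omega>))\<^sup>2 / 2" by simp
    qed
    also have "\<dots> = (\<integral>\<omega>. ?f n \<omega> \<partial>M) / 2 + (\<integral>\<omega>. (norm (Y \<omega>))\<^sup>2 \<partial>M) / 2"
      using int_f[of n] L2vecD(2)[OF L2Y] by simp
    finally show ?thesis unfolding eq by simp
  qed
  have mono_f: "mono (\<lambda>n. ?f n \<omega>)" for \<omega>
    by (intro monoI mult_right_mono cutoff) auto
  then have "incseq (\<lambda>n. \<integral>\<omega>. ?f n \<omega> \<partial>M)"
    by (intro monoI integral_mono int_f) (auto dest: monoD)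
  then obtain r where "(\<lambda>n. \<integral>\<omega>. ?f n \<omega> \<partial>M) \<longlonglongrightarrow> r"
    using le incseq_convergent by blast
  moreover have "(\<lambda>n. ?f n \<omega>) \<longlonglongrightarrow> (norm (?Z \<omega>))\<^sup>2" for \<omega>
    using tendsto_mult[OF cutoff_tendsto[of "?Z \<omega>"] tendsto_const] by simp
  ultimately have "integrable M (\<lambda>\<omega>. (norm (?Z \<omega>))\<^sup>2)"
    using mono_f by (intro integrable_monotone_convergence[OF int_f]) auto
  then show ?thesis by (simp add: L2vec_def Zm)
qed

lemma Z_martingale:
  assumes dG: "dual_optimal S (distr M borel Y) G" and A: "A \<in> sets borel"
  shows "(\<integral>\<omega>. indicator A (Z G \<omega>) * (Y \<omega> $ i - Z G \<omega> $ i) \<partial>M) = 0"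
proof -
  note G = dual_optimalD(1)[OF dG]
  have Zm[measurable]: "Z G \<in> borel_measurable M" by (rule Z_measurable[OF G])
  let ?f = "\<lambda>\<omega>. Y \<omega> $ i - Z G \<omega> $ i"
  have int: "integrable M ?f"
    by (intro Bochner_Integration.integrable_diff L2vec_integrable_component[OF finite_measure_axioms]
        L2Y Z_L2[OF dG])
  show ?thesis
  proof (rule integral_indicator_closed_imp_borel[OF Zm int _ A])
    fix F :: "(real^'n) set" assume F: "closed F"
    show "(\<integral>\<omega>. indicator F (Z G \<omega>) * ?f \<omega> \<partial>M) = 0"
    proof (cases "F = {}")
      case False
      \<comment> \<open>The second factor is 1 on \<open>F\<close> and, for positive
        \<open>n\<close>, 0 at distance at least \<open>1 / n\<close>; the cutoff provides bounded
        support. The empty set is treated apart because \<open>infdist\<close> to it is 0.\<close>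
      define \<kappa> where "\<kappa> = (\<lambda>n (x::real^'n). cutoff n x * max 0 (1 - real n * infdist x F))"
      have k: "\<bar>\<kappa> n x\<bar> \<le> 1" for n x
      proof -
        have "max 0 (1 - real n * infdist x F) \<le> 1" by (simp add: infdist_nonneg)
        then show ?thesis unfolding \<kappa>_def using cutoff(1,2)[of n x] by (simp add: abs_mult mult_le_one)
      qed
      have kc: "continuous_on UNIV (\<kappa> n)" for n
        unfolding \<kappa>_def by (intro continuous_intros cutoff)
      have [measurable]: "\<kappa> n \<in> borel_measurable borel" for n
        using kc by (rule borel_measurable_continuous_onI)
      have [measurable]: "F \<in> sets borel" using F by simp
      have lim: "(\<lambda>n. \<kappa> n x) \<longlonglongrightarrow> indicator F x" for x
      proof (cases "x \<in> F")
        case True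
        then have "infdist x F = 0" by simp
        then show ?thesis using cutoff_tendsto[of x] True by (simp add: \<kappa>_def)
      next
        case nF: False
        then have d: "infdist x F > 0"
          using in_closed_iff_infdist_zero[OF F False, of x] infdist_nonneg[of x F] by linarith
        obtain N :: nat where N: "1 / infdist x F \<le> real N" using real_arch_simple by blast
        have "\<kappa> n x = 0" if "n \<ge> N" for n
        proof -
          have "1 / infdist x F \<le> real n" using N that by linarith
          then have "1 \<le> real n * infdist x F" using d by (simp add: pos_divide_le_eq)
          then show ?thesis by (simp add: \<kappa>_def)
        qed
        then have "\<forall>\<^sub>F n in sequentially. \<kappa> n x = 0" unfolding eventually_sequentially by blast
        then show ?thesis using nF by (simp add: tendsto_eventually)
      qed
      have "(\<lambda>n. \<integral>\<omega>. \<kappa> n (Z G \<omega>) * ?f \<omega> \<partial>M) \<longlonglongrightarrow> (\<integral>\<omega>. indicator F (Z G \<omega>) * ?f \<omega> \<partial>M)"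
      proof (rule integral_dominated_convergence[OF _ _ integrable_norm[OF int]])
        show "AE \<omega> in M. (\<lambda>n. \<kappa> n (Z G \<omega>) * ?f \<omega>) \<longlonglongrightarrow> indicator F (Z G \<omega>) * ?f \<omega>"
          by (intro AE_I2 tendsto_mult lim tendsto_const)
        show "AE \<omega> in M. norm (\<kappa> n (Z G \<omega>) * ?f \<omega>) \<le> norm (?f \<omega>)" for n
          using k by (intro AE_I2) (simp add: abs_mult mult_left_le_one_le)
      qed measurable
      moreover have "(\<integral>\<omega>. \<kappa> n (Z G \<omega>) * ?f \<omega> \<partial>M) = 0" for n
        by (rule first_order_equation[OF dG kc k, where R = "real n + 1"]) (simp add: \<kappa>_def cutoff(3))
      ultimately show ?thesis by (simp add: LIMSEQ_const_iff)
    qed simp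
  qed
qed

end

section \<open>Weak duality and optimality\<close>

context prob_space
begin

text \<open>Written in coordinates, the integrand is a sum of functions of \<open>X\<close> times
  components of \<open>Y\<close>, each a product of square integrable factors, so the conditional
  expectation can be tested term by term.\<close>

lemma martingale_Sform:
  fixes X Y :: "'a \<Rightarrow> real^'n::finite" and S :: "real^'n^'n"
  assumes X: "L2vec M X" and Y: "L2vec M Y" and h: "h \<in> borel_measurable borel" "L2vec M (\<lambda>\<omega>. h (X \<omega>))"
    and ce: "\<And>i. AE \<omega> in M. real_cond_exp M (vimage_algebra (space M) X borel) (\<lambda>\<omega>. Y \<omega> $ i) \<omega> = X \<omega> $ i"
    and sym: "transpose S = S"
  shows "(\<integral>\<omega>. Sform S (h (X \<omega>)) (Y \<omega>) \<partial>M) = (\<integral>\<omega>. Sform S (h (X \<omega>)) (X \<omega>) \<partial>M)"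
proof -
  note [measurable] = h(1) L2vecD(1)[OF X] L2vecD(1)[OF Y]
  define k where "k = (\<lambda>i x. (S *v h x) $ i)"
  have Sm: "(\<lambda>x. S *v h x) \<in> borel_measurable borel"
    by (rule measurable_compose[OF h(1) borel_measurable_continuous_onI])
       (intro linear_continuous_on matrix_vector_mul_bounded_linear)
  then have km[measurable]: "k i \<in> borel_measurable borel" for i
    unfolding k_def by measurable
  have SF: "Sform S (h x) y = (\<Sum>i\<in>UNIV. k i x * y $ i)" for x y
  proof -
    have "Sform S (h x) y = (S *v h x) \<bullet> y"
      unfolding Sform_def by (metis dot_lmul_matrix sym transpose_matrix_vector)
    then show ?thesis by (simp add: inner_vec_def k_def)
  qed
  obtain C where C: "C > 0" "\<And>x. norm (S *v x) \<le> norm x * C"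
    using bounded_linear.pos_bounded[OF matrix_vector_mul_bounded_linear[of S]] by blast
  have int: "integrable M (\<lambda>\<omega>. k i (X \<omega>) * W \<omega> $ i)" if W: "L2vec M W" for W :: "'a \<Rightarrow> real^'n" and i
  proof (rule L2vec_integrable_mult[OF h(2) W, where C = C])
    note [measurable] = L2vecD(1)[OF W]
    show "(\<lambda>\<omega>. k i (X \<omega>) * W \<omega> $ i) \<in> borel_measurable M" by measurable
    show "\<bar>k i (X \<omega>) * W \<omega> $ i\<bar> \<le> C * norm (h (X \<omega>)) * norm (W \<omega>)" for \<omega>
    proof -
      have "\<bar>k i (X \<omega>)\<bar> \<le> C * norm (h (X \<omega>))"
        unfolding k_def using component_le_norm_cart[of "S *v h (X \<omega>)" i] C(2)[of "h (X \<omega>)"]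
        by (simp add: mult.commute)
      then show ?thesis unfolding abs_mult using C(1)
        by (intro mult_mono component_le_norm_cart) auto
    qed
  qed (use C in simp)
  have "(\<integral>\<omega>. Sform S (h (X \<omega>)) (Y \<omega>) \<partial>M) = (\<Sum>i\<in>UNIV. \<integral>\<omega>. k i (X \<omega>) * Y \<omega> $ i \<partial>M)"
    unfolding SF using int[OF Y] by (simp add: Bochner_Integration.integral_sum)
  also have "\<dots> = (\<Sum>i\<in>UNIV. \<integral>\<omega>. k i (X \<omega>) * X \<omega> $ i \<partial>M)"
    using real_cond_exp_vimage_test(2)[OF _ km _ ce _ int[OF Y]] by (intro sum.cong refl) simp
  also have "\<dots> = (\<integral>\<omega>. Sform S (h (X \<omega>)) (X \<omega>) \<partial>M)"
    unfolding SF using int[OF X] by (simp add: Bochner_Integration.integral_sum)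
  finally show ?thesis .
qed

end

context transport
begin

text \<open>Replacing \<open>x\<close> by the point of \<^term>\<open>G\<close> with the same positive part loses nothing: \<^term>\<open>psi\<close> is tested
  against that point, and the error \<^term>\<open>qform S\<close> of a purely negative vector has the favourable sign.\<close>

lemma weak_duality:
  fixes N :: "'b measure" and X' Y' :: "'b \<Rightarrow> real^'n"
  assumes dG: "dual_optimal S (distr M borel Y) G" and N: "prob_space N"
    and X': "L2vec N X'" and Y': "L2vec N Y'" and law: "distr N borel Y' = distr M borel Y"
    and ce: "\<And>i. AE \<omega> in N. real_cond_exp N (vimage_algebra (space N) X' borel) (\<lambda>\<omega>. Y' \<omega> $ i) \<omega> = X' \<omega> $ i"
  defines "V \<equiv> \<integral>\<omega>. ell S (Z G \<omega>) (Y \<omega>) \<partial>M"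
  shows "(\<integral>\<omega>. Sform S (X' \<omega>) (Y' \<omega>) \<partial>N) / 2 \<le> V"
    and "(\<integral>\<omega>. Sform S (X' \<omega>) (Y' \<omega>) \<partial>N) / 2 = V \<Longrightarrow> AE \<omega> in N. X' \<omega> = proj_point S G (Y' \<omega>)"
proof -
  note G = dual_optimalD(1)[OF dG]
  interpret N: prob_space N by fact
  note [measurable] = L2vecD(1)[OF X'] L2vecD(1)[OF Y'] borel_measurable_proj_point[OF G]
  let ?\<xi> = "section_of G"
  define r where "r = (\<lambda>y. ell S (proj_point S G y) y)"
  have rm[measurable]: "r \<in> borel_measurable borel" unfolding r_def by measurable
  have [measurable]: "?\<xi> \<in> borel_measurable borel"
    by (rule borel_measurable_continuous_onI) (rule section_of_continuous[OF G])
  have "integrable (distr M borel Y) r"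
    using AE_dual_optimal(2)[OF dG] by (subst integrable_distr_eq) (auto simp: r_def)
  then have int_r: "integrable N (\<lambda>\<omega>. r (Y' \<omega>))" unfolding law[symmetric]
    by (subst (asm) integrable_distr_eq) auto
  have V: "(\<integral>\<omega>. r (Y' \<omega>) \<partial>N) = V"
    using integral_distr[of Y' N borel r] integral_distr[of Y M borel r] law by (simp add: V_def r_def)
  \<comment> \<open>Uniqueness of the maximiser is an event about the value of \<open>Y\<close>
    only, so the common law carries it to \<open>Y'\<close> on another probability space.\<close>
  have "AE y in distr M borel Y. \<exists>z. PG S G y = {z}"
  proof (subst AE_distr_iff)
    show "AE \<omega> in M. \<exists>z. PG S G (Y \<omega>) = {z}"
      using AE_dual_optimal(1)[OF dG] by (rule eventually_mono) blast
  qed (use borel_PG_singleton[OF G] in auto)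
  then have single: "AE \<omega> in N. \<exists>z. PG S G (Y' \<omega>) = {z}"
    unfolding law[symmetric]
    by (rule AE_distr_iff[THEN iffD1, rotated 2]) (use borel_PG_singleton[OF G] in simp_all)
  have PGr: "PG S G y = {proj_point S G y}" if "\<exists>z. PG S G y = {z}" for y
    using that unfolding proj_point_def by (elim exE) simp
  have L2\<xi>: "L2vec N (\<lambda>\<omega>. ?\<xi> (X' \<omega>))"
  proof -
    obtain L where L: "L > 0" "\<And>z z'. norm (?\<xi> z - ?\<xi> z') \<le> L * norm (z - z')"
      using section_of_Lipschitz[OF G] by blast
    show ?thesis
    proof (rule L2vec_dominated[OF N.finite_measure_axioms X', where a = "norm (?\<xi> 0)" and b = L])
      show "norm (?\<xi> (X' \<omega>)) \<le> norm (?\<xi> 0) + L * norm (X' \<omega>)" for \<omega>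
        using L(2)[of "X' \<omega>" 0] norm_triangle_ineq2[of "?\<xi> (X' \<omega>)" "?\<xi> 0"] by simp
    qed measurable
  qed
  have L2d: "L2vec N (\<lambda>\<omega>. X' \<omega> - ?\<xi> (X' \<omega>))"
  proof -
    obtain L where L: "L > 0" "\<And>z z'. norm (?\<xi> z - ?\<xi> z') \<le> L * norm (z - z')"
      using section_of_Lipschitz[OF G] by blast
    show ?thesis
    proof (rule L2vec_dominated[OF N.finite_measure_axioms X', where a = "norm (?\<xi> 0)" and b = "L + 1"])
      show "norm (X' \<omega> - ?\<xi> (X' \<omega>)) \<le> norm (?\<xi> 0) + (L + 1) * norm (X' \<omega>)" for \<omega>
        using L(2)[of "X' \<omega>" 0] norm_triangle_ineq2[of "?\<xi> (X' \<omega>)" "?\<xi> 0"]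
          norm_triangle_ineq4[of "X' \<omega>" "?\<xi> (X' \<omega>)"] by (simp add: distrib_right)
    qed measurable
  qed
  \<comment> \<open>Two nonnegative losses: \<open>g1\<close> measures how far the point of
    \<open>G\<close> is from being a maximiser for \<open>Y'\<close>, and \<open>g2\<close> how far
    \<open>X'\<close> is from that point.\<close>
  define g1 where "g1 = (\<lambda>\<omega>. r (Y' \<omega>) - ell S (?\<xi> (X' \<omega>)) (Y' \<omega>))"
  define g2 where "g2 = (\<lambda>\<omega>. - qform S (X' \<omega> - ?\<xi> (X' \<omega>)))"
  have g1i: "integrable N g1"
    unfolding g1_def by (intro Bochner_Integration.integrable_diff int_r L2vec_integrable_ell L2\<xi> Y')
  have g2i: "integrable N g2"
    unfolding g2_def by (intro integrable_minus L2vec_integrable_qform L2d)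
  have g1p: "AE \<omega> in N. 0 \<le> g1 \<omega>"
    using single
  proof eventually_elim
    case (elim \<omega>)
    have "proj_point S G (Y' \<omega>) \<in> PG S G (Y' \<omega>)" by (subst PGr[OF elim]) simp
    then show ?case using section_of(1)[OF G, of "X' \<omega>"] by (auto simp: g1_def r_def PG_ell)
  qed
  have Pd: "P (x - ?\<xi> x) = 0" for x using section_of(2)[OF G, of x] by (simp add: P_diff)
  have g2p: "0 \<le> g2 \<omega>" for \<omega>
    using qform_ker_nonpos[OF Pd] by (simp add: g2_def)
  \<comment> \<open>The martingale property replaces \<open>Y'\<close> by \<open>X'\<close>, after
    which completing the square produces \<open>qform S (X' \<omega>)\<close> and the loss
    \<open>g2\<close>.\<close>
  have "(\<integral>\<omega>. ell S (?\<xi> (X' \<omega>)) (Y' \<omega>) \<partial>N) = (\<integral>\<omega>. ell S (?\<xi> (X' \<omega>)) (X' \<omega>) \<partial>N)"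
    unfolding ell_def
    using N.martingale_Sform[OF X' Y' _ L2\<xi> ce symS]
      L2vec_integrable_Sform[OF L2\<xi> Y', of S] L2vec_integrable_Sform[OF L2\<xi> X', of S]
      L2vec_integrable_Sform[OF L2\<xi> L2\<xi>, of S] by simp
  also have "\<dots> = (\<integral>\<omega>. qform S (X' \<omega>) + g2 \<omega> \<partial>N)"
    by (simp add: ell_qform g2_def)
  also have "\<dots> = (\<integral>\<omega>. qform S (X' \<omega>) \<partial>N) + (\<integral>\<omega>. g2 \<omega> \<partial>N)"
    by (intro Bochner_Integration.integral_add L2vec_integrable_qform X' g2i)
  also have "(\<integral>\<omega>. qform S (X' \<omega>) \<partial>N) = (\<integral>\<omega>. Sform S (X' \<omega>) (Y' \<omega>) \<partial>N) / 2"
    unfolding qform_def using N.martingale_Sform[OF X' Y' _ _ ce symS, of "\<lambda>x. x"] X' by simp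
  finally have gap: "V = (\<integral>\<omega>. Sform S (X' \<omega>) (Y' \<omega>) \<partial>N) / 2 + ((\<integral>\<omega>. g1 \<omega> \<partial>N) + (\<integral>\<omega>. g2 \<omega> \<partial>N))"
    unfolding g1_def using int_r L2vec_integrable_ell[OF L2\<xi> Y', of S] V by simp
  have i: "0 \<le> (\<integral>\<omega>. g1 \<omega> \<partial>N)" "0 \<le> (\<integral>\<omega>. g2 \<omega> \<partial>N)"
    using g1p g2p by (auto intro: integral_nonneg_AE)
  then show "(\<integral>\<omega>. Sform S (X' \<omega>) (Y' \<omega>) \<partial>N) / 2 \<le> V" using gap by linarith
  assume eq: "(\<integral>\<omega>. Sform S (X' \<omega>) (Y' \<omega>) \<partial>N) / 2 = V"
  then have "(\<integral>\<omega>. g1 \<omega> \<partial>N) = 0" "(\<integral>\<omega>. g2 \<omega> \<partial>N) = 0" using gap i by linarith+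
  then have "AE \<omega> in N. g1 \<omega> = 0" "AE \<omega> in N. g2 \<omega> = 0"
    using integral_nonneg_eq_0_iff_AE[OF g1i g1p] integral_nonneg_eq_0_iff_AE[OF g2i] g2p by auto
  \<comment> \<open>\<open>g2 = 0\<close> puts \<open>X'\<close> on \<open>G\<close>, then
    \<open>g1 = 0\<close> makes it a maximiser for \<open>Y'\<close>, and the maximiser is
    unique.\<close>
  with single show "AE \<omega> in N. X' \<omega> = proj_point S G (Y' \<omega>)"
  proof eventually_elim
    case (elim \<omega>)
    then have "X' \<omega> - ?\<xi> (X' \<omega>) = 0" by (intro qform_ker_eq0[OF Pd]) (simp add: g2_def)
    then have X\<xi>: "?\<xi> (X' \<omega>) = X' \<omega>" by simp
    then have XG: "X' \<omega> \<in> G" using section_of(1)[OF G, of "X' \<omega>"] by simp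
    have p: "proj_point S G (Y' \<omega>) \<in> PG S G (Y' \<omega>)" by (subst PGr[OF elim(1)]) simp
    have "ell S (X' \<omega>) (Y' \<omega>) = ell S (proj_point S G (Y' \<omega>)) (Y' \<omega>)"
      using elim X\<xi> by (simp add: g1_def r_def)
    then have "X' \<omega> \<in> PG S G (Y' \<omega>)" using p XG by (simp add: PG_ell)
    then show ?case unfolding PGr[OF elim(1)] by simp
  qed
qed

section \<open>Attainment of the dual bound by maps and plans\<close>

lemma Z_cond_exp:
  assumes dG: "dual_optimal S (distr M borel Y) G"
  shows "AE \<omega> in M. real_cond_exp M (vimage_algebra (space M) (Z G) borel) (\<lambda>\<omega>. Y \<omega> $ i) \<omega> = Z G \<omega> $ i"
proof -
  note Zm = Z_measurable[OF dual_optimalD(1)[OF dG]]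
  show ?thesis
    using Z_martingale[OF dG]
    by (subst real_cond_exp_vimage_iff[OF Zm, where g = "\<lambda>x. x $ i"])
      (auto intro!: L2vec_integrable_component finite_measure_axioms L2Y Z_L2[OF dG])
qed

text \<open>Absence of a duality gap: by the martingale property the integral of
  \<open>Sform S (Z G \<omega>) (Z G \<omega>)\<close> equals that of
  \<open>Sform S (Z G \<omega>) (Y \<omega>)\<close>.\<close>

lemma Z_value:
  assumes dG: "dual_optimal S (distr M borel Y) G"
  shows "(\<integral>\<omega>. Sform S (Z G \<omega>) (Y \<omega>) \<partial>M) / 2 = (\<integral>\<omega>. ell S (Z G \<omega>) (Y \<omega>) \<partial>M)"
proof -
  note Z2 = Z_L2[OF dG]
  have "(\<integral>\<omega>. Sform S (Z G \<omega>) (Y \<omega>) \<partial>M) = (\<integral>\<omega>. Sform S (Z G \<omega>) (Z G \<omega>) \<partial>M)"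
    using martingale_Sform[OF Z2 L2Y _ _ Z_cond_exp[OF dG] symS, of "\<lambda>x. x"] Z2 by simp
  then show ?thesis
    unfolding ell_def using L2vec_integrable_Sform[OF Z2 L2Y, of S] L2vec_integrable_Sform[OF Z2 Z2, of S] by simp
qed

lemma Z_optimal_map:
  assumes dG: "dual_optimal S (distr M borel Y) G"
  shows "optimal_map M S Y (Z G)"
    and "optimal_map M S Y X' \<Longrightarrow> AE \<omega> in M. X' \<omega> = Z G \<omega>"
proof -
  note G = dual_optimalD(1)[OF dG]
  have "Y \<in> measurable (vimage_algebra (space M) Y borel) borel" by (rule measurable_vimage_algebra1) auto
  then have "Z G \<in> borel_measurable (vimage_algebra (space M) Y borel)"
    by (rule measurable_compose[OF _ borel_measurable_proj_point[OF G]])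
  then have ZX: "Z G \<in> Xset M Y"
    using Z_L2[OF dG] Z_cond_exp[OF dG] by (simp add: Xset_def cond_exp_self_def)
  have wd: "(\<integral>\<omega>. Sform S (X' \<omega>) (Y \<omega>) \<partial>M) / 2 \<le> (\<integral>\<omega>. Sform S (Z G \<omega>) (Y \<omega>) \<partial>M) / 2"
      "(\<integral>\<omega>. Sform S (X' \<omega>) (Y \<omega>) \<partial>M) / 2 = (\<integral>\<omega>. Sform S (Z G \<omega>) (Y \<omega>) \<partial>M) / 2 \<Longrightarrow> AE \<omega> in M. X' \<omega> = Z G \<omega>"
    if "X' \<in> Xset M Y" for X'
  proof -
    have "L2vec M X'" and ce: "\<And>i. AE \<omega> in M. real_cond_exp M (vimage_algebra (space M) X' borel) (\<lambda>\<omega>. Y \<omega> $ i) \<omega> = X' \<omega> $ i"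
      using that by (auto simp: Xset_def cond_exp_self_def)
    note w = weak_duality[OF dG prob_space_axioms this(1) L2Y refl ce]
    show "(\<integral>\<omega>. Sform S (X' \<omega>) (Y \<omega>) \<partial>M) / 2 \<le> (\<integral>\<omega>. Sform S (Z G \<omega>) (Y \<omega>) \<partial>M) / 2"
      unfolding Z_value[OF dG] by (rule w(1))
    show "AE \<omega> in M. X' \<omega> = Z G \<omega>"
      if "(\<integral>\<omega>. Sform S (X' \<omega>) (Y \<omega>) \<partial>M) / 2 = (\<integral>\<omega>. Sform S (Z G \<omega>) (Y \<omega>) \<partial>M) / 2"
      using that unfolding Z_value[OF dG] by (rule w(2))
  qed
  show opt: "optimal_map M S Y (Z G)" unfolding optimal_map_def using ZX wd(1) by blast
  assume X': "optimal_map M S Y X'"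
  then have m: "X' \<in> Xset M Y" by (simp add: optimal_map_def)
  show "AE \<omega> in M. X' \<omega> = Z G \<omega>"
    using X' ZX wd(1)[OF m] by (intro wd(2)[OF m] antisym) (auto simp: optimal_map_def)
qed

text \<open>Reads a plan as a pair of random vectors on its own probability space, the form in which
  \<open>weak_duality\<close> covers maps and plans alike.\<close>

lemma GammaD:
  fixes \<nu> :: "(real^'n) measure"
  assumes "\<gamma> \<in> Gamma \<nu>"
  shows "prob_space \<gamma>" "sets \<gamma> = sets borel" "L2vec \<gamma> fst" "L2vec \<gamma> snd" "distr \<gamma> borel snd = \<nu>"
    "\<And>i. AE p in \<gamma>. real_cond_exp \<gamma> (vimage_algebra (space \<gamma>) fst borel) (\<lambda>p. snd p $ i) p = fst p $ i"
proof -
  show 1: "prob_space \<gamma>" and s: "sets \<gamma> = sets borel" and "distr \<gamma> borel snd = \<nu>"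
    "\<And>i. AE p in \<gamma>. real_cond_exp \<gamma> (vimage_algebra (space \<gamma>) fst borel) (\<lambda>p. snd p $ i) p = fst p $ i"
    using assms by (auto simp: Gamma_def)
  have fin: "(\<integral>\<^sup>+p. ennreal ((norm (fst p))\<^sup>2 + (norm (snd p))\<^sup>2) \<partial>\<gamma>) < \<infinity>"
    using assms by (simp add: Gamma_def)
  have "fst \<in> borel_measurable (borel :: ((real^'n) \<times> (real^'n)) measure)"
    "snd \<in> borel_measurable (borel :: ((real^'n) \<times> (real^'n)) measure)"
    by (intro borel_measurable_continuous_onI continuous_intros)+
  then have m[measurable]: "fst \<in> borel_measurable \<gamma>" "snd \<in> borel_measurable \<gamma>"
    using measurable_cong_sets[OF s refl] by blast+
  have int: "integrable \<gamma> (\<lambda>p. (norm (fst p))\<^sup>2 + (norm (snd p))\<^sup>2)"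
    using fin by (intro integrableI_bounded) auto
  have "integrable \<gamma> (\<lambda>p. (norm (fst p))\<^sup>2)" "integrable \<gamma> (\<lambda>p. (norm (snd p))\<^sup>2)"
    by (rule Bochner_Integration.integrable_bound[OF int]; force)+
  then show "L2vec \<gamma> fst" "L2vec \<gamma> snd" using m by (auto simp: L2vec_def)
qed

lemma Z_optimal_plan:
  assumes dG: "dual_optimal S (distr M borel Y) G"
  defines "\<gamma>0 \<equiv> distr M borel (\<lambda>\<omega>. (Z G \<omega>, Y \<omega>))"
  shows "optimal_plan (distr M borel Y) S \<gamma>0"
    and "optimal_plan (distr M borel Y) S \<gamma> \<Longrightarrow> \<gamma> = \<gamma>0"
proof -
  note G = dual_optimalD(1)[OF dG]
  note Z2 = Z_L2[OF dG]
  note [measurable] = Z_measurable[OF G] borel_measurable_proj_point[OF G]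
  have fs[measurable]: "fst \<in> borel_measurable (borel :: ((real^'n) \<times> (real^'n)) measure)"
    "snd \<in> borel_measurable (borel :: ((real^'n) \<times> (real^'n)) measure)"
    by (intro borel_measurable_continuous_onI continuous_intros)+
  have pm[measurable]: "(\<lambda>\<omega>. (Z G \<omega>, Y \<omega>)) \<in> borel_measurable M" by measurable
  have ps: "prob_space \<gamma>0" unfolding \<gamma>0_def by (rule prob_space_distr) measurable
  interpret g: prob_space \<gamma>0 by fact
  have sg[simp]: "sets \<gamma>0 = sets borel" "space \<gamma>0 = UNIV" by (auto simp: \<gamma>0_def)
  have fm[measurable]: "fst \<in> borel_measurable \<gamma>0" "snd \<in> borel_measurable \<gamma>0"
    unfolding \<gamma>0_def by auto
  have mom: "(\<integral>\<^sup>+p. ennreal ((norm (fst p))\<^sup>2 + (norm (snd p))\<^sup>2) \<partial>\<gamma>0) < \<infinity>"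
  proof -
    have "integrable M (\<lambda>\<omega>. (norm (Z G \<omega>))\<^sup>2 + (norm (Y \<omega>))\<^sup>2)"
      using L2vecD(2)[OF Z2] L2vecD(2)[OF L2Y] by simp
    then have "(\<integral>\<^sup>+\<omega>. ennreal ((norm (Z G \<omega>))\<^sup>2 + (norm (Y \<omega>))\<^sup>2) \<partial>M) < \<infinity>"
      by (simp add: real_integrable_def less_top)
    then show ?thesis unfolding \<gamma>0_def by (subst nn_integral_distr) auto
  qed
  have marg: "distr \<gamma>0 borel snd = distr M borel Y"
    unfolding \<gamma>0_def by (subst distr_distr) (auto simp: comp_def)
  have ce: "AE p in \<gamma>0. real_cond_exp \<gamma>0 (vimage_algebra (space \<gamma>0) fst borel) (\<lambda>p. snd p $ i) p = fst p $ i" for i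
  proof -
    have int: "integrable \<gamma>0 (\<lambda>p. snd p $ i)" "integrable \<gamma>0 (\<lambda>p. fst p $ i)"
      unfolding \<gamma>0_def
      by (subst integrable_distr_eq;
          auto intro!: L2vec_integrable_component finite_measure_axioms L2Y Z2)+
    have "(\<integral>p. indicator A (fst p) * (snd p $ i - fst p $ i) \<partial>\<gamma>0) = 0" if A: "A \<in> sets borel" for A
    proof -
      have [measurable]: "A \<in> sets borel" by fact
      show ?thesis unfolding \<gamma>0_def by (subst integral_distr) (auto simp: Z_martingale[OF dG A])
    qed
    then show ?thesis using int by (subst g.real_cond_exp_vimage_iff[where g = "\<lambda>x. x $ i"]) auto
  qed
  have g0: "\<gamma>0 \<in> Gamma (distr M borel Y)"
    unfolding Gamma_def using ps mom marg ce by simp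
  have val: "(\<integral>p. Sform S (fst p) (snd p) \<partial>\<gamma>0) = (\<integral>\<omega>. Sform S (Z G \<omega>) (Y \<omega>) \<partial>M)"
    unfolding \<gamma>0_def by (subst integral_distr) auto
  have wd: "(\<integral>p. Sform S (fst p) (snd p) \<partial>\<gamma>') / 2 \<le> (\<integral>p. Sform S (fst p) (snd p) \<partial>\<gamma>0) / 2"
      "(\<integral>p. Sform S (fst p) (snd p) \<partial>\<gamma>') / 2 = (\<integral>p. Sform S (fst p) (snd p) \<partial>\<gamma>0) / 2 \<Longrightarrow>
         AE p in \<gamma>'. fst p = proj_point S G (snd p)"
    if "\<gamma>' \<in> Gamma (distr M borel Y)" for \<gamma>'
  proof -
    note g' = GammaD[OF that]
    note w = weak_duality[OF dG g'(1,3,4,5,6)]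
    show "(\<integral>p. Sform S (fst p) (snd p) \<partial>\<gamma>') / 2 \<le> (\<integral>p. Sform S (fst p) (snd p) \<partial>\<gamma>0) / 2"
      unfolding val Z_value[OF dG] by (rule w(1))
    show "AE p in \<gamma>'. fst p = proj_point S G (snd p)"
      if "(\<integral>p. Sform S (fst p) (snd p) \<partial>\<gamma>') / 2 = (\<integral>p. Sform S (fst p) (snd p) \<partial>\<gamma>0) / 2"
      using that unfolding val Z_value[OF dG] by (rule w(2))
  qed
  show "optimal_plan (distr M borel Y) S \<gamma>0" unfolding optimal_plan_def using g0 wd(1) by blast
  assume opt: "optimal_plan (distr M borel Y) S \<gamma>"
  then have g: "\<gamma> \<in> Gamma (distr M borel Y)" by (simp add: optimal_plan_def)
  note g' = GammaD[OF g]
  have ae: "AE p in \<gamma>. fst p = proj_point S G (snd p)"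
    using opt g0 wd(1)[OF g] by (intro wd(2)[OF g] antisym) (auto simp: optimal_plan_def)
  \<comment> \<open>An optimal plan is concentrated on the graph of \<open>proj_point S G\<close>,
    so it is the image of its prescribed second marginal under \<open>f\<close>.\<close>
  define f where "f = (\<lambda>y. (proj_point S G y, y))"
  have f: "f \<in> measurable borel borel" unfolding f_def by measurable
  note sm = L2vecD(1)[OF g'(4)]
  have "\<gamma> = distr \<gamma> borel (\<lambda>p. p)" using distr_id2[OF g'(2)[symmetric]] by (simp add: id_def)
  also have "\<dots> = distr \<gamma> borel (\<lambda>p. f (snd p))"
  proof (rule distr_cong_AE)
    show "AE p in \<gamma>. p = f (snd p)" using ae by (rule eventually_mono) (simp add: f_def prod_eq_iff)
    show "(\<lambda>p. p) \<in> measurable \<gamma> borel" using measurable_ident_sets[OF g'(2)] by (simp add: id_def)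
    show "(\<lambda>p. f (snd p)) \<in> measurable \<gamma> borel" by (rule measurable_compose[OF sm f])
  qed auto
  also have "\<dots> = distr (distr \<gamma> borel snd) borel f"
    using distr_distr[OF f sm] by (simp add: comp_def)
  also have "\<dots> = \<gamma>0" unfolding g'(5) \<gamma>0_def using distr_distr[OF f Y_measurable] by (simp add: comp_def f_def)
  finally show "\<gamma> = \<gamma>0" .
qed

end

theorem theorem7:
  fixes S :: "real^'n::finite^'n" and m :: nat and M :: "'a measure" and Y :: "'a \<Rightarrow> real^'n"
  assumes "S \<in> Sdm m"
    and "prob_space M"
    and "L2vec M Y"
    and "interior (convex hull (msupp (distr M borel Y))) \<noteq> {}"
    and A4: "\<And>j C h. compact C \<Longrightarrow> C \<subseteq> {x. x $ j = 1 \<and> Sform S x x \<ge> 0} \<Longrightarrow>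
               h \<in> Hfam j C \<Longrightarrow> AE \<omega> in M. h (S *v Y \<omega>) \<noteq> 0"
  shows "(\<forall>G\<in>maxmon S. ext_int M (\<lambda>\<omega>. psi S G (Y \<omega>)) < \<infinity> \<longrightarrow>
            (AE y in distr M borel Y. y \<notin> SigmaP S G))
       \<and> (\<forall>G. dual_optimal S (distr M borel Y) G \<longrightarrow>
            optimal_map M S Y (mapX S G Y)
            \<and> (\<forall>X'. optimal_map M S Y X' \<longrightarrow> (AE \<omega> in M. X' \<omega> = mapX S G Y \<omega>))
            \<and> optimal_plan (distr M borel Y) S (distr M borel (\<lambda>\<omega>. (mapX S G Y \<omega>, Y \<omega>)))
            \<and> (\<forall>\<gamma>. optimal_plan (distr M borel Y) S \<gamma> \<longrightarrow>
                   \<gamma> = distr M borel (\<lambda>\<omega>. (mapX S G Y \<omega>, Y \<omega>))))"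
proof -
  obtain P c where "pseudo_euclidean S P c" using Sdm_pseudo_euclidean[OF assms(1)] by blast
  then interpret pseudo_euclidean S P c .
  interpret prob_space M by fact
  interpret transport S P c M Y
    by unfold_locales (use assms(3) A4 in auto)
  have Z: "mapX S G Y = Z G" for G by (rule ext) (rule mapX_proj_point)
  show ?thesis
  proof (intro conjI ballI allI impI)
    fix G assume G: "G \<in> maxmon S"
    show "AE y in distr M borel Y. y \<notin> SigmaP S G"
      using AE_not_SigmaP[OF G] borel_SigmaP[OF G]
      by (subst AE_distr_iff) (auto simp: Compl_eq[symmetric] borel_comp)
  next
    fix G assume "dual_optimal S (distr M borel Y) G"
    then show "optimal_map M S Y (mapX S G Y)"
      "optimal_plan (distr M borel Y) S (distr M borel (\<lambda>\<omega>. (mapX S G Y \<omega>, Y \<omega>)))"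
      unfolding Z using Z_optimal_map(1) Z_optimal_plan(1) by blast+
  next
    fix G X' assume "dual_optimal S (distr M borel Y) G" "optimal_map M S Y X'"
    then show "AE \<omega> in M. X' \<omega> = mapX S G Y \<omega>" unfolding Z by (rule Z_optimal_map(2))
  next
    fix G \<gamma> assume "dual_optimal S (distr M borel Y) G" "optimal_plan (distr M borel Y) S \<gamma>"
    then show "\<gamma> = distr M borel (\<lambda>\<omega>. (mapX S G Y \<omega>, Y \<omega>))" unfolding Z by (rule Z_optimal_plan(2))
  qed
qed

end
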